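(* Let $X$ be a Banach space, $1<p_0<p_1<\infty$, $s_0,s_1\in\mathbb{R}$, $q\in[1,\infty]$, and $w_0(x)=|x|^{\gamma_0}$, $w_1(x)=|x|^{\gamma_1}$ with $\gamma_0\in(-d,d(p_0-1))$, $\gamma_1\in(-d,d(p_1-1))$. Suppose $\frac{\gamma_1}{p_1}\le\frac{\gamma_0}{p_0}$ and $s_0-\frac{d+\gamma_0}{p_0}\ge s_1-\frac{d+\gamma_1}{p_1}$. Then $B^{s_0}_{p_0,p_1}(\mathbb{R}^d,w_0;X)\hookrightarrow F^{s_1}_{p_1,q}(\mathbb{R}^d,w_1;X)$ and $F^{s_0}_{p_0,q}(\mathbb{R}^d,w_0;X)\hookrightarrow B^{s_1}_{p_1,p_0}(\mathbb{R}^d,w_1;X)$ continuously.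
   Context: $\|f\|_{L^p(\mathbb{R}^d,w;X)}=(\int\|f\|^pw)^{1/p}$. Fourier transform $\hat f(\xi)=(2\pi)^{-d/2}\int f(x)e^{-ix\cdot\xi}dx$ on $X$-valued tempered distributions. Fix $\varphi\in\mathcal{S}(\mathbb{R}^d)$ with $0\le\hat\varphi\le1$, $\hat\varphi=1$ on $\{|\xi|\le1\}$, $\hat\varphi=0$ on $\{|\xi|\ge3/2\}$; $\hat\varphi_0=\hat\varphi$, $\hat\varphi_k(\xi)=\hat\varphi(2^{-k}\xi)-\hat\varphi(2^{-k+1}\xi)$, $S_kf=\mathcal{F}^{-1}[\hat\varphi_k\hat f]$. $B^s_{p,q}(\mathbb{R}^d,w;X)$: tempered $f$ with $\|(2^{ks}\|S_kf\|_{L^p(w;X)})_k\|_{\ell^q}<\infty$; $F^s_{p,q}(\mathbb{R}^d,w;X)$: tempered $f$ with $\|\,\|(2^{ks}\|S_kf(\cdot)\|)_k\|_{\ell^q}\|_{L^p(\mathbb{R}^d,w)}<\infty$. *)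

theory Defs
  imports "HOL-Analysis.Analysis"
begin

section \<open>Complex Banach spaces, modelled as real Banach spaces with a complex structure\<close>

definition cscale :: "('b::real_vector \<Rightarrow> 'b) \<Rightarrow> complex \<Rightarrow> 'b \<Rightarrow> 'b" where
  "cscale J c x = Re c *\<^sub>R x + Im c *\<^sub>R J x"

definition complex_structure :: "('b::real_normed_vector \<Rightarrow> 'b) \<Rightarrow> bool" where
  "complex_structure J \<longleftrightarrow> linear J \<and> (\<forall>x. J (J x) = - x)
     \<and> (\<forall>c x. norm (cscale J c x) = cmod c * norm x)"

fun dderiv :: "'a::euclidean_space list \<Rightarrow> ('a \<Rightarrow> complex) \<Rightarrow> 'a \<Rightarrow> complex" where
  "dderiv [] f = f"
| "dderiv (v # vs) f = (\<lambda>x. frechet_derivative (dderiv vs f) (at x) v)"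

definition schwartz :: "('a::euclidean_space \<Rightarrow> complex) set" where
  "schwartz = {\<phi>. \<forall>vs. set vs \<subseteq> Basis \<longrightarrow>
      (\<forall>x. dderiv vs \<phi> differentiable (at x)) \<and>
      (\<forall>N::nat. \<exists>C. \<forall>x. (1 + norm x) ^ N * norm (dderiv vs \<phi> x) \<le> C)}"

definition sw_seminorm :: "nat \<Rightarrow> ('a::euclidean_space \<Rightarrow> complex) \<Rightarrow> real" where
  "sw_seminorm N \<phi> = (SUP vx \<in> {vs. set vs \<subseteq> Basis \<and> length vs \<le> N} \<times> UNIV.
       (1 + norm (snd vx)) ^ N * norm (dderiv (fst vx) \<phi> (snd vx)))"

definition tempered :: "('b::real_normed_vector \<Rightarrow> 'b) \<Rightarrow> (('a::euclidean_space \<Rightarrow> complex) \<Rightarrow> 'b) \<Rightarrow> bool" where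
  "tempered J T \<longleftrightarrow>
     (\<forall>\<phi> \<psi>. \<phi> \<in> schwartz \<longrightarrow> \<psi> \<in> schwartz \<longrightarrow> T (\<lambda>x. \<phi> x + \<psi> x) = T \<phi> + T \<psi>) \<and>
     (\<forall>c \<phi>. \<phi> \<in> schwartz \<longrightarrow> T (\<lambda>x. c * \<phi> x) = cscale J c (T \<phi>)) \<and>
     (\<exists>C N. \<forall>\<phi> \<in> schwartz. norm (T \<phi>) \<le> C * sw_seminorm N \<phi>)"

definition ft :: "('a::euclidean_space \<Rightarrow> complex) \<Rightarrow> 'a \<Rightarrow> complex" where
  "ft f \<xi> = complex_of_real ((2 * pi) powr (- real DIM('a) / 2)) *
      (\<integral>x. f x * exp (- (\<i> * complex_of_real (x \<bullet> \<xi>))) \<partial>lborel)"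

definition ift :: "('a::euclidean_space \<Rightarrow> complex) \<Rightarrow> 'a \<Rightarrow> complex" where
  "ift h x = complex_of_real ((2 * pi) powr (- real DIM('a) / 2)) *
      (\<integral>\<xi>. h \<xi> * exp (\<i> * complex_of_real (x \<bullet> \<xi>)) \<partial>lborel)"

definition phihat :: "('a::euclidean_space \<Rightarrow> complex) \<Rightarrow> nat \<Rightarrow> 'a \<Rightarrow> complex" where
  "phihat \<phi> k \<xi> = (if k = 0 then ft \<phi> \<xi>
      else ft \<phi> ((2 powr (- real k)) *\<^sub>R \<xi>) - ft \<phi> ((2 powr (- real k + 1)) *\<^sub>R \<xi>))"

text \<open>$S_k f = \mathcal F^{-1}[\hat\varphi_k \hat f] = (2\pi)^{-d/2}\,\varphi_k * f$ with
  $\varphi_k = \mathcal F^{-1}\hat\varphi_k$; $(\varphi_k*f)(x) = f(\varphi_k(x-\cdot))$.\<close>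
definition LP :: "('a::euclidean_space \<Rightarrow> complex) \<Rightarrow> (('a \<Rightarrow> complex) \<Rightarrow> 'b::real_normed_vector) \<Rightarrow> nat \<Rightarrow> 'a \<Rightarrow> 'b" where
  "LP \<phi> T k x = ((2 * pi) powr (- real DIM('a) / 2)) *\<^sub>R T (\<lambda>y. ift (phihat \<phi> k) (x - y))"

definition epow :: "ennreal \<Rightarrow> real \<Rightarrow> ennreal" where
  "epow x r = (if x = \<infinity> then \<infinity> else ennreal (enn2real x powr r))"

definition lq :: "ennreal \<Rightarrow> (nat \<Rightarrow> ennreal) \<Rightarrow> ennreal" where
  "lq q a = (if q = \<infinity> then (SUP k. a k)
             else epow (\<Sum>k. epow (a k) (enn2real q)) (1 / enn2real q))"

definition Lpw :: "real \<Rightarrow> real \<Rightarrow> ('a::euclidean_space \<Rightarrow> 'b::real_normed_vector) \<Rightarrow> ennreal" where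
  "Lpw p \<gamma> g = epow (\<integral>\<^sup>+x. ennreal (norm (g x) powr p * norm x powr \<gamma>) \<partial>lborel) (1 / p)"

definition besov_norm :: "('a::euclidean_space \<Rightarrow> complex) \<Rightarrow> real \<Rightarrow> real \<Rightarrow> ennreal \<Rightarrow> real
    \<Rightarrow> (('a \<Rightarrow> complex) \<Rightarrow> 'b::real_normed_vector) \<Rightarrow> ennreal" where
  "besov_norm \<phi> s p q \<gamma> T = lq q (\<lambda>k. ennreal (2 powr (real k * s)) * Lpw p \<gamma> (LP \<phi> T k))"

definition triebel_norm :: "('a::euclidean_space \<Rightarrow> complex) \<Rightarrow> real \<Rightarrow> real \<Rightarrow> ennreal \<Rightarrow> real
    \<Rightarrow> (('a \<Rightarrow> complex) \<Rightarrow> 'b::real_normed_vector) \<Rightarrow> ennreal" where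
  "triebel_norm \<phi> s p q \<gamma> T = epow (\<integral>\<^sup>+x.
      epow (lq q (\<lambda>k. ennreal (2 powr (real k * s) * norm (LP \<phi> T k x)))) p
        * ennreal (norm x powr \<gamma>) \<partial>lborel) (1 / p)"

end

theory Submission
  imports Defs "HOL-Probability.Characteristic_Functions"
begin

text \<open>Put \<open>a k = norm (S_k f)\<close>. Since \<open>S_k f\<close> is band limited, \<open>a k\<close> is pointwise dominated by its own
  convolution with the kernel \<open>2^(k d) (1 + 2^k |x|)^(-N)\<close>, uniformly in \<open>k\<close> and \<open>f\<close>. Hoelder's
  inequality against the power weight turns this into a weighted Bernstein inequality
  \<open>L^p(|x|^\<gamma>) \<rightarrow> L^r(|x|^\<sigma>)\<close> for every \<open>r \<ge> p\<close> with \<open>\<sigma>/r \<le> \<gamma>/p\<close>. For the first embedding one uses it at two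
  exponents \<open>r < p1 < \<rho>\<close> with \<open>1/r + (p1 - 1)/\<rho> = 1\<close>, in the telescoping bound
  \<open>(\<Sum>k. u k)^p1 \<le> p1 * \<Sum>k. u k * (\<Sum>j\<le>k. u j)^(p1 - 1)\<close> followed by Hoelder's inequality; this gives
  an \<open>l^p1\<close> sum of scale-invariant norms, for the smallest possible microscopic exponent \<open>q = 1\<close>.
  The argument only uses the kernel, not the band limitation, so the second embedding (with \<open>q = \<infinity>\<close>)
  follows from the first one at the dual exponents and weights, tested on the functions that norm
  \<open>a k\<close> in \<open>L^p1(|x|^\<gamma>1)\<close>.\<close>

section \<open>Integrals of power weights and of the decaying kernel\<close>

text \<open>A power weight is not translation invariant, so Young's inequality does not give the
  Bernstein estimate. What makes it work is that averaging at scale 1 turns the dual weight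
  \<open>norm y powr - \<alpha>\<close>, \<open>\<alpha> = \<gamma> / (p - 1)\<close>, into
  \<open>(1 + norm x) powr - \<alpha>\<close>: the singularity at the origin is smoothed out. This
  uses \<open>\<alpha> < d\<close>, which is the upper bound on the weight exponent at the source.
  At the target only local integrability \<open>- d < \<sigma>\<close> enters, and dilation gives
  all scales because powers are homogeneous. Bernstein at the exponent \<open>p1\<close> alone,
  followed by the triangle inequality, would sum the blocks in l^1 only. Below \<open>p1\<close> the
  scale-invariant bounds lose a power of \<open>2^k\<close>, above \<open>p1\<close> they gain one;
  the two cancel for equal indices, and the gap between the exponents leaves geometric decay in
  \<open>k - j\<close> for blocks \<open>j \<le> k\<close>. This plays the part that real
  interpolation plays in other proofs of such embeddings. The duality is applied to the scalar
  functions \<open>a k\<close> and the symmetric kernel, so that the dual space of X never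
  appears.\<close>

lemma nn_integral_lborel_scale:
  fixes f :: "'a::euclidean_space \<Rightarrow> ennreal"
  assumes [measurable]: "f \<in> borel_measurable borel" and c: "c \<noteq> 0"
  shows "(\<integral>\<^sup>+x. f x \<partial>lborel) = ennreal (\<bar>c\<bar> ^ DIM('a)) * (\<integral>\<^sup>+x. f (t + c *\<^sub>R x) \<partial>lborel)"
  by (subst lborel_affine[OF c, of t])
     (simp add: nn_integral_density nn_integral_distr nn_integral_cmult)

lemma lborel_integrable_scale:
  fixes f :: "'a::euclidean_space \<Rightarrow> 'b::{banach, second_countable_topology}"
  assumes f: "integrable lborel f" and c: "c \<noteq> 0"
  shows "integrable lborel (\<lambda>x. f (t + c *\<^sub>R x))"
proof -
  have [measurable]: "f \<in> borel_measurable borel" using f by auto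
  have "(\<integral>\<^sup>+x. norm (f x) \<partial>lborel) < \<infinity>"
    using f by (simp add: integrable_iff_bounded)
  then have "ennreal (\<bar>c\<bar> ^ DIM('a)) * (\<integral>\<^sup>+x. norm (f (t + c *\<^sub>R x)) \<partial>lborel) < \<infinity>"
    by (subst (asm) nn_integral_lborel_scale[OF _ c, of _ t]) auto
  then have "(\<integral>\<^sup>+x. norm (f (t + c *\<^sub>R x)) \<partial>lborel) < \<infinity>"
    using c by (auto simp: ennreal_mult_less_top)
  then show ?thesis by (simp add: integrable_iff_bounded)
qed

lemma lborel_integral_scale:
  fixes f :: "'a::euclidean_space \<Rightarrow> 'b::{banach, second_countable_topology}"
  assumes f: "integrable lborel f" and c: "c \<noteq> 0"
  shows "(\<integral>x. f x \<partial>lborel) = (\<bar>c\<bar> ^ DIM('a)) *\<^sub>R (\<integral>x. f (t + c *\<^sub>R x) \<partial>lborel)"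
proof -
  have [measurable]: "f \<in> borel_measurable borel" using f by auto
  show ?thesis
    using lborel_integrable_scale[OF f c, of t]
    by (subst lborel_affine[OF c, of t]) (simp add: integral_density integral_distr)
qed

lemma nn_integral_lborel_reflect:
  fixes f :: "'a::euclidean_space \<Rightarrow> ennreal"
  assumes "f \<in> borel_measurable borel"
  shows "(\<integral>\<^sup>+x. f (t - x) \<partial>lborel) = (\<integral>\<^sup>+x. f x \<partial>lborel)"
  using nn_integral_lborel_scale[OF assms, of "-1" t] by simp

text \<open>Stands in for polar coordinates: comparison with a step function on balls turns the
  integrability of a radial power into the convergence of a series. The origin is exempt because no
  smallest dyadic ball contains it.\<close>

lemma nn_integral_dyadic_balls:
  fixes f :: "'a::euclidean_space \<Rightarrow> ennreal"
  assumes f: "\<And>y. y \<noteq> 0 \<Longrightarrow> f y \<le> (\<Sum>j. ennreal (c j) * indicator (ball 0 (r j)) y)"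
    and c: "\<And>j. 0 \<le> c j" and r: "\<And>j. 0 \<le> r j" and s: "summable (\<lambda>j. c j * r j ^ DIM('a))"
  shows "\<exists>C\<ge>0. (\<integral>\<^sup>+y. f y \<partial>lborel) \<le> ennreal C"
proof (intro exI conjI)
  let ?v = "unit_ball_vol (DIM('a))"
  have v: "0 \<le> ?v" by simp
  have s': "summable (\<lambda>j. c j * (?v * r j ^ DIM('a)))"
    using summable_mult[OF s, of ?v] by (simp add: mult.left_commute)
  show "0 \<le> (\<Sum>j. c j * (?v * r j ^ DIM('a)))"
    using c r v by (intro suminf_nonneg s') simp
  have [measurable]: "ball (0::'a) (r j) \<in> sets borel" for j by simp
  have "AE y in lborel. f y \<le> (\<Sum>j. ennreal (c j) * indicator (ball 0 (r j)) y)"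
    using AE_lborel_singleton[of 0] f by (auto elim: eventually_mono)
  then have "(\<integral>\<^sup>+y. f y \<partial>lborel) \<le> (\<integral>\<^sup>+y. (\<Sum>j. ennreal (c j) * indicator (ball (0::'a) (r j)) y) \<partial>lborel)"
    by (rule nn_integral_mono_AE)
  also have "\<dots> = (\<Sum>j. ennreal (c j) * emeasure lborel (ball (0::'a) (r j)))"
    by (subst nn_integral_suminf, measurable) (auto simp: nn_integral_cmult_indicator)
  also have "\<dots> = (\<Sum>j. ennreal (c j * (?v * r j ^ DIM('a))))"
    using c r by (simp add: emeasure_ball ennreal_mult)
  also have "\<dots> = ennreal (\<Sum>j. c j * (?v * r j ^ DIM('a)))"
    using c r v s' by (intro suminf_ennreal2) auto
  finally show "(\<integral>\<^sup>+y. f y \<partial>lborel) \<le> ennreal (\<Sum>j. c j * (?v * r j ^ DIM('a)))" .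
qed

lemma ennreal_le_suminf_single:
  fixes g :: "nat \<Rightarrow> ennreal"
  assumes "a \<le> g j" shows "a \<le> (\<Sum>j. g j)"
  using assms sum_le_suminf[of g "{j}"] by (auto intro: order_trans)

lemma nn_integral_unit_ball_powr:
  assumes \<alpha>: "\<alpha> < real DIM('a::euclidean_space)"
  shows "\<exists>C\<ge>0. (\<integral>\<^sup>+y. ennreal (norm y powr - \<alpha>) * indicator (ball (0::'a) 1) y \<partial>lborel) \<le> ennreal C"
proof (rule nn_integral_dyadic_balls)
  \<comment> \<open>Inside the unit ball raising the exponent to \<open>max \<alpha> 0\<close> only
    enlarges the integrand and makes it decreasing in the norm, so both signs of
    \<open>\<alpha>\<close> are treated at once.\<close>
  let ?b = "max \<alpha> 0"
  let ?c = "\<lambda>j::nat. 2 powr (?b * real (Suc j))"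
  let ?r = "\<lambda>j::nat. (1/2::real) ^ j"
  fix y :: 'a assume y: "y \<noteq> 0"
  show "ennreal (norm y powr - \<alpha>) * indicator (ball 0 1) y \<le> (\<Sum>j. ennreal (?c j) * indicator (ball 0 (?r j)) y)"
  proof (cases "norm y < 1")
    case True
    obtain n where "(1/2) ^ n < norm y" using real_arch_pow_inv[of "norm y" "1/2"] y by auto
    then have ex: "\<exists>j. (1/2) ^ (Suc j) \<le> norm y"
      by (intro exI[of _ n] order_trans[OF power_decreasing[of n "Suc n"]]) auto
    define j where "j = (LEAST j. (1/2) ^ (Suc j) \<le> norm y)"
    have j1: "(1/2) ^ (Suc j) \<le> norm y" unfolding j_def by (rule LeastI_ex[OF ex])
    have j2: "norm y < (1/2) ^ j"
    proof (cases j)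
      case (Suc i)
      then have "\<not> (1/2) ^ (Suc i) \<le> norm y" unfolding j_def by (metis lessI not_less_Least)
      then show ?thesis using Suc by simp
    qed (use True in simp)
    have "norm y powr - \<alpha> \<le> norm y powr - ?b"
      using True y by (intro powr_mono') auto
    also have "\<dots> \<le> ((1/2) ^ (Suc j)) powr - ?b"
      using j1 y by (intro powr_mono2') auto
    also have "\<dots> = ?c j"
    proof -
      have "(1/2::real) ^ Suc j = 2 powr (- real (Suc j))"
        by (simp only: powr_minus_divide powr_realpow zero_less_numeral power_one_over)
      then show ?thesis by (simp only: powr_powr) (simp add: algebra_simps)
    qed
    finally show ?thesis
      using True j2 by (intro ennreal_le_suminf_single[of _ _ j]) (simp add: ennreal_leI)
  qed simp
next
  let ?b = "max \<alpha> 0"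
  have b: "?b < real DIM('a)" using \<alpha> by simp
  have "2 powr (?b * real (Suc j)) * ((1/2) ^ j) ^ DIM('a) = 2 powr ?b * (2 powr (?b - real DIM('a))) ^ j" for j
  proof -
    have "((1/2::real) ^ j) ^ DIM('a) = 2 powr (- real DIM('a) * real j)"
      by (simp add: power_mult[symmetric] power_one_over powr_minus_divide powr_realpow[symmetric] mult.commute powr_powr)
    moreover have "(2 powr (?b - real DIM('a))) ^ j = 2 powr ((?b - real DIM('a)) * real j)"
      by (simp add: powr_realpow[symmetric] powr_powr)
    ultimately show ?thesis by (simp add: powr_add[symmetric] algebra_simps)
  qed
  moreover have "summable (\<lambda>j. 2 powr ?b * (2 powr (?b - real DIM('a))) ^ j)"
  proof -
    have "2 powr (?b - real DIM('a)) < 2 powr 0" using b by (intro powr_less_mono) auto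
    then show ?thesis by (intro summable_mult summable_geometric) simp
  qed
  ultimately show "summable (\<lambda>j. 2 powr (?b * real (Suc j)) * ((1/2) ^ j) ^ DIM('a))" by presburger
qed auto

lemma nn_integral_decay:
  assumes M: "real DIM('a::euclidean_space) < M"
  shows "\<exists>C\<ge>0. (\<integral>\<^sup>+y. ennreal ((1 + norm (y::'a)) powr - M) \<partial>lborel) \<le> ennreal C"
proof (rule nn_integral_dyadic_balls)
  let ?c = "\<lambda>j::nat. 2 powr (- M * real j)"
  let ?r = "\<lambda>j::nat. (2::real) ^ Suc j"
  fix y :: 'a
  obtain n where n: "norm y < 2 ^ n" using real_arch_pow[of 2 "norm y"] by auto
  then have ex: "\<exists>j. norm y < 2 ^ Suc j" by (intro exI[of _ n]) (simp add: less_le_trans)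
  define j where "j = (LEAST j. norm y < 2 ^ Suc j)"
  have j1: "norm y < 2 ^ Suc j" unfolding j_def by (rule LeastI_ex[OF ex])
  have j2: "2 ^ j \<le> 1 + norm y"
  proof (cases j)
    case (Suc i)
    then have "\<not> norm y < 2 ^ Suc i" unfolding j_def by (metis lessI not_less_Least)
    then show ?thesis using Suc by simp
  qed simp
  have "(1 + norm y) powr - M \<le> (2 ^ j) powr - M"
    using j2 M by (intro powr_mono2') auto
  also have "\<dots> = ?c j" by (simp add: powr_realpow[symmetric] powr_powr mult.commute)
  finally show "ennreal ((1 + norm y) powr - M) \<le> (\<Sum>j. ennreal (?c j) * indicator (ball 0 (?r j)) y)"
    using j1 by (intro ennreal_le_suminf_single[of _ _ j]) (simp add: ennreal_leI)
next
  let ?c = "\<lambda>j::nat. 2 powr (- M * real j)"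
  let ?r = "\<lambda>j::nat. (2::real) ^ Suc j"
  have "?c j * ?r j ^ DIM('a) = 2 ^ DIM('a) * (2 powr (real DIM('a) - M)) ^ j" for j
  proof -
    have "?r j ^ DIM('a) = 2 powr (real DIM('a) * real (Suc j))"
    proof -
      have "?r j ^ DIM('a) = 2 ^ (Suc j * DIM('a))" by (simp only: power_mult)
      also have "\<dots> = 2 powr (real (Suc j * DIM('a)))" by (simp only: powr_realpow zero_less_numeral)
      finally show ?thesis by (simp only: of_nat_mult mult.commute)
    qed
    moreover have "(2 powr (real DIM('a) - M)) ^ j = 2 powr ((real DIM('a) - M) * real j)"
      by (simp add: powr_realpow[symmetric] powr_powr)
    moreover have "(2::real) ^ DIM('a) = 2 powr real DIM('a)" by (simp add: powr_realpow)
    ultimately show ?thesis by (simp only: powr_add[symmetric]) (simp add: algebra_simps)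
  qed
  moreover have "summable (\<lambda>j. 2 ^ DIM('a) * (2 powr (real DIM('a) - M)) ^ j)"
  proof -
    have "2 powr (real DIM('a) - M) < 2 powr 0" using M by (intro powr_less_mono) auto
    then show ?thesis by (intro summable_mult summable_geometric) simp
  qed
  ultimately show "summable (\<lambda>j. ?c j * ?r j ^ DIM('a))" by presburger
qed auto

text \<open>Young's inequality for \<open>f / a\<close> and \<open>g / b\<close>, where
  \<open>a\<close> and \<open>b\<close> are the normalising roots of \<open>A\<close> and
  \<open>B\<close>; vanishing \<open>A\<close> or \<open>B\<close> is treated apart because of the
  division. The integrals enter through real upper bounds, which lets later estimates be chained
  without extended arithmetic.\<close>

lemma nn_integral_Holder:
  fixes f g :: "'m \<Rightarrow> real"
  assumes pq: "1 < p" "1 < q" "1 / p + 1 / q = 1"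
    and [measurable]: "f \<in> borel_measurable M" "g \<in> borel_measurable M"
    and f0: "\<And>x. 0 \<le> f x" and g0: "\<And>x. 0 \<le> g x"
    and A: "(\<integral>\<^sup>+x. ennreal (f x powr p) \<partial>M) \<le> ennreal A" "0 \<le> A"
    and B: "(\<integral>\<^sup>+x. ennreal (g x powr q) \<partial>M) \<le> ennreal B" "0 \<le> B"
  shows "(\<integral>\<^sup>+x. ennreal (f x * g x) \<partial>M) \<le> ennreal (A powr (1 / p) * B powr (1 / q))"
proof -
  have zero: "(\<integral>\<^sup>+x. ennreal (u x * w x) \<partial>M) = 0"
    if [measurable]: "u \<in> borel_measurable M" "w \<in> borel_measurable M"
      and u: "(\<integral>\<^sup>+x. ennreal (u x powr s) \<partial>M) = 0" for u w :: "'m \<Rightarrow> real" and s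
  proof -
    have "AE x in M. ennreal (u x powr s) = 0" using u by (subst (asm) nn_integral_0_iff_AE) auto
    then have "AE x in M. ennreal (u x * w x) = 0" by (auto simp: ennreal_eq_0_iff elim!: eventually_mono)
    then show ?thesis by (subst nn_integral_0_iff_AE) auto
  qed
  consider "A = 0" | "B = 0" | "0 < A" "0 < B" using A(2) B(2) by fastforce
  then show ?thesis
  proof cases
    case 1 then show ?thesis using zero[of f g p] A by auto
  next
    case 2 then show ?thesis using zero[of g f q] B by (auto simp: mult.commute)
  next
    case 3
    define a where "a = A powr (1 / p)"
    define b where "b = B powr (1 / q)"
    have ab: "0 < a" "0 < b" using 3 by (auto simp: a_def b_def)
    have ap: "a powr p = A" "b powr q = B" using 3 pq by (auto simp: a_def b_def powr_powr)
    have le: "f x * g x \<le> a * b / (p * A) * (f x powr p) + a * b / (q * B) * (g x powr q)" for x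
    proof -
      have "f x / a * (g x / b) \<le> (f x / a) powr p / p + (g x / b) powr q / q"
        using pq f0 g0 ab by (intro Youngs_inequality) auto
      also have "\<dots> = f x powr p / (p * A) + g x powr q / (q * B)"
        using f0 g0 ab by (simp add: powr_divide ap mult.commute)
      finally have "a * b * (f x / a * (g x / b)) \<le> a * b * (f x powr p / (p * A) + g x powr q / (q * B))"
        using ab by (intro mult_left_mono) auto
      then show ?thesis using ab by (simp add: field_simps)
    qed
    have "(\<integral>\<^sup>+x. ennreal (f x * g x) \<partial>M)
       \<le> (\<integral>\<^sup>+x. ennreal (a * b / (p * A)) * ennreal (f x powr p) + ennreal (a * b / (q * B)) * ennreal (g x powr q) \<partial>M)"
      using le 3 pq ab
      by (intro nn_integral_mono) (simp add: ennreal_mult'[symmetric] ennreal_plus[symmetric] del: ennreal_plus)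
    also have "\<dots> = ennreal (a * b / (p * A)) * (\<integral>\<^sup>+x. ennreal (f x powr p) \<partial>M)
        + ennreal (a * b / (q * B)) * (\<integral>\<^sup>+x. ennreal (g x powr q) \<partial>M)"
      by (subst nn_integral_add) (auto simp: nn_integral_cmult)
    also have "\<dots> \<le> ennreal (a * b / (p * A)) * ennreal A + ennreal (a * b / (q * B)) * ennreal B"
      using A B by (intro add_mono mult_left_mono) auto
    also have "\<dots> = ennreal (a * b * (1 / p + 1 / q))"
      using 3 pq ab
      by (simp add: ennreal_mult'[symmetric] ennreal_plus[symmetric] field_simps del: ennreal_plus)
    finally show ?thesis using pq by (simp add: a_def b_def)
  qed
qed

lemma one_plus_norm_le: "1 + norm u \<le> (1 + norm (u - v)) * (1 + norm v)" for u v :: "'a::real_normed_vector"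
proof -
  have "1 + norm u \<le> 1 + norm (u - v) + norm v" using norm_triangle_sub[of u v] by simp
  also have "\<dots> \<le> (1 + norm (u - v)) * (1 + norm v)" by (simp add: algebra_simps)
  finally show ?thesis .
qed

text \<open>Peetre's inequality for a real exponent. A negative exponent is handled by exchanging
  \<open>x\<close> and \<open>y\<close>.\<close>

lemma powr_one_plus_norm_le:
  fixes x y :: "'a::real_normed_vector"
  shows "(1 + norm x) powr \<alpha> \<le> (1 + norm (x - y)) powr \<bar>\<alpha>\<bar> * (1 + norm y) powr \<alpha>"
proof -
  show ?thesis
  proof (cases "0 \<le> \<alpha>")
    case True
    then have "(1 + norm x) powr \<alpha> \<le> ((1 + norm (x - y)) * (1 + norm y)) powr \<alpha>"
      using one_plus_norm_le[of x y] by (intro powr_mono2) auto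
    then show ?thesis using True by (simp add: powr_mult)
  next
    case False
    then have "(1 + norm y) powr - \<alpha> \<le> ((1 + norm (x - y)) * (1 + norm x)) powr - \<alpha>"
      using one_plus_norm_le[of y x] by (intro powr_mono2) (auto simp: norm_minus_commute)
    also have "\<dots> = (1 + norm (x - y)) powr - \<alpha> * (1 + norm x) powr - \<alpha>"
      by (simp add: powr_mult)
    finally have *: "1 / (1 + norm y) powr \<alpha> \<le> (1 + norm (x - y)) powr - \<alpha> / (1 + norm x) powr \<alpha>"
      by (simp add: powr_minus_divide)
    have pos: "0 < (1 + norm x) powr \<alpha>" "0 < (1 + norm y) powr \<alpha>"
      by (auto simp: add_pos_nonneg add_nonneg_eq_0_iff)
    from * pos have "(1 + norm x) powr \<alpha> \<le> (1 + norm (x - y)) powr - \<alpha> * (1 + norm y) powr \<alpha>"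
      by (simp add: field_simps)
    then show ?thesis using False by simp
  qed
qed

lemma powr_abs_le_2:
  fixes u :: real assumes "1/2 \<le> u" "u \<le> 2" shows "u powr \<alpha> \<le> 2 powr \<bar>\<alpha>\<bar>"
proof (cases "0 \<le> \<alpha>")
  case True then show ?thesis using assms powr_mono2[of \<alpha> u 2] by simp
next
  case False
  have "u powr \<alpha> \<le> (1/2) powr \<alpha>" using False assms by (intro powr_mono2') auto
  also have "\<dots> = 2 powr - \<alpha>" by (simp add: powr_divide powr_minus_divide)
  finally show ?thesis using False by simp
qed

text \<open>Away from the unit ball \<open>norm y\<close> is comparable to
  \<open>1 + norm y\<close>, and Peetre's inequality moves that weight to \<open>x\<close> at the
  price of \<open>\<bar>\<alpha>\<bar>\<close> powers of the kernel; hence the size of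
  \<open>N\<close>. Inside the ball the kernel is bounded by 1 and \<open>\<alpha> < d\<close> makes
  the singularity integrable.\<close>

lemma nn_integral_kernel_power_weight:
  assumes \<alpha>: "\<alpha> < real DIM('a::euclidean_space)" and N: "real DIM('a) + \<bar>\<alpha>\<bar> < N"
  shows "\<exists>C\<ge>0. \<forall>x::'a. (\<integral>\<^sup>+y. ennreal ((1 + norm (x - y)) powr - N * norm y powr - \<alpha>) \<partial>lborel)
      \<le> ennreal (C * (1 + norm x) powr - \<alpha>)"
proof -
  obtain C1 where C1: "0 \<le> C1" "(\<integral>\<^sup>+y. ennreal ((1 + norm (y::'a)) powr - (N - \<bar>\<alpha>\<bar>)) \<partial>lborel) \<le> ennreal C1"
    using nn_integral_decay[of "N - \<bar>\<alpha>\<bar>", where 'a='a] N by auto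
  obtain C2 where C2: "0 \<le> C2" "(\<integral>\<^sup>+y. ennreal (norm y powr - \<alpha>) * indicator (ball (0::'a) 1) y \<partial>lborel) \<le> ennreal C2"
    using nn_integral_unit_ball_powr[OF \<alpha>] by auto
  have [measurable]: "ball (0::'a) 1 \<in> sets borel" by simp
  define D where "D = 2 powr \<bar>\<alpha>\<bar>"
  have D: "0 \<le> D" by (simp add: D_def)
  have pw: "(1 + norm x) powr \<alpha> * ((1 + norm (x - y)) powr - N * norm y powr - \<alpha>)
      \<le> D * (1 + norm (x - y)) powr - (N - \<bar>\<alpha>\<bar>) + D * (norm y powr - \<alpha> * indicator (ball 0 1) y)"
    for x y :: 'a
  proof -
    let ?k = "(1 + norm (x - y)) powr - (N - \<bar>\<alpha>\<bar>)"
    have k1: "?k \<le> 1" using N powr_mono[of "- (N - \<bar>\<alpha>\<bar>)" 0 "1 + norm (x - y)"] by (simp split: if_splits)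
    have "(1 + norm x) powr \<alpha> * ((1 + norm (x - y)) powr - N * norm y powr - \<alpha>)
       \<le> ((1 + norm (x - y)) powr \<bar>\<alpha>\<bar> * (1 + norm y) powr \<alpha>) * ((1 + norm (x - y)) powr - N * norm y powr - \<alpha>)"
      by (intro mult_right_mono powr_one_plus_norm_le) auto
    also have "\<dots> = ?k * ((1 + norm y) powr \<alpha> * norm y powr - \<alpha>)"
      by (simp add: powr_diff powr_minus field_simps)
    also have "\<dots> \<le> D * ?k + D * (norm y powr - \<alpha> * indicator (ball 0 1) y)"
    proof (cases "norm y < 1")
      case True
      have "(1 + norm y) powr \<alpha> \<le> D" unfolding D_def using True by (intro powr_abs_le_2) auto
      then have "?k * ((1 + norm y) powr \<alpha> * norm y powr - \<alpha>) \<le> 1 * (D * norm y powr - \<alpha>)"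
        using k1 D by (intro mult_mono) auto
      then show ?thesis using True D by (simp add: add_increasing)
    next
      case False
      then have "(1 + norm y) powr \<alpha> * norm y powr - \<alpha> = ((1 + norm y) / norm y) powr \<alpha>"
        by (simp add: powr_divide powr_minus_divide)
      also have "\<dots> \<le> D"
      proof -
        have "1 \<le> norm y" "0 < norm y" using False by linarith+
        then show ?thesis unfolding D_def by (intro powr_abs_le_2) (simp_all add: le_divide_eq divide_le_eq)
      qed
      finally have "?k * ((1 + norm y) powr \<alpha> * norm y powr - \<alpha>) \<le> ?k * D" by (intro mult_left_mono) auto
      then show ?thesis using False by (simp add: mult.commute)
    qed
    finally show ?thesis .
  qed
  show ?thesis
  proof (intro exI[of _ "D * C1 + D * C2"] conjI allI)
    show "0 \<le> D * C1 + D * C2" using D C1 C2 by simp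
    fix x :: 'a
    let ?w = "(1 + norm x) powr \<alpha>"
    have w: "0 < ?w" by (simp add: add_nonneg_eq_0_iff)
    have "ennreal ?w * (\<integral>\<^sup>+y. ennreal ((1 + norm (x - y)) powr - N * norm y powr - \<alpha>) \<partial>lborel)
      = (\<integral>\<^sup>+y. ennreal (?w * ((1 + norm (x - y)) powr - N * norm y powr - \<alpha>)) \<partial>lborel)"
      by (subst nn_integral_cmult[symmetric]) (auto simp: ennreal_mult)
    also have "\<dots> \<le> (\<integral>\<^sup>+y. ennreal (D * (1 + norm (x - y)) powr - (N - \<bar>\<alpha>\<bar>)
        + D * (norm y powr - \<alpha> * indicator (ball 0 1) y)) \<partial>lborel)"
      by (intro nn_integral_mono ennreal_leI pw)
    also have "\<dots> = (\<integral>\<^sup>+y. ennreal D * ennreal ((1 + norm (x - y)) powr - (N - \<bar>\<alpha>\<bar>))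
        + ennreal D * (ennreal (norm y powr - \<alpha>) * indicator (ball 0 1) y) \<partial>lborel)"
      using D by (intro nn_integral_cong) (auto simp: ennreal_mult split: split_indicator)
    also have "\<dots> = ennreal D * (\<integral>\<^sup>+y. ennreal ((1 + norm (x - y)) powr - (N - \<bar>\<alpha>\<bar>)) \<partial>lborel)
        + ennreal D * (\<integral>\<^sup>+y. ennreal (norm y powr - \<alpha>) * indicator (ball (0::'a) 1) y \<partial>lborel)"
      by (simp add: nn_integral_add nn_integral_cmult)
    also have "(\<integral>\<^sup>+y. ennreal ((1 + norm (x - y)) powr - (N - \<bar>\<alpha>\<bar>)) \<partial>lborel)
        = (\<integral>\<^sup>+y. ennreal ((1 + norm (y::'a)) powr - (N - \<bar>\<alpha>\<bar>)) \<partial>lborel)"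
      by (rule nn_integral_lborel_reflect) measurable
    also have "ennreal D * (\<integral>\<^sup>+y. ennreal ((1 + norm (y::'a)) powr - (N - \<bar>\<alpha>\<bar>)) \<partial>lborel)
        + ennreal D * (\<integral>\<^sup>+y. ennreal (norm y powr - \<alpha>) * indicator (ball (0::'a) 1) y \<partial>lborel)
      \<le> ennreal D * ennreal C1 + ennreal D * ennreal C2"
      using C1 C2 by (intro add_mono mult_left_mono) auto
    also have "\<dots> = ennreal (D * C1 + D * C2)"
      using D C1 C2 by (simp add: ennreal_mult)
    finally have le: "ennreal ?w * (\<integral>\<^sup>+y. ennreal ((1 + norm (x - y)) powr - N * norm y powr - \<alpha>) \<partial>lborel)
       \<le> ennreal (D * C1 + D * C2)" .
    have "(\<integral>\<^sup>+y. ennreal ((1 + norm (x - y)) powr - N * norm y powr - \<alpha>) \<partial>lborel)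
       = ennreal (1 / ?w) * (ennreal ?w * (\<integral>\<^sup>+y. ennreal ((1 + norm (x - y)) powr - N * norm y powr - \<alpha>) \<partial>lborel))"
      using w by (simp add: mult.assoc[symmetric] ennreal_mult[symmetric])
    also have "\<dots> \<le> ennreal (1 / ?w) * ennreal (D * C1 + D * C2)"
      using le by (intro mult_left_mono) auto
    also have "\<dots> = ennreal ((D * C1 + D * C2) * (1 + norm x) powr - \<alpha>)"
      using D C1 C2 w by (simp add: ennreal_mult[symmetric] powr_minus_divide del: ennreal_plus)
    finally show "(\<integral>\<^sup>+y. ennreal ((1 + norm (x - y)) powr - N * norm y powr - \<alpha>) \<partial>lborel)
       \<le> ennreal ((D * C1 + D * C2) * (1 + norm x) powr - \<alpha>)" .
  qed
qed

section \<open>Weighted Bernstein inequalities\<close>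

abbreviation weighted_integral :: "real \<Rightarrow> real \<Rightarrow> ('a::euclidean_space \<Rightarrow> real) \<Rightarrow> ennreal" where
  "weighted_integral p \<gamma> f \<equiv> \<integral>\<^sup>+x. ennreal (f x powr p * norm x powr \<gamma>) \<partial>lborel"

abbreviation unit_kernel_conv :: "real \<Rightarrow> ('a::euclidean_space \<Rightarrow> real) \<Rightarrow> 'a \<Rightarrow> ennreal" where
  "unit_kernel_conv N h x \<equiv> \<integral>\<^sup>+y. ennreal ((1 + norm (x - y)) powr - N * h y) \<partial>lborel"

abbreviation kernel_conv :: "real \<Rightarrow> real \<Rightarrow> ('a::euclidean_space \<Rightarrow> real) \<Rightarrow> 'a \<Rightarrow> ennreal" where
  "kernel_conv N t h x \<equiv> \<integral>\<^sup>+y. ennreal (t ^ DIM('a) * (1 + t * norm (x - y)) powr - N * h y) \<partial>lborel"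

text \<open>Hoelder's inequality separates \<open>h\<close> from the dual weight. The witness
  \<open>W\<close> is the convolution of the kernel with \<open>h^p |y|^\<gamma>\<close>. It is
  bounded by \<open>H\<close> because the kernel is at most 1, and its integral is at most a
  multiple of \<open>H\<close> because the kernel is integrable; between these L^infinity and L^1
  bounds lie all exponents \<open>r \<ge> p\<close>.\<close>

lemma kernel_convolution_weighted_bound:
  fixes N p \<gamma> :: real
  assumes p: "1 < p" and \<gamma>: "\<gamma> < real DIM('a::euclidean_space) * (p - 1)"
    and N: "real DIM('a) + \<bar>\<gamma>\<bar> / (p - 1) < N"
  obtains C where "0 \<le> C" and "\<And>(g::'a \<Rightarrow> real) h H. (\<forall>x. 0 \<le> g x) \<Longrightarrow> (\<forall>y. 0 \<le> h y) \<Longrightarrow> h \<in> borel_measurable borel \<Longrightarrow> 0 \<le> H \<Longrightarrow>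
     (\<forall>x. ennreal (g x) \<le> unit_kernel_conv N h x) \<Longrightarrow>
     weighted_integral p \<gamma> h \<le> ennreal H \<Longrightarrow>
     (\<exists>W. W \<in> borel_measurable borel \<and> (\<forall>x. 0 \<le> W x \<and> W x \<le> H \<and> g x powr p * (1 + norm x) powr \<gamma> \<le> C * W x)
        \<and> (\<integral>\<^sup>+x. ennreal (W x) \<partial>lborel) \<le> ennreal (C * H))"
proof -
  \<comment> \<open>Minus the exponent of the dual weight \<open>w^(-1/(p-1))\<close>; the bound
    \<open>\<alpha> < d\<close> is the hypothesis on \<open>\<gamma>\<close>.\<close>
  define \<alpha> where "\<alpha> = \<gamma> / (p - 1)"
  have \<alpha>d: "\<alpha> < real DIM('a)" using p \<gamma> by (simp add: \<alpha>_def field_simps)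
  have \<alpha>N: "real DIM('a) + \<bar>\<alpha>\<bar> < N" using N p by (simp add: \<alpha>_def)
  have Nd: "real DIM('a) < N" using \<alpha>N by linarith
  obtain C1 where C1: "0 \<le> C1" and C1b: "\<And>x::'a. (\<integral>\<^sup>+y. ennreal ((1 + norm (x - y)) powr - N * norm y powr - \<alpha>) \<partial>lborel)
      \<le> ennreal (C1 * (1 + norm x) powr - \<alpha>)"
    using nn_integral_kernel_power_weight[OF \<alpha>d \<alpha>N] by blast
  obtain C2 where C2: "0 \<le> C2" "(\<integral>\<^sup>+y. ennreal ((1 + norm (y::'a)) powr - N) \<partial>lborel) \<le> ennreal C2"
    using nn_integral_decay[OF Nd] by auto
  define q where "q = p / (p - 1)"
  have q: "1 < q" "1 / q + 1 / p = 1" "p / q = p - 1" "q / p = 1 / (p - 1)"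
    using p by (auto simp: q_def field_simps)
  \<comment> \<open>The first entry is the constant of the pointwise bound, the second that of the
    bound on the integral of \<open>W\<close>.\<close>
  define C where "C = max (C1 powr (p - 1)) C2"
  show ?thesis
  proof (rule that[of C])
    show "0 \<le> C" using C2 by (simp add: C_def)
    fix g h :: "'a \<Rightarrow> real" and H :: real
    assume g0: "\<forall>x. 0 \<le> g x" and h0: "\<forall>y. 0 \<le> h y" and [measurable]: "h \<in> borel_measurable borel" and H0: "0 \<le> H"
      and gh: "\<forall>x. ennreal (g x) \<le> unit_kernel_conv N h x"
      and H: "weighted_integral p \<gamma> h \<le> ennreal H"
    define E where "E x = (\<integral>\<^sup>+y. ennreal ((1 + norm (x - y)) powr - N * (h y powr p * norm y powr \<gamma>)) \<partial>lborel)" for x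
    have k1: "(1 + norm u) powr - N \<le> 1" for u :: 'a
      using Nd powr_mono[of "- N" 0 "1 + norm u"] by (simp split: if_splits)
    have EH: "E x \<le> ennreal H" for x
    proof -
      have "E x \<le> weighted_integral p \<gamma> h"
        unfolding E_def by (intro nn_integral_mono ennreal_leI mult_left_le_one_le k1) auto
      then show ?thesis using H by (rule order_trans)
    qed
    define W where "W x = enn2real (E x)" for x
    have EW: "E x = ennreal (W x)" for x
      using EH[of x] by (auto simp: W_def ennreal_enn2real_if top_unique)
    have [measurable]: "E \<in> borel_measurable borel" unfolding E_def by measurable
    have Wm: "W \<in> borel_measurable borel" unfolding W_def by measurable
    have WH: "W x \<le> H" for x using EH[of x] H0 unfolding EW by simp
    have W0: "0 \<le> W x" for x by (simp add: W_def)
    have main: "g x powr p * (1 + norm x) powr \<gamma> \<le> C * W x" for x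
    proof -
      define A where "A = C1 * (1 + norm x) powr - \<alpha>"
      have A0: "0 \<le> A" using C1 by (simp add: A_def)
      \<comment> \<open>The kernel is split according to the conjugate exponents, and the factor
        \<open>|y|^(-\<gamma>/p) |y|^(\<gamma>/p)\<close> is inserted. The latter is 1 only off the
        origin, so the integrands agree almost everywhere.\<close>
      define u where "u y = (1 + norm (x - y)) powr (- N / q) * norm y powr (- \<gamma> / p)" for y
      define v where "v y = (1 + norm (x - y)) powr (- N / p) * norm y powr (\<gamma> / p) * h y" for y
      have [measurable]: "u \<in> borel_measurable borel" "v \<in> borel_measurable borel"
        unfolding u_def v_def by measurable
      have uq: "u y powr q = (1 + norm (x - y)) powr - N * norm y powr - \<alpha>" for y
      proof -
        have "- N / q * q = - N" "- \<gamma> / p * q = - \<alpha>"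
          using p by (simp_all add: q_def \<alpha>_def)
        then show ?thesis by (simp only: u_def powr_mult powr_powr)
      qed
      have vp: "v y powr p = (1 + norm (x - y)) powr - N * (h y powr p * norm y powr \<gamma>)" for y
        using p h0 by (simp add: v_def powr_mult powr_powr)
      have exps: "- N / q + - N / p = - N"
      proof -
        have "- N / q + - N / p = - N * (1 / q + 1 / p)" by (simp add: algebra_simps)
        then show ?thesis using q by simp
      qed
      have "ennreal (g x) \<le> unit_kernel_conv N h x" using gh by simp
      also have "\<dots> = (\<integral>\<^sup>+y. ennreal (u y * v y) \<partial>lborel)"
      proof (rule nn_integral_cong_AE)
        have "(1 + norm (x - y)) powr - N * h y = u y * v y" if "y \<noteq> 0" for y
        proof -
          have "u y * v y = ((1 + norm (x - y)) powr (- N / q) * (1 + norm (x - y)) powr (- N / p))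
             * (norm y powr (- \<gamma> / p) * norm y powr (\<gamma> / p)) * h y"
            by (simp add: u_def v_def)
          also have "\<dots> = (1 + norm (x - y)) powr - N * h y"
            unfolding powr_add[symmetric] exps using that by simp
          finally show ?thesis by simp
        qed
        then show "AE y in lborel. ennreal ((1 + norm (x - y)) powr - N * h y) = ennreal (u y * v y)"
          using AE_lborel_singleton[of "0::'a"] by (auto elim: eventually_mono)
      qed
      also have "\<dots> \<le> ennreal (A powr (1 / q) * W x powr (1 / p))"
      proof (rule nn_integral_Holder)
        show "(\<integral>\<^sup>+y. ennreal (u y powr q) \<partial>lborel) \<le> ennreal A"
          unfolding uq A_def by (rule C1b)
        show "(\<integral>\<^sup>+y. ennreal (v y powr p) \<partial>lborel) \<le> ennreal (W x)"
          unfolding vp using EW[of x] by (simp add: E_def)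
      qed (use p q h0 W0 A0 in \<open>auto simp: u_def v_def\<close>)
      finally have "g x \<le> A powr (1 / q) * W x powr (1 / p)" by (simp add: ennreal_le_iff)
      then have "g x powr p \<le> (A powr (1 / q) * W x powr (1 / p)) powr p"
        using g0 p by (intro powr_mono2) auto
      also have "\<dots> = A powr (p - 1) * W x"
        using W0[of x] p q by (simp add: powr_mult powr_powr)
      also have "A powr (p - 1) = C1 powr (p - 1) * (1 + norm x) powr - \<gamma>"
        using C1 p by (simp add: A_def powr_mult powr_powr \<alpha>_def)
      finally have "g x powr p \<le> C1 powr (p - 1) * (1 + norm x) powr - \<gamma> * W x" .
      then have "g x powr p * (1 + norm x) powr \<gamma>
          \<le> C1 powr (p - 1) * (1 + norm x) powr - \<gamma> * W x * (1 + norm x) powr \<gamma>"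
        by (rule mult_right_mono) simp
      also have "\<dots> = C1 powr (p - 1) * W x * ((1 + norm x) powr - \<gamma> * (1 + norm x) powr \<gamma>)"
        by (simp only: ac_simps)
      also have "(1 + norm x) powr - \<gamma> * (1 + norm x) powr \<gamma> = 1"
        unfolding powr_add[symmetric] by (simp add: add_nonneg_eq_0_iff)
      also have "C1 powr (p - 1) * W x * 1 \<le> C * W x"
        using W0 by (simp add: C_def mult_right_mono)
      finally show ?thesis .
    qed
    have "(\<integral>\<^sup>+x. ennreal (W x) \<partial>lborel) =
       (\<integral>\<^sup>+x. (\<integral>\<^sup>+y. ennreal ((1 + norm (x - y)) powr - N * (h y powr p * norm y powr \<gamma>)) \<partial>lborel) \<partial>lborel)"
      by (simp add: EW[symmetric] E_def)
    also have "\<dots> = (\<integral>\<^sup>+y. (\<integral>\<^sup>+x. ennreal ((1 + norm (x - y)) powr - N * (h y powr p * norm y powr \<gamma>)) \<partial>lborel) \<partial>lborel)"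
      by (rule lborel_pair.Fubini') measurable
    also have "\<dots> = (\<integral>\<^sup>+y. ennreal (h y powr p * norm y powr \<gamma>) * (\<integral>\<^sup>+x. ennreal ((1 + norm (x - y)) powr - N) \<partial>lborel) \<partial>lborel)"
      by (intro nn_integral_cong, subst nn_integral_cmult[symmetric]) (auto simp: ennreal_mult' mult.commute)
    also have "\<dots> = (\<integral>\<^sup>+y. ennreal (h y powr p * norm y powr \<gamma>) * (\<integral>\<^sup>+x. ennreal ((1 + norm (x::'a)) powr - N) \<partial>lborel) \<partial>lborel)"
    proof (rule nn_integral_cong, rule arg_cong2[where f="(*)"], rule refl)
      fix y :: 'a
      have "(\<integral>\<^sup>+x. ennreal ((1 + norm (x - y)) powr - N) \<partial>lborel) = (\<integral>\<^sup>+x. ennreal ((1 + norm (y - x)) powr - N) \<partial>lborel)"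
        by (simp add: norm_minus_commute)
      also have "\<dots> = (\<integral>\<^sup>+x. ennreal ((1 + norm (x::'a)) powr - N) \<partial>lborel)"
        by (rule nn_integral_lborel_reflect) measurable
      finally show "(\<integral>\<^sup>+x. ennreal ((1 + norm (x - y)) powr - N) \<partial>lborel) = (\<integral>\<^sup>+x. ennreal ((1 + norm (x::'a)) powr - N) \<partial>lborel)" .
    qed
    also have "\<dots> = weighted_integral p \<gamma> h * (\<integral>\<^sup>+x. ennreal ((1 + norm (x::'a)) powr - N) \<partial>lborel)"
      by (rule nn_integral_multc) measurable
    also have "\<dots> \<le> ennreal H * ennreal C2"
      using H C2 by (intro mult_mono) auto
    also have "\<dots> = ennreal (C2 * H)"
      using C2 H0 by (simp add: ennreal_mult[symmetric] mult.commute)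
    also have "\<dots> \<le> ennreal (C * H)"
      using H0 by (intro ennreal_leI mult_right_mono) (auto simp: C_def)
    finally have WI: "(\<integral>\<^sup>+x. ennreal (W x) \<partial>lborel) \<le> ennreal (C * H)" .
    show "\<exists>W. W \<in> borel_measurable borel \<and> (\<forall>x. 0 \<le> W x \<and> W x \<le> H \<and> g x powr p * (1 + norm x) powr \<gamma> \<le> C * W x)
        \<and> (\<integral>\<^sup>+x. ennreal (W x) \<partial>lborel) \<le> ennreal (C * H)"
      using Wm WH W0 main WI by blast
  qed
qed

text \<open>Raising the bound on \<open>g^p\<close> to the power \<open>\<theta> = r / p\<close>
  leaves the weight \<open>(1 + |x|)^(-e) |x|^\<sigma>\<close> with
  \<open>e = \<gamma> \<theta>\<close>. Outside the unit ball it is bounded, since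
  \<open>\<sigma> \<le> e\<close>; this is where the comparison of weight exponents is used. Inside,
  only \<open>|x|^\<sigma>\<close> matters, and \<open>\<sigma> > -d\<close> makes it
  integrable.\<close>

lemma kernel_convolution_weighted_embedding_unit:
  fixes N p \<gamma> r \<sigma> :: real
  assumes p: "1 < p" "p \<le> r" and \<gamma>: "\<gamma> < real DIM('a::euclidean_space) * (p - 1)"
    and N: "real DIM('a) + \<bar>\<gamma>\<bar> / (p - 1) < N"
    and \<sigma>: "- real DIM('a) < \<sigma>" "\<sigma> / r \<le> \<gamma> / p"
  obtains C where "0 \<le> C" and "\<And>(g::'a \<Rightarrow> real) h H. (\<forall>x. 0 \<le> g x) \<Longrightarrow> (\<forall>y. 0 \<le> h y) \<Longrightarrow> h \<in> borel_measurable borel \<Longrightarrow> 0 \<le> H \<Longrightarrow>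
     (\<forall>x. ennreal (g x) \<le> unit_kernel_conv N h x) \<Longrightarrow>
     weighted_integral p \<gamma> h \<le> ennreal H \<Longrightarrow>
     weighted_integral r \<sigma> g \<le> ennreal (C * H powr (r / p))"
proof -
  obtain C where C: "0 \<le> C" and
    Cb: "\<And>g h H. (\<forall>x::'a. 0 \<le> g x) \<Longrightarrow> (\<forall>y. 0 \<le> h y) \<Longrightarrow> h \<in> borel_measurable borel \<Longrightarrow> 0 \<le> H \<Longrightarrow>
     (\<forall>x. ennreal (g x) \<le> unit_kernel_conv N h x) \<Longrightarrow>
     weighted_integral p \<gamma> h \<le> ennreal H \<Longrightarrow>
     (\<exists>W. W \<in> borel_measurable borel \<and> (\<forall>x. 0 \<le> W x \<and> W x \<le> H \<and> g x powr p * (1 + norm x) powr \<gamma> \<le> C * W x)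
        \<and> (\<integral>\<^sup>+x. ennreal (W x) \<partial>lborel) \<le> ennreal (C * H))"
    by (rule kernel_convolution_weighted_bound[OF p(1) \<gamma> N]) (rule that)
  have "- \<sigma> < real DIM('a)" using \<sigma> by simp
  from nn_integral_unit_ball_powr[OF this] obtain C2 where
    C2: "0 \<le> C2" "(\<integral>\<^sup>+y. ennreal (norm y powr \<sigma>) * indicator (ball (0::'a) 1) y \<partial>lborel) \<le> ennreal C2" by auto
  have [measurable]: "ball (0::'a) 1 \<in> sets borel" by simp
  define \<theta> where "\<theta> = r / p"
  have \<theta>: "1 \<le> \<theta>" using p by (simp add: \<theta>_def)
  define e where "e = \<gamma> * \<theta>"
  have e: "\<sigma> \<le> e" using \<sigma> p by (simp add: e_def \<theta>_def field_simps)
  define D where "D = max (2 powr \<bar>\<sigma>\<bar>) (2 powr \<bar>e\<bar>)"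
  have D: "0 \<le> D" by (simp add: D_def le_max_iff_disj)
  have wt: "(1 + norm x) powr - e * norm x powr \<sigma> \<le> D + D * (norm x powr \<sigma> * indicator (ball 0 1) x)" for x :: 'a
  proof (cases "norm x < 1")
    case True
    have "(1 + norm x) powr - e \<le> 2 powr \<bar>- e\<bar>" using True by (intro powr_abs_le_2) auto
    then have "(1 + norm x) powr - e \<le> D" by (simp add: D_def le_max_iff_disj)
    then have "(1 + norm x) powr - e * norm x powr \<sigma> \<le> D * norm x powr \<sigma>" by (intro mult_right_mono) auto
    then show ?thesis using True D by simp
  next
    case False
    have "(1 + norm x) powr - e \<le> (1 + norm x) powr - \<sigma>" using e by (intro powr_mono) auto
    then have "(1 + norm x) powr - e * norm x powr \<sigma> \<le> (1 + norm x) powr - \<sigma> * norm x powr \<sigma>"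
      by (intro mult_right_mono) auto
    also have "\<dots> = (norm x / (1 + norm x)) powr \<sigma>" by (simp add: powr_divide powr_minus_divide)
    also have "\<dots> \<le> 2 powr \<bar>\<sigma>\<bar>" using False
      by (intro powr_abs_le_2) (auto simp: field_simps add_pos_nonneg)
    also have "\<dots> \<le> D" by (simp add: D_def)
    finally show ?thesis using False by simp
  qed
  define K where "K = C powr \<theta> * D * (C + C2)"
  show ?thesis
  proof (rule that[of K])
    show "0 \<le> K" using C C2 D by (simp add: K_def)
    fix g h :: "'a \<Rightarrow> real" and H :: real
    assume A: "\<forall>x. 0 \<le> g x" "\<forall>y. 0 \<le> h y" "h \<in> borel_measurable borel" "0 \<le> H"
      "\<forall>x. ennreal (g x) \<le> unit_kernel_conv N h x"
      "weighted_integral p \<gamma> h \<le> ennreal H"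
    from Cb[OF this] obtain W where [measurable]: "W \<in> borel_measurable borel"
      and W: "\<And>x. 0 \<le> W x" "\<And>x. W x \<le> H" "\<And>x. g x powr p * (1 + norm x) powr \<gamma> \<le> C * W x"
      and WI: "(\<integral>\<^sup>+x. ennreal (W x) \<partial>lborel) \<le> ennreal (C * H)" by blast
    \<comment> \<open>\<open>G\<close> comes from \<open>W^\<theta> \<le> H^(\<theta>-1) W\<close>,
      which keeps one factor \<open>W\<close> to be integrated over the whole space;
      \<open>G'\<close> comes from \<open>W^\<theta> \<le> H^\<theta>\<close>, which suffices on the
      unit ball.\<close>
    define G where "G = C powr \<theta> * D * H powr (\<theta> - 1)"
    define G' where "G' = C powr \<theta> * D * H powr \<theta>"
    have G0: "0 \<le> G" "0 \<le> G'" using D by (auto simp: G_def G'_def)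
    have pw: "g x powr r * norm x powr \<sigma> \<le> G * W x + G' * (norm x powr \<sigma> * indicator (ball 0 1) x)" for x
    proof -
      have pos: "0 < (1 + norm x) powr \<gamma>" by (simp add: add_nonneg_eq_0_iff)
      have "g x powr p \<le> C * W x * (1 + norm x) powr - \<gamma>"
        using W(3)[of x] pos by (simp add: powr_minus_divide field_simps)
      then have "(g x powr p) powr \<theta> \<le> (C * W x * (1 + norm x) powr - \<gamma>) powr \<theta>"
        using \<theta> by (intro powr_mono2) auto
      then have "g x powr r \<le> C powr \<theta> * W x powr \<theta> * (1 + norm x) powr - e"
        using p C W(1)[of x] by (simp add: powr_powr powr_mult \<theta>_def e_def)
      then have "g x powr r * norm x powr \<sigma> \<le> C powr \<theta> * W x powr \<theta> * ((1 + norm x) powr - e * norm x powr \<sigma>)"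
        by (simp add: mult_right_mono mult.assoc[symmetric])
      also have "\<dots> \<le> C powr \<theta> * W x powr \<theta> * (D + D * (norm x powr \<sigma> * indicator (ball 0 1) x))"
        by (intro mult_left_mono wt) auto
      also have "\<dots> = C powr \<theta> * D * W x powr \<theta> + C powr \<theta> * D * W x powr \<theta> * (norm x powr \<sigma> * indicator (ball 0 1) x)"
        by (simp add: algebra_simps)
      also have "\<dots> \<le> G * W x + G' * (norm x powr \<sigma> * indicator (ball 0 1) x)"
      proof (intro add_mono mult_right_mono)
        have "W x powr \<theta> = W x powr (\<theta> - 1) * W x"
          using W(1)[of x] by (cases "W x = 0") (simp_all add: powr_diff)
        also have "\<dots> \<le> H powr (\<theta> - 1) * W x" using W \<theta> by (intro mult_right_mono powr_mono2) auto
        finally have "C powr \<theta> * D * W x powr \<theta> \<le> C powr \<theta> * D * (H powr (\<theta> - 1) * W x)"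
          using D by (intro mult_left_mono) auto
        then show "C powr \<theta> * D * W x powr \<theta> \<le> G * W x" by (simp add: G_def)
        show "C powr \<theta> * D * W x powr \<theta> \<le> G'"
          unfolding G'_def using W \<theta> D by (intro mult_left_mono powr_mono2) auto
      qed auto
      finally show ?thesis .
    qed
    have "weighted_integral r \<sigma> g
       \<le> (\<integral>\<^sup>+x. ennreal (G * W x + G' * (norm x powr \<sigma> * indicator (ball 0 1) x)) \<partial>lborel)"
      by (intro nn_integral_mono ennreal_leI pw)
    also have "\<dots> = (\<integral>\<^sup>+x. ennreal G * ennreal (W x) + ennreal G' * (ennreal (norm x powr \<sigma>) * indicator (ball 0 1) x) \<partial>lborel)"
      using G0 W by (intro nn_integral_cong) (auto simp: ennreal_mult split: split_indicator)
    also have "\<dots> = ennreal G * (\<integral>\<^sup>+x. ennreal (W x) \<partial>lborel) + ennreal G' * (\<integral>\<^sup>+x. ennreal (norm x powr \<sigma>) * indicator (ball (0::'a) 1) x \<partial>lborel)"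
      by (simp add: nn_integral_add nn_integral_cmult)
    also have "\<dots> \<le> ennreal G * ennreal (C * H) + ennreal G' * ennreal C2"
      using WI C2 by (intro add_mono mult_left_mono) auto
    also have "\<dots> = ennreal (G * (C * H) + G' * C2)"
      using G0 C C2 A(4) by (simp add: ennreal_mult)
    also have "G * (C * H) + G' * C2 = K * H powr (r / p)"
    proof -
      have "H powr (\<theta> - 1) * H = H powr \<theta>" using A(4) \<theta> by (cases "H = 0") (auto simp: powr_diff)
      then have "G * (C * H) = C powr \<theta> * D * C * H powr \<theta>" unfolding G_def by (simp add: ac_simps)
      then show ?thesis by (simp add: G'_def K_def \<theta>_def[symmetric] algebra_simps)
    qed
    finally show "weighted_integral r \<sigma> g \<le> ennreal (K * H powr (r / p))" .
  qed
qed

text \<open>The common data of the Bernstein inequalities at frequency \<open>t\<close>;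
  \<open>H\<close> bounds the \<open>p\<close>-th power of the weighted norm of \<open>h\<close>,
  not the norm. Keeping \<open>g\<close> and \<open>h\<close> apart allows two uses:
  \<open>g\<close> a dyadic block and \<open>h\<close> a multiple of it, or \<open>h\<close> a dual
  test function and \<open>g\<close> its convolution with the kernel.\<close>

definition dominated :: "real \<Rightarrow> real \<Rightarrow> real \<Rightarrow> real \<Rightarrow> ('a::euclidean_space \<Rightarrow> real) \<Rightarrow> ('a \<Rightarrow> real) \<Rightarrow> real \<Rightarrow> bool" where
  "dominated N p \<gamma> t g h H \<longleftrightarrow> (\<forall>x. 0 \<le> g x) \<and> (\<forall>y. 0 \<le> h y) \<and>
     g \<in> borel_measurable borel \<and> h \<in> borel_measurable borel \<and> 0 \<le> H \<and>
     (\<forall>x. ennreal (g x) \<le> kernel_conv N t h x) \<and> weighted_integral p \<gamma> h \<le> ennreal H"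

text \<open>Power weights are homogeneous, so the dilation \<open>x / t\<close> reduces the claim to
  \<open>t = 1\<close>. The exponent of \<open>t\<close> is \<open>r\<close> times the difference of
  the scaling dimensions \<open>(d + \<gamma>) / p\<close> and
  \<open>(d + \<sigma>) / r\<close>.\<close>

lemma kernel_convolution_weighted_embedding:
  fixes N p \<gamma> r \<sigma> :: real
  assumes p: "1 < p" "p \<le> r" and \<gamma>: "\<gamma> < real DIM('a::euclidean_space) * (p - 1)"
    and N: "real DIM('a) + \<bar>\<gamma>\<bar> / (p - 1) < N"
    and \<sigma>: "- real DIM('a) < \<sigma>" "\<sigma> / r \<le> \<gamma> / p"
  obtains C where "0 \<le> C" and "\<And>t (g::'a \<Rightarrow> real) h H. 0 < t \<Longrightarrow> dominated N p \<gamma> t g h H \<Longrightarrow>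
     weighted_integral r \<sigma> g
        \<le> ennreal (C * t powr (r * ((real DIM('a) + \<gamma>) / p) - (real DIM('a) + \<sigma>)) * H powr (r / p))"
proof -
  let ?d = "real DIM('a)"
  obtain C where C: "0 \<le> C" and
    Cb: "\<And>g h H. (\<forall>x::'a. 0 \<le> g x) \<Longrightarrow> (\<forall>y. 0 \<le> h y) \<Longrightarrow> h \<in> borel_measurable borel \<Longrightarrow> 0 \<le> H \<Longrightarrow>
     (\<forall>x. ennreal (g x) \<le> unit_kernel_conv N h x) \<Longrightarrow>
     weighted_integral p \<gamma> h \<le> ennreal H \<Longrightarrow>
     weighted_integral r \<sigma> g \<le> ennreal (C * H powr (r / p))"
    by (rule kernel_convolution_weighted_embedding_unit[OF p \<gamma> N \<sigma>]) (rule that)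
  show ?thesis
  proof (rule that[of C])
    show "0 \<le> C" by fact
    fix t :: real and g h :: "'a \<Rightarrow> real" and H :: real
    assume t: "0 < t" and D: "dominated N p \<gamma> t g h H"
    from D have g0: "\<forall>x. 0 \<le> g x" and h0: "\<forall>y. 0 \<le> h y"
      and [measurable]: "g \<in> borel_measurable borel" "h \<in> borel_measurable borel" and H0: "0 \<le> H"
      and gh: "\<forall>x. ennreal (g x) \<le> kernel_conv N t h x"
      and H: "weighted_integral p \<gamma> h \<le> ennreal H" unfolding dominated_def by blast+
    define g' where "g' x = g (x /\<^sub>R t)" for x
    define h' where "h' x = h (x /\<^sub>R t)" for x
    have [measurable]: "g' \<in> borel_measurable borel" "h' \<in> borel_measurable borel"
      unfolding g'_def h'_def by measurable
    have gh': "ennreal (g' x) \<le> unit_kernel_conv N h' x" for x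
    proof -
      have nrm: "t * norm (x /\<^sub>R t - y /\<^sub>R t) = norm (x - y)" for y
        using t by (simp add: scaleR_diff_right[symmetric])
      have "ennreal (g' x) \<le> (\<integral>\<^sup>+y. ennreal (t ^ DIM('a) * (1 + t * norm (x /\<^sub>R t - y)) powr - N * h y) \<partial>lborel)"
        using gh unfolding g'_def by blast
      also have "\<dots> = ennreal ((1 / t) ^ DIM('a)) * (\<integral>\<^sup>+y. ennreal (t ^ DIM('a) * (1 + norm (x - y)) powr - N * h' y) \<partial>lborel)"
        using t by (subst nn_integral_lborel_scale[where c="1 / t" and t=0]) (auto simp: h'_def nrm divide_inverse_commute)
      also have "\<dots> = (\<integral>\<^sup>+y. ennreal ((1 / t) ^ DIM('a)) * ennreal (t ^ DIM('a) * (1 + norm (x - y)) powr - N * h' y) \<partial>lborel)"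
        by (rule nn_integral_cmult[symmetric]) measurable
      also have "\<dots> = unit_kernel_conv N h' x"
        using t h0 by (intro nn_integral_cong) (simp add: ennreal_mult[symmetric] h'_def power_divide)
      finally show ?thesis .
    qed
    have "weighted_integral p \<gamma> h'
       = ennreal (t ^ DIM('a)) * (\<integral>\<^sup>+y. ennreal (h y powr p * (norm (t *\<^sub>R y) powr \<gamma>)) \<partial>lborel)"
      using t by (subst nn_integral_lborel_scale[where c=t and t=0]) (auto simp: h'_def)
    also have "(\<integral>\<^sup>+y. ennreal (h y powr p * (norm (t *\<^sub>R y) powr \<gamma>)) \<partial>lborel)
       = (\<integral>\<^sup>+y. ennreal (t powr \<gamma>) * ennreal (h y powr p * norm y powr \<gamma>) \<partial>lborel)"
      using t by (intro nn_integral_cong) (simp add: ennreal_mult[symmetric] powr_mult mult.left_commute)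
    also have "\<dots> = ennreal (t powr \<gamma>) * weighted_integral p \<gamma> h"
      by (rule nn_integral_cmult) measurable
    also have "ennreal (t ^ DIM('a)) * (ennreal (t powr \<gamma>) * weighted_integral p \<gamma> h)
       \<le> ennreal (t ^ DIM('a)) * (ennreal (t powr \<gamma>) * ennreal H)"
      using H by (intro mult_left_mono) auto
    also have "\<dots> = ennreal (t powr (?d + \<gamma>) * H)"
      using t H0 by (simp add: ennreal_mult[symmetric] powr_add powr_realpow mult.assoc)
    finally have H': "weighted_integral p \<gamma> h' \<le> ennreal (t powr (?d + \<gamma>) * H)" .
    have main: "weighted_integral r \<sigma> g' \<le> ennreal (C * (t powr (?d + \<gamma>) * H) powr (r / p))"
      using H0 g0 h0 gh' H' by (intro Cb[of g' h']) (auto simp: g'_def h'_def)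
    have "weighted_integral r \<sigma> g
       = ennreal ((1 / t) ^ DIM('a)) * (\<integral>\<^sup>+x. ennreal (g' x powr r * norm (x /\<^sub>R t) powr \<sigma>) \<partial>lborel)"
      using t by (subst nn_integral_lborel_scale[where c="1 / t" and t=0]) (auto simp: g'_def divide_inverse_commute)
    also have "(\<integral>\<^sup>+x. ennreal (g' x powr r * norm (x /\<^sub>R t) powr \<sigma>) \<partial>lborel)
       = (\<integral>\<^sup>+x. ennreal (t powr - \<sigma>) * ennreal (g' x powr r * norm x powr \<sigma>) \<partial>lborel)"
      using t by (intro nn_integral_cong)
        (simp add: ennreal_mult[symmetric] powr_mult powr_divide powr_minus_divide divide_inverse_commute[symmetric] mult.left_commute)
    also have "\<dots> = ennreal (t powr - \<sigma>) * weighted_integral r \<sigma> g'"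
      by (rule nn_integral_cmult) measurable
    also have "ennreal ((1 / t) ^ DIM('a)) * (ennreal (t powr - \<sigma>) * weighted_integral r \<sigma> g')
       \<le> ennreal ((1 / t) ^ DIM('a)) * (ennreal (t powr - \<sigma>) * ennreal (C * (t powr (?d + \<gamma>) * H) powr (r / p)))"
      using main by (intro mult_left_mono) auto
    also have "\<dots> = ennreal ((1 / t) ^ DIM('a) * (t powr - \<sigma> * (C * (t powr (?d + \<gamma>) * H) powr (r / p))))"
      using t C by (simp add: ennreal_mult[symmetric])
    also have "(1 / t) ^ DIM('a) * (t powr - \<sigma> * (C * (t powr (?d + \<gamma>) * H) powr (r / p)))
       = C * (t powr (- ?d) * t powr - \<sigma> * t powr ((?d + \<gamma>) * (r / p))) * H powr (r / p)"
    proof -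
      have "(1 / t) ^ DIM('a) = t powr (- ?d)"
        using t by (simp add: powr_minus_divide powr_realpow power_one_over)
      moreover have "(t powr (?d + \<gamma>) * H) powr (r / p) = t powr ((?d + \<gamma>) * (r / p)) * H powr (r / p)"
        by (simp only: powr_mult powr_powr)
      ultimately show ?thesis by (simp only: ac_simps)
    qed
    also have "t powr (- ?d) * t powr - \<sigma> * t powr ((?d + \<gamma>) * (r / p)) = t powr (r * ((?d + \<gamma>) / p) - (?d + \<sigma>))"
      unfolding powr_add[symmetric] by (simp add: algebra_simps add_divide_distrib)
    finally show "weighted_integral r \<sigma> g
        \<le> ennreal (C * t powr (r * ((?d + \<gamma>) / p) - (?d + \<sigma>)) * H powr (r / p))" .
  qed
qed

section \<open>Elementary inequalities for powers of sums\<close>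

lemma sum_geometric_inj_le:
  fixes s :: real
  assumes s: "0 < s" and F: "finite F" "inj_on f F"
  shows "(\<Sum>i\<in>F. 2 powr (- s * real (f i))) \<le> 1 / (1 - 2 powr - s)"
proof -
  let ?x = "2 powr - s"
  have x: "0 \<le> ?x" "?x < 1" using s powr_less_mono[of "- s" 0 2] by auto
  have "(\<Sum>i\<in>F. 2 powr (- s * real (f i))) = (\<Sum>i\<in>F. ?x ^ f i)"
    by (intro sum.cong) (auto simp: powr_realpow[symmetric] powr_powr)
  \<comment> \<open>Only injectivity of the exponent counts, so the bound covers
    \<open>k - j\<close> summed over \<open>j\<close> with \<open>k\<close> fixed as well as over
    \<open>k\<close> with \<open>j\<close> fixed.\<close>
  also have "\<dots> = (\<Sum>n\<in>f ` F. ?x ^ n)" using F by (simp add: sum.reindex)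
  also have "\<dots> \<le> (\<Sum>n. ?x ^ n)" using x F by (intro sum_le_suminf summable_geometric) auto
  also have "\<dots> = 1 / (1 - ?x)" using x by (intro suminf_geometric) auto
  finally show ?thesis .
qed

text \<open>Factoring out the largest of the terms \<open>2^(s(k-j)) u j\<close> leaves a geometric
  series, and the \<open>\<rho>\<close>-th power of the largest term is at most the sum of all
  \<open>\<rho>\<close>-th powers. A loss growing geometrically in \<open>k - j\<close> is accepted,
  so that no factor depends on the number of terms.\<close>

lemma powr_sum_geometric_le:
  fixes u :: "nat \<Rightarrow> real"
  assumes s: "0 < s" and \<rho>: "0 < \<rho>" and u: "\<And>j. 0 \<le> u j"
  shows "(\<Sum>j\<le>k. u j) powr \<rho> \<le> (1 / (1 - 2 powr - s)) powr \<rho> * (\<Sum>j\<le>k. 2 powr (s * \<rho> * real (k - j)) * u j powr \<rho>)"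
proof -
  let ?S = "1 / (1 - 2 powr - s)"
  define m where "m = Max ((\<lambda>j. 2 powr (s * real (k - j)) * u j) ` {..k})"
  have "m \<in> (\<lambda>j. 2 powr (s * real (k - j)) * u j) ` {..k}" unfolding m_def by (intro Max_in) auto
  then obtain i where i: "i \<le> k" "m = 2 powr (s * real (k - i)) * u i" by auto
  have m: "2 powr (s * real (k - j)) * u j \<le> m" if "j \<le> k" for j
    unfolding m_def using that by (intro Max_ge) auto
  have m0: "0 \<le> m" using i u by simp
  have "(\<Sum>j\<le>k. u j) = (\<Sum>j\<le>k. 2 powr (- s * real (k - j)) * (2 powr (s * real (k - j)) * u j))"
    by (simp add: mult.assoc[symmetric] powr_add[symmetric])
  also have "\<dots> \<le> (\<Sum>j\<le>k. 2 powr (- s * real (k - j)) * m)"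
    by (intro sum_mono mult_left_mono m) auto
  also have "\<dots> \<le> ?S * m"
    unfolding sum_distrib_right[symmetric] using s m0
    by (intro mult_right_mono sum_geometric_inj_le) (auto intro!: inj_onI)
  finally have "(\<Sum>j\<le>k. u j) powr \<rho> \<le> (?S * m) powr \<rho>"
    using \<rho> u by (intro powr_mono2 sum_nonneg) auto
  also have "\<dots> = ?S powr \<rho> * m powr \<rho>" by (simp only: powr_mult)
  also have "m powr \<rho> = 2 powr (s * \<rho> * real (k - i)) * u i powr \<rho>"
    by (simp add: i powr_mult powr_powr ac_simps)
  also have "\<dots> \<le> (\<Sum>j\<le>k. 2 powr (s * \<rho> * real (k - j)) * u j powr \<rho>)"
    using i by (intro member_le_sum) auto
  finally show ?thesis by (simp add: mult_left_mono)
qed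

lemma powr_sum_subadditive:
  fixes x :: "'i \<Rightarrow> real"
  assumes \<theta>: "0 < \<theta>" "\<theta> \<le> 1" and F: "finite F" and x: "\<And>j. 0 \<le> x j"
  shows "(\<Sum>j\<in>F. x j) powr \<theta> \<le> (\<Sum>j\<in>F. x j powr \<theta>)"
proof (cases "(\<Sum>j\<in>F. x j) = 0")
  case True then show ?thesis by (simp add: sum_nonneg)
next
  case False
  let ?s = "\<Sum>j\<in>F. x j"
  have s: "0 < ?s" using False x by (simp add: sum_nonneg less_le)
  have le: "x j / ?s \<le> (x j / ?s) powr \<theta>" if "j \<in> F" for j
  proof (cases "x j = 0")
    case False
    have "x j \<le> ?s" using that F x by (intro member_le_sum) auto
    then have "(x j / ?s) powr 1 \<le> (x j / ?s) powr \<theta>"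
      using \<theta> s x[of j] False by (intro powr_mono') auto
    then show ?thesis using x[of j] s by simp
  qed simp
  have "1 = (\<Sum>j\<in>F. x j / ?s)" using s by (simp add: sum_divide_distrib[symmetric])
  also have "\<dots> \<le> (\<Sum>j\<in>F. (x j / ?s) powr \<theta>)" by (intro sum_mono le)
  also have "\<dots> = (\<Sum>j\<in>F. x j powr \<theta>) / ?s powr \<theta>"
    using x s by (simp add: powr_divide sum_divide_distrib)
  finally show ?thesis using s by (simp add: field_simps)
qed

text \<open>The tangent inequality of the convex function \<open>t^p\<close> at \<open>b\<close>, in
  the form \<open>p a b^(p-1) \<le> a^p + (p-1) b^p\<close>, which is Young's inequality.\<close>

lemma powr_diff_le:
  fixes a b p :: real
  assumes "1 < p" "0 \<le> a" "0 \<le> b"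
  shows "b powr p - a powr p \<le> p * (b - a) * b powr (p - 1)"
proof -
  define q where "q = p / (p - 1)"
  have q: "1 < q" "1 / p + 1 / q = 1" "(p - 1) * q = p" using assms by (auto simp: q_def field_simps)
  have "a * b powr (p - 1) \<le> a powr p / p + (b powr (p - 1)) powr q / q"
    using assms q by (intro Youngs_inequality) auto
  also have "(b powr (p - 1)) powr q / q = b powr p * (1 - 1 / p)"
    using q by (simp add: powr_powr) (metis add_diff_cancel_left' mult.right_neutral times_divide_eq_right)
  finally have "p * (a * b powr (p - 1)) \<le> p * (a powr p / p + b powr p * (1 - 1 / p))"
    using assms by (intro mult_left_mono) auto
  also have "\<dots> = a powr p + (p - 1) * b powr p" using assms by (simp add: field_simps)
  finally have *: "p * (a * b powr (p - 1)) \<le> a powr p + (p - 1) * b powr p" .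
  have "b * b powr (p - 1) = b powr p" using assms by (cases "b = 0") (auto simp: powr_diff)
  then have "p * (b - a) * b powr (p - 1) = p * b powr p - p * (a * b powr (p - 1))"
    by (simp add: algebra_simps)
  then show ?thesis using * by (simp only: left_diff_distrib mult_1)
qed

lemma mult_powr_le_add:
  fixes x y p :: real
  assumes "1 < p" "0 \<le> x" "0 \<le> y"
  shows "x * y powr (p - 1) \<le> x powr p + y powr p"
proof -
  let ?m = "max x y"
  have "x * y powr (p - 1) \<le> ?m * ?m powr (p - 1)"
    using assms by (intro mult_mono powr_mono2) auto
  also have "\<dots> = ?m powr p" using assms by (cases "?m = 0") (auto simp: powr_diff)
  also have "\<dots> \<le> x powr p + y powr p" by (auto simp: max_def)
  finally show ?thesis .
qed

section \<open>Almost orthogonal sums\<close>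

text \<open>The upper exponent \<open>\<rho> = (p-1) r / (r-1)\<close> is fixed by
  \<open>1/r + (p-1)/\<rho> = 1\<close> and tends to \<open>p\<close> as \<open>r\<close> does.
  Hence the weight exponent \<open>\<rho> G / p\<close> tends to \<open>G > -d\<close>, and an
  \<open>r\<close> close enough to \<open>p\<close> keeps it above \<open>-d\<close>. For negative
  \<open>G\<close> this is a genuine restriction on \<open>\<rho>\<close>.\<close>

lemma exists_exponents:
  fixes P p d G :: real
  assumes "1 < P" "P < p" "0 < d" "- d < G"
  shows "\<exists>r>P. r < p \<and> - d < (p - 1) * r / (r - 1) * (G / p)"
proof -
  have "((\<lambda>r. (p - 1) * r / (r - 1) * (G / p)) \<longlongrightarrow> (p - 1) * p / (p - 1) * (G / p)) (at_left p)"
    using assms by (intro tendsto_intros) auto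
  moreover have "(p - 1) * p / (p - 1) * (G / p) = G" using assms by simp
  ultimately have "((\<lambda>r. (p - 1) * r / (r - 1) * (G / p)) \<longlongrightarrow> G) (at_left p)" by simp
  then have "eventually (\<lambda>r. - d < (p - 1) * r / (r - 1) * (G / p)) (at_left p)"
    using assms by (intro order_tendstoD) auto
  moreover have "eventually (\<lambda>r. r \<in> {P<..<p}) (at_left p)"
    using assms by (intro eventually_at_left_real)
  ultimately have "eventually (\<lambda>r. r > P \<and> r < p \<and> - d < (p - 1) * r / (r - 1) * (G / p)) (at_left p)"
    by eventually_elim auto
  then show ?thesis using eventually_happens trivial_limit_at_left_real by blast
qed

lemma powr_partial_sum_le:
  fixes u :: "nat \<Rightarrow> real"
  assumes p: "1 < p" and u: "\<And>j. 0 \<le> u j"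
  shows "(\<Sum>k<M. u k) powr p \<le> p * (\<Sum>k<M. u k * (\<Sum>j\<le>k. u j) powr (p - 1))"
proof (induction M)
  case (Suc M)
  have "(\<Sum>k<Suc M. u k) powr p - (\<Sum>k<M. u k) powr p
      \<le> p * ((\<Sum>k<Suc M. u k) - (\<Sum>k<M. u k)) * (\<Sum>k<Suc M. u k) powr (p - 1)"
    using p u by (intro powr_diff_le sum_nonneg) auto
  also have "\<dots> = p * (u M * (\<Sum>j\<le>M. u j) powr (p - 1))" by (simp flip: lessThan_Suc_atMost)
  finally show ?case using Suc by (simp add: algebra_simps)
qed simp

text \<open>The two bounds \<open>U1\<close>, \<open>U2\<close> are Bernstein inequalities at exponents below and above
  \<open>p\<close>. In \<open>S^p \<le> p * \<Sum>k. u k * (S k)^(p - 1)\<close> the first one is applied to \<open>u k\<close> and the second to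
  \<open>S k\<close>; the powers of \<open>2\<close> then cancel exactly.\<close>

lemma almost_orthogonal_sum:
  fixes u :: "nat \<Rightarrow> 'a::euclidean_space \<Rightarrow> real" and b :: "nat \<Rightarrow> real"
  assumes r: "1 < r" "r < p" and d: "0 < d"
    and u0: "\<And>k x. 0 \<le> u k x" and [measurable]: "\<And>k. u k \<in> borel_measurable borel"
    and b0: "\<And>k. 0 \<le> b k" and C0: "0 \<le> C1" "0 \<le> C2"
    and \<rho>: "\<rho> = (p - 1) * r / (r - 1)"
    and U1: "\<And>k. weighted_integral r (r * G / p) (u k)
        \<le> ennreal (C1 * 2 powr (real k * (d * (r / p - 1))) * b k powr r)"
    and U2: "\<And>k. weighted_integral \<rho> (\<rho> * G / p) (u k)
        \<le> ennreal (C2 * 2 powr (real k * (d * (\<rho> / p - 1))) * b k powr \<rho>)"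
    and \<epsilon>: "\<epsilon> = d * (1 / p - 1 / \<rho>) / 2"
    and K: "K = p * (C1 powr (1 / r) * ((1 / (1 - 2 powr - \<epsilon>)) powr \<rho> * C2) powr (1 - 1 / r)) * (1 + 1 / (1 - 2 powr - (\<epsilon> * p)))"
  shows "(\<integral>\<^sup>+x. ennreal ((\<Sum>k<M. u k x) powr p * norm x powr G) \<partial>lborel)
     \<le> ennreal (K * (\<Sum>k<M. b k powr p))"
proof -
  define r' where "r' = r / (r - 1)"
  have r': "1 < r'" "1 / r + 1 / r' = 1" "1 / r' = 1 - 1 / r" "(p - 1) * r' = \<rho>"
    using r by (auto simp: r'_def \<rho> field_simps)
  have p: "1 < p" using r by simp
  have \<rho>p: "p < \<rho>" using r by (simp add: \<rho> field_simps)
  have \<epsilon>0: "0 < \<epsilon>" using \<rho>p p d by (simp add: \<epsilon> field_simps)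
  define A where "A = (1 / (1 - 2 powr - \<epsilon>)) powr \<rho>"
  have A0: "0 \<le> A" by (simp add: A_def)
  define S where "S k x = (\<Sum>j\<le>k. u j x)" for k x
  have S0: "0 \<le> S k x" for k x by (simp add: S_def sum_nonneg u0)
  have [measurable]: "S k \<in> borel_measurable borel" for k unfolding S_def by measurable
  \<comment> \<open>The bound \<open>U2\<close> grows like \<open>2^(2 \<epsilon> \<rho> k)\<close>,
    because \<open>d (\<rho>/p - 1) = 2 \<epsilon> \<rho>\<close>. Half of this rate pays for
    \<open>powr_sum_geometric_le\<close>; the other half survives as the decay
    \<open>2^(-\<epsilon> \<rho> (k-j))\<close>. This is the reason for the 2 in the denominator of
    \<open>\<epsilon>\<close>.\<close>
  define Q where "Q k = (\<Sum>j\<le>k. 2 powr (- (\<epsilon> * \<rho>) * real (k - j)) * b j powr \<rho>)" for k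
  have Q0: "0 \<le> Q k" for k by (simp add: Q_def sum_nonneg)
  have SQ: "weighted_integral \<rho> (\<rho> * G / p) (S k)
      \<le> ennreal (A * C2 * 2 powr (real k * (d * (\<rho> / p - 1))) * Q k)" for k
  proof -
    have "weighted_integral \<rho> (\<rho> * G / p) (S k)
      \<le> (\<integral>\<^sup>+x. (\<Sum>j\<le>k. ennreal (A * 2 powr (\<epsilon> * \<rho> * real (k - j))) * ennreal (u j x powr \<rho> * norm x powr (\<rho> * G / p))) \<partial>lborel)"
    proof (intro nn_integral_mono)
      fix x
      have "S k x powr \<rho> * norm x powr (\<rho> * G / p)
         \<le> (A * (\<Sum>j\<le>k. 2 powr (\<epsilon> * \<rho> * real (k - j)) * u j x powr \<rho>)) * norm x powr (\<rho> * G / p)"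
        unfolding S_def A_def using \<epsilon>0 \<rho>p p u0 by (intro mult_right_mono powr_sum_geometric_le) auto
      also have "\<dots> = (\<Sum>j\<le>k. A * 2 powr (\<epsilon> * \<rho> * real (k - j)) * (u j x powr \<rho> * norm x powr (\<rho> * G / p)))"
        by (simp add: sum_distrib_left sum_distrib_right mult.assoc)
      finally show "ennreal (S k x powr \<rho> * norm x powr (\<rho> * G / p)) \<le>
         (\<Sum>j\<le>k. ennreal (A * 2 powr (\<epsilon> * \<rho> * real (k - j))) * ennreal (u j x powr \<rho> * norm x powr (\<rho> * G / p)))"
        using A0 by (simp add: ennreal_mult[symmetric] sum_nonneg)
    qed
    also have "\<dots> = (\<Sum>j\<le>k. ennreal (A * 2 powr (\<epsilon> * \<rho> * real (k - j))) * weighted_integral \<rho> (\<rho> * G / p) (u j))"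
      by (subst nn_integral_sum) (auto simp: nn_integral_cmult)
    also have "\<dots> \<le> (\<Sum>j\<le>k. ennreal (A * 2 powr (\<epsilon> * \<rho> * real (k - j))) * ennreal (C2 * 2 powr (real j * (d * (\<rho> / p - 1))) * b j powr \<rho>))"
      by (intro sum_mono mult_left_mono U2) auto
    also have "\<dots> = ennreal (\<Sum>j\<le>k. A * 2 powr (\<epsilon> * \<rho> * real (k - j)) * (C2 * 2 powr (real j * (d * (\<rho> / p - 1))) * b j powr \<rho>))"
      using A0 C0 by (simp add: ennreal_mult[symmetric])
    also have "(\<Sum>j\<le>k. A * 2 powr (\<epsilon> * \<rho> * real (k - j)) * (C2 * 2 powr (real j * (d * (\<rho> / p - 1))) * b j powr \<rho>))
       = A * C2 * 2 powr (real k * (d * (\<rho> / p - 1))) * Q k"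
      unfolding Q_def sum_distrib_left
    proof (intro sum.cong refl)
      fix j assume j: "j \<in> {..k}"
      have e: "d * (\<rho> / p - 1) = 2 * \<epsilon> * \<rho>" using p \<rho>p by (simp add: \<epsilon> field_simps)
      have "2 powr (\<epsilon> * \<rho> * real (k - j)) * 2 powr (real j * (d * (\<rho> / p - 1)))
        = 2 powr (real k * (d * (\<rho> / p - 1))) * 2 powr (- (\<epsilon> * \<rho>) * real (k - j))"
        unfolding powr_add[symmetric] e using j by (simp add: of_nat_diff algebra_simps)
      then show "A * 2 powr (\<epsilon> * \<rho> * real (k - j)) * (C2 * 2 powr (real j * (d * (\<rho> / p - 1))) * b j powr \<rho>) =
         A * C2 * 2 powr (real k * (d * (\<rho> / p - 1))) * (2 powr (- (\<epsilon> * \<rho>) * real (k - j)) * b j powr \<rho>)"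
        by (simp only: ac_simps)
    qed
    finally show ?thesis .
  qed
  define C3 where "C3 = C1 powr (1 / r) * (A * C2) powr (1 / r')"
  have C30: "0 \<le> C3" by (simp add: C3_def)
  have step: "(\<integral>\<^sup>+x. ennreal (u k x * S k x powr (p - 1) * norm x powr G) \<partial>lborel)
      \<le> ennreal (C3 * (b k powr p + Q k powr (p / \<rho>)))" for k
  proof -
    let ?e1 = "real k * (d * (r / p - 1))" and ?e2 = "real k * (d * (\<rho> / p - 1))"
    have ex: "u k x * S k x powr (p - 1) * norm x powr G
        = (u k x * norm x powr (G / p)) * (S k x powr (p - 1) * norm x powr ((p - 1) * G / p))" for x
    proof -
      have "G / p + (p - 1) * G / p = G" using p by (simp add: field_simps)
      then have "norm x powr G = norm x powr (G / p) * norm x powr ((p - 1) * G / p)"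
        by (simp only: powr_add[symmetric])
      then show ?thesis by (simp only: ac_simps)
    qed
    have "(\<integral>\<^sup>+x. ennreal (u k x * S k x powr (p - 1) * norm x powr G) \<partial>lborel)
      = (\<integral>\<^sup>+x. ennreal ((u k x * norm x powr (G / p)) * (S k x powr (p - 1) * norm x powr ((p - 1) * G / p))) \<partial>lborel)"
      unfolding ex ..
    also have "\<dots> \<le> ennreal ((C1 * 2 powr ?e1 * b k powr r) powr (1 / r) * (A * C2 * 2 powr ?e2 * Q k) powr (1 / r'))"
    proof (rule nn_integral_Holder[OF r(1) r'(1) r'(2)])
      show "(\<integral>\<^sup>+x. ennreal ((u k x * norm x powr (G / p)) powr r) \<partial>lborel) \<le> ennreal (C1 * 2 powr ?e1 * b k powr r)"
      proof -
        have "(u k x * norm x powr (G / p)) powr r = u k x powr r * norm x powr (r * G / p)" for x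
          by (simp add: powr_mult powr_powr mult.commute)
        then show ?thesis using U1[of k] by simp
      qed
      show "(\<integral>\<^sup>+x. ennreal ((S k x powr (p - 1) * norm x powr ((p - 1) * G / p)) powr r') \<partial>lborel) \<le> ennreal (A * C2 * 2 powr ?e2 * Q k)"
      proof -
        have "(p - 1) * G / p * r' = \<rho> * G / p" using r'(4) by (simp add: field_simps)
        then have "(S k x powr (p - 1) * norm x powr ((p - 1) * G / p)) powr r' = S k x powr \<rho> * norm x powr (\<rho> * G / p)" for x
          by (simp only: powr_mult powr_powr r'(4))
        then show ?thesis using SQ[of k] by simp
      qed
    qed (use u0 S0 A0 C0 Q0 in auto)
    also have "(C1 * 2 powr ?e1 * b k powr r) powr (1 / r) * (A * C2 * 2 powr ?e2 * Q k) powr (1 / r')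
       = C3 * (2 powr (?e1 * (1 / r)) * 2 powr (?e2 * (1 / r'))) * (b k powr (r * (1 / r)) * Q k powr (1 / r'))"
      by (simp only: C3_def powr_mult powr_powr ac_simps)
    \<comment> \<open>After Hoelder's inequality the rates are \<open>1/p - 1/r\<close> and
      \<open>(p-1)/p - 1/r'\<close>, and they add up to 0.\<close>
    also have "2 powr (?e1 * (1 / r)) * 2 powr (?e2 * (1 / r')) = 1"
    proof -
      have "(r / p - 1) * (1 / r) + (\<rho> / p - 1) * (1 / r') = 0"
      proof -
        have X: "\<rho> * (1 / r') = p - 1" using r' by (simp add: field_simps)
        have "(\<rho> / p - 1) * (1 / r') = \<rho> * (1 / r') / p - 1 / r'" by (simp only: left_diff_distrib mult_1 times_divide_eq_left)
        then have "(\<rho> / p - 1) * (1 / r') = (p - 1) / p - 1 / r'" unfolding X .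
        moreover have "(r / p - 1) * (1 / r) = 1 / p - 1 / r" using r p by (simp add: field_simps)
        moreover have "(p - 1) / p = 1 - 1 / p" using p by (simp add: field_simps)
        ultimately show ?thesis using r'(2) by linarith
      qed
      then have "real k * d * ((r / p - 1) * (1 / r) + (\<rho> / p - 1) * (1 / r')) = 0" by simp
      then have "?e1 * (1 / r) + ?e2 * (1 / r') = 0" by (simp only: distrib_left ac_simps)
      then show ?thesis unfolding powr_add[symmetric] by simp
    qed
    also have "ennreal (C3 * 1 * (b k powr (r * (1 / r)) * Q k powr (1 / r'))) \<le> ennreal (C3 * (b k powr p + Q k powr (p / \<rho>)))"
    proof -
      have "Q k powr (1 / r') = (Q k powr (1 / \<rho>)) powr (p - 1)"
        unfolding powr_powr using r'(4) r'(1) \<rho>p p by (intro arg_cong2[where f="(powr)"] refl) (simp add: field_simps)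
      moreover have "b k powr (r * (1 / r)) = b k" using r b0[of k] by simp
      ultimately have "b k powr (r * (1 / r)) * Q k powr (1 / r') \<le> b k powr p + (Q k powr (1 / \<rho>)) powr p"
        using mult_powr_le_add[OF p, of "b k" "Q k powr (1 / \<rho>)"] b0 by simp
      then have "b k powr (r * (1 / r)) * Q k powr (1 / r') \<le> b k powr p + Q k powr (p / \<rho>)"
        by (simp add: powr_powr)
      from mult_left_mono[OF this C30] show ?thesis by (intro ennreal_leI) simp
    qed
    finally show ?thesis .
  qed
  \<comment> \<open>Since \<open>p < \<rho>\<close>, the power \<open>p / \<rho>\<close> is
    subadditive, so \<open>Q^(p/\<rho>)\<close> is dominated by a discrete convolution of
    \<open>b^p\<close> with a geometric sequence. Exchanging the sums and summing the geometric
    factor over \<open>k\<close> leaves the l^p sum of \<open>b\<close>.\<close>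
  have Qp: "(\<Sum>k<M. Q k powr (p / \<rho>)) \<le> 1 / (1 - 2 powr - (\<epsilon> * p)) * (\<Sum>k<M. b k powr p)"
  proof -
    have "(\<Sum>k<M. Q k powr (p / \<rho>)) \<le> (\<Sum>k<M. \<Sum>j\<le>k. 2 powr (- (\<epsilon> * p) * real (k - j)) * b j powr p)"
    proof (intro sum_mono)
      fix k
      have "Q k powr (p / \<rho>) \<le> (\<Sum>j\<le>k. (2 powr (- (\<epsilon> * \<rho>) * real (k - j)) * b j powr \<rho>) powr (p / \<rho>))"
        unfolding Q_def using p \<rho>p by (intro powr_sum_subadditive) auto
      also have "\<dots> = (\<Sum>j\<le>k. 2 powr (- (\<epsilon> * p) * real (k - j)) * b j powr p)"
      proof (intro sum.cong refl)
        fix j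
        have "- (\<epsilon> * \<rho>) * real (k - j) * (p / \<rho>) = - (\<epsilon> * p) * real (k - j)" "\<rho> * (p / \<rho>) = p" using p \<rho>p by auto
        then show "(2 powr (- (\<epsilon> * \<rho>) * real (k - j)) * b j powr \<rho>) powr (p / \<rho>) = 2 powr (- (\<epsilon> * p) * real (k - j)) * b j powr p"
          by (simp only: powr_mult powr_powr)
      qed
      finally show "Q k powr (p / \<rho>) \<le> (\<Sum>j\<le>k. 2 powr (- (\<epsilon> * p) * real (k - j)) * b j powr p)" .
    qed
    also have "\<dots> = (\<Sum>j<M. \<Sum>k\<in>{j..<M}. 2 powr (- (\<epsilon> * p) * real (k - j)) * b j powr p)"
    proof -
      have "(\<Sum>k<M. \<Sum>j\<le>k. 2 powr (- (\<epsilon> * p) * real (k - j)) * b j powr p)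
        = (\<Sum>(k, j)\<in>Sigma {..<M} (\<lambda>k. {..k}). 2 powr (- (\<epsilon> * p) * real (k - j)) * b j powr p)"
        by (rule sum.Sigma) auto
      also have "\<dots> = (\<Sum>(j, k)\<in>Sigma {..<M} (\<lambda>j. {j..<M}). 2 powr (- (\<epsilon> * p) * real (k - j)) * b j powr p)"
        by (rule sum.reindex_bij_witness[of _ prod.swap prod.swap]) auto
      also have "\<dots> = (\<Sum>j<M. \<Sum>k\<in>{j..<M}. 2 powr (- (\<epsilon> * p) * real (k - j)) * b j powr p)"
        by (rule sum.Sigma[symmetric]) auto
      finally show ?thesis .
    qed
    also have "\<dots> \<le> (\<Sum>j<M. 1 / (1 - 2 powr - (\<epsilon> * p)) * b j powr p)"
      unfolding sum_distrib_right[symmetric] using \<epsilon>0 p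
      by (intro sum_mono mult_right_mono sum_geometric_inj_le) (auto intro!: inj_onI)
    finally show ?thesis by (simp only: sum_distrib_left)
  qed
  have "(\<integral>\<^sup>+x. ennreal ((\<Sum>k<M. u k x) powr p * norm x powr G) \<partial>lborel)
     \<le> (\<integral>\<^sup>+x. (\<Sum>k<M. ennreal p * ennreal (u k x * S k x powr (p - 1) * norm x powr G)) \<partial>lborel)"
  proof (intro nn_integral_mono)
    fix x
    have "(\<Sum>k<M. u k x) powr p * norm x powr G \<le> p * (\<Sum>k<M. u k x * S k x powr (p - 1)) * norm x powr G"
      unfolding S_def by (intro mult_right_mono powr_partial_sum_le p u0) auto
    also have "\<dots> = (\<Sum>k<M. p * (u k x * S k x powr (p - 1) * norm x powr G))"
      by (simp add: sum_distrib_left sum_distrib_right mult.assoc)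
    finally show "ennreal ((\<Sum>k<M. u k x) powr p * norm x powr G)
       \<le> (\<Sum>k<M. ennreal p * ennreal (u k x * S k x powr (p - 1) * norm x powr G))"
      using p u0 by (simp add: ennreal_mult[symmetric] sum_nonneg)
  qed
  also have "\<dots> = (\<Sum>k<M. ennreal p * (\<integral>\<^sup>+x. ennreal (u k x * S k x powr (p - 1) * norm x powr G) \<partial>lborel))"
    by (subst nn_integral_sum) (auto simp: nn_integral_cmult)
  also have "\<dots> \<le> (\<Sum>k<M. ennreal p * ennreal (C3 * (b k powr p + Q k powr (p / \<rho>))))"
    by (intro sum_mono mult_left_mono step) auto
  also have "\<dots> = ennreal (\<Sum>k<M. p * (C3 * (b k powr p + Q k powr (p / \<rho>))))"
    using p C30 by (simp add: ennreal_mult[symmetric] del: ennreal_plus)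
  also have "\<dots> \<le> ennreal (K * (\<Sum>k<M. b k powr p))"
  proof (rule ennreal_leI)
    have "(\<Sum>k<M. p * (C3 * (b k powr p + Q k powr (p / \<rho>)))) = p * C3 * ((\<Sum>k<M. b k powr p) + (\<Sum>k<M. Q k powr (p / \<rho>)))"
      by (simp add: sum_distrib_left sum.distrib algebra_simps)
    also have "\<dots> \<le> p * C3 * ((\<Sum>k<M. b k powr p) + 1 / (1 - 2 powr - (\<epsilon> * p)) * (\<Sum>k<M. b k powr p))"
      using p C30 Qp by (intro mult_left_mono add_left_mono) auto
    also have "\<dots> = K * (\<Sum>k<M. b k powr p)"
      unfolding K C3_def r'(3) A_def by (simp only: distrib_left distrib_right mult_1 mult_1_right mult.assoc)
    finally show "(\<Sum>k<M. p * (C3 * (b k powr p + Q k powr (p / \<rho>)))) \<le> K * (\<Sum>k<M. b k powr p)" .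
  qed
  finally show ?thesis .
qed

text \<open>Along the line of weights \<open>s G / p\<close> the comparison of exponents reads
  \<open>G / p \<le> \<gamma> / P\<close> for every \<open>s\<close>, so only
  \<open>- d < s G / p\<close> limits the choice of \<open>s\<close>. The factor
  \<open>2^(-k \<delta>)\<close> normalises the Bernstein inequality at the exponent
  \<open>s\<close> to the rate \<open>d (s/p - 1)\<close>, which is the form that
  \<open>almost_orthogonal_sum\<close> takes.\<close>

lemma weighted_besov_sum:
  fixes N P p \<gamma> G \<delta> :: real
  assumes P: "1 < P" "P < p" and \<gamma>: "\<gamma> < real DIM('a::euclidean_space) * (P - 1)"
    and G: "- real DIM('a) < G" "G / p \<le> \<gamma> / P"
    and N: "real DIM('a) + \<bar>\<gamma>\<bar> / (P - 1) < N"
    and \<delta>: "\<delta> = (real DIM('a) + \<gamma>) / P - (real DIM('a) + G) / p"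
  obtains C where "0 \<le> C" and "\<And>(g::nat \<Rightarrow> 'a \<Rightarrow> real) h b M.
     (\<forall>k. 0 \<le> b k \<and> dominated N P \<gamma> (2 ^ k) (g k) (h k) (b k powr P)) \<Longrightarrow>
     (\<integral>\<^sup>+x. ennreal ((\<Sum>k<M. 2 powr (- real k * \<delta>) * g k x) powr p * norm x powr G) \<partial>lborel)
        \<le> ennreal (C * (\<Sum>k<M. b k powr p))"
proof -
  let ?d = "real DIM('a)"
  have d: "0 < ?d" by simp
  obtain r where r: "P < r" "r < p" and rw: "- ?d < (p - 1) * r / (r - 1) * (G / p)"
    using exists_exponents[OF P d G(1)] by auto
  define \<rho> where "\<rho> = (p - 1) * r / (r - 1)"
  have pr: "1 < r" "1 < p" using P r by auto
  have \<rho>p: "p < \<rho>" using pr r by (simp add: \<rho>_def field_simps)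
  have B: "\<exists>C\<ge>0. \<forall>(g::'a \<Rightarrow> real) h b k. 0 \<le> b \<longrightarrow> dominated N P \<gamma> (2 ^ k) g h (b powr P) \<longrightarrow>
     weighted_integral s (s * G / p) (\<lambda>x. 2 powr (- real k * \<delta>) * g x)
        \<le> ennreal (C * 2 powr (real k * (?d * (s / p - 1))) * b powr s)"
    if s: "P \<le> s" and sw: "- ?d < s * G / p" for s
  proof -
    have s0: "0 < s" using s P by simp
    have sG: "s * G / p / s \<le> \<gamma> / P" using G s0 by simp
    obtain C where C: "0 \<le> C" and
      Cb: "\<And>t (g::'a \<Rightarrow> real) h H. 0 < t \<Longrightarrow> dominated N P \<gamma> t g h H \<Longrightarrow>
       weighted_integral s (s * G / p) g
          \<le> ennreal (C * t powr (s * ((?d + \<gamma>) / P) - (?d + s * G / p)) * H powr (s / P))"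
      by (rule kernel_convolution_weighted_embedding[OF P(1) s \<gamma> N sw sG]) (rule that)
    show ?thesis
    proof (intro exI[of _ C] conjI allI impI)
      show "0 \<le> C" by fact
      fix g h :: "'a \<Rightarrow> real" and b :: real and k :: nat
      assume b: "0 \<le> b" and D: "dominated N P \<gamma> (2 ^ k) g h (b powr P)"
      have [measurable]: "g \<in> borel_measurable borel" using D by (simp add: dominated_def)
      let ?e = "s * ((?d + \<gamma>) / P) - (?d + s * G / p)"
      have main: "weighted_integral s (s * G / p) g
          \<le> ennreal (C * (2 ^ k) powr ?e * (b powr P) powr (s / P))"
        using D by (intro Cb) auto
      have "(\<integral>\<^sup>+x. ennreal ((2 powr (- real k * \<delta>) * g x) powr s * norm x powr (s * G / p)) \<partial>lborel)
         = (\<integral>\<^sup>+x. ennreal (2 powr (- real k * \<delta> * s)) * ennreal (g x powr s * norm x powr (s * G / p)) \<partial>lborel)"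
        by (intro nn_integral_cong) (simp add: ennreal_mult[symmetric] powr_mult powr_powr mult.assoc)
      also have "\<dots> = ennreal (2 powr (- real k * \<delta> * s)) * weighted_integral s (s * G / p) g"
        by (rule nn_integral_cmult) measurable
      also have "\<dots> \<le> ennreal (2 powr (- real k * \<delta> * s)) * ennreal (C * (2 ^ k) powr ?e * (b powr P) powr (s / P))"
        by (intro mult_left_mono main) auto
      also have "\<dots> = ennreal (2 powr (- real k * \<delta> * s) * (C * (2 ^ k) powr ?e * (b powr P) powr (s / P)))"
        using C by (simp add: ennreal_mult[symmetric])
      also have "2 powr (- real k * \<delta> * s) * (C * (2 ^ k) powr ?e * (b powr P) powr (s / P))
          = C * (2 powr (- real k * \<delta> * s) * 2 powr (real k * ?e)) * b powr s"
        using P b by (simp add: powr_realpow[symmetric] powr_powr)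
      also have "2 powr (- real k * \<delta> * s) * 2 powr (real k * ?e) = 2 powr (real k * (?d * (s / p - 1)))"
      proof -
        have "- real k * \<delta> * s + real k * ?e = real k * (?d * (s / p - 1))"
        proof -
          have gen: "- K * (A - x - y) * s + K * (s * A - (D + s * y)) = K * (s * x - D)" for K A x y D :: real
            by (simp add: algebra_simps)
          have "\<delta> = (?d + \<gamma>) / P - ?d / p - G / p" "s * G / p = s * (G / p)" "?d * (s / p - 1) = s * (?d / p) - ?d"
            by (auto simp: \<delta> add_divide_distrib right_diff_distrib)
          then show ?thesis by (simp only: gen)
        qed
        then show ?thesis by (simp only: powr_add[symmetric])
      qed
      finally show "weighted_integral s (s * G / p) (\<lambda>x. 2 powr (- real k * \<delta>) * g x)
        \<le> ennreal (C * 2 powr (real k * (?d * (s / p - 1))) * b powr s)" .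
    qed
  qed
  \<comment> \<open>Below \<open>p\<close> the factor \<open>r / p\<close> moves a negative
    \<open>G\<close> towards 0, so only the exponent \<open>\<rho>\<close> above \<open>p\<close>
    needs the careful choice of \<open>r\<close>.\<close>
  have rw1: "- ?d < r * G / p"
  proof (cases "0 \<le> G")
    case True
    then have "0 \<le> r * G / p" using pr by simp
    then show ?thesis using d by linarith
  next
    case False
    have "r / p \<le> 1" using r pr by simp
    then have "1 * G \<le> r / p * G" using False by (intro mult_right_mono_neg) auto
    then show ?thesis using G by simp
  qed
  have rw2: "- ?d < \<rho> * G / p" using rw by (simp add: \<rho>_def)
  have le: "P \<le> r" "P \<le> \<rho>" using r \<rho>p by auto
  obtain C1 where C1: "0 \<le> C1" "\<And>(g::'a \<Rightarrow> real) h b k. 0 \<le> b \<Longrightarrow> dominated N P \<gamma> (2 ^ k) g h (b powr P) \<Longrightarrow>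
     weighted_integral r (r * G / p) (\<lambda>x. 2 powr (- real k * \<delta>) * g x)
        \<le> ennreal (C1 * 2 powr (real k * (?d * (r / p - 1))) * b powr r)"
    using B[OF le(1) rw1] by blast
  obtain C2 where C2: "0 \<le> C2" "\<And>(g::'a \<Rightarrow> real) h b k. 0 \<le> b \<Longrightarrow> dominated N P \<gamma> (2 ^ k) g h (b powr P) \<Longrightarrow>
     weighted_integral \<rho> (\<rho> * G / p) (\<lambda>x. 2 powr (- real k * \<delta>) * g x)
        \<le> ennreal (C2 * 2 powr (real k * (?d * (\<rho> / p - 1))) * b powr \<rho>)"
    using B[OF le(2) rw2] by blast
  define \<epsilon> where "\<epsilon> = ?d * (1 / p - 1 / \<rho>) / 2"
  define K where "K = p * (C1 powr (1 / r) * ((1 / (1 - 2 powr - \<epsilon>)) powr \<rho> * C2) powr (1 - 1 / r)) * (1 + 1 / (1 - 2 powr - (\<epsilon> * p)))"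
  show ?thesis
  proof (rule that[of K])
    have "0 < \<epsilon>" using \<rho>p pr d by (simp add: \<epsilon>_def field_simps)
    then have "2 powr - (\<epsilon> * p) < 2 powr 0" using pr by (intro powr_less_mono) auto
    then show "0 \<le> K" using pr by (auto simp: K_def intro!: mult_nonneg_nonneg add_nonneg_nonneg)
    fix g h :: "nat \<Rightarrow> 'a \<Rightarrow> real" and b :: "nat \<Rightarrow> real" and M :: nat
    assume A: "\<forall>k. 0 \<le> b k \<and> dominated N P \<gamma> (2 ^ k) (g k) (h k) (b k powr P)"
    then have b0: "\<And>k. 0 \<le> b k" and D: "\<And>k. dominated N P \<gamma> (2 ^ k) (g k) (h k) (b k powr P)" by auto
    from D have g0: "\<And>k x. 0 \<le> g k x" and [measurable]: "\<And>k. g k \<in> borel_measurable borel"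
      by (simp_all add: dominated_def)
    show "(\<integral>\<^sup>+x. ennreal ((\<Sum>k<M. 2 powr (- real k * \<delta>) * g k x) powr p * norm x powr G) \<partial>lborel)
        \<le> ennreal (K * (\<Sum>k<M. b k powr p))"
    proof (rule almost_orthogonal_sum[OF pr(1) r(2) d _ _ _ C1(1) C2(1) \<rho>_def _ _ \<epsilon>_def K_def])
      show "(\<integral>\<^sup>+x. ennreal ((2 powr (- real k * \<delta>) * g k x) powr r * norm x powr (r * G / p)) \<partial>lborel)
        \<le> ennreal (C1 * 2 powr (real k * (?d * (r / p - 1))) * b k powr r)" for k
        by (rule C1(2)[OF b0 D])
      show "(\<integral>\<^sup>+x. ennreal ((2 powr (- real k * \<delta>) * g k x) powr \<rho> * norm x powr (\<rho> * G / p)) \<partial>lborel)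
        \<le> ennreal (C2 * 2 powr (real k * (?d * (\<rho> / p - 1))) * b k powr \<rho>)" for k
        by (rule C2(2)[OF b0 D])
    qed (use g0 b0 in auto)
  qed
qed

section \<open>Fourier inversion\<close>

lemma cmod_exp_i [simp]:
  "cmod (exp (\<i> * complex_of_real a)) = 1" "cmod (exp (- (\<i> * complex_of_real a))) = 1"
  by (simp_all add: norm_exp_eq_Re)

lemma lborel_prod_coordinates:
  fixes f :: "'a::euclidean_space \<Rightarrow> real \<Rightarrow> complex"
  assumes f: "\<And>b. b \<in> Basis \<Longrightarrow> integrable lborel (f b)"
  shows "integrable lborel (\<lambda>x::'a. \<Prod>b\<in>Basis. f b (x \<bullet> b))"
    and "(\<integral>x. (\<Prod>b\<in>Basis. f b (x \<bullet> b)) \<partial>lborel) = (\<Prod>b\<in>Basis. \<integral>t. f b t \<partial>lborel)"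
proof -
  interpret product_sigma_finite "\<lambda>b::'a. lborel :: real measure" by standard
  let ?T = "\<lambda>g::'a \<Rightarrow> real. \<Sum>b\<in>Basis. g b *\<^sub>R b"
  have fm: "(\<lambda>x::'a. \<Prod>b\<in>Basis. f b (x \<bullet> b)) \<in> borel_measurable borel"
  proof (intro borel_measurable_prod)
    fix b :: 'a assume "b \<in> Basis"
    then have [measurable]: "f b \<in> borel_measurable borel" using f by auto
    show "(\<lambda>x. f b (x \<bullet> b)) \<in> borel_measurable borel" by measurable
  qed
  have T: "?T \<in> (\<Pi>\<^sub>M b\<in>Basis. lborel) \<rightarrow>\<^sub>M borel" by measurable
  have eq: "(\<Prod>b\<in>Basis. f b (?T g \<bullet> b)) = (\<Prod>b\<in>Basis. f b (g b))" for g
    by (intro prod.cong) auto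
  show "integrable lborel (\<lambda>x::'a. \<Prod>b\<in>Basis. f b (x \<bullet> b))"
    by (subst lborel_eq, subst integrable_distr_eq[OF T fm], unfold eq)
       (intro product_integrable_prod f finite_Basis)
  show "(\<integral>x. (\<Prod>b\<in>Basis. f b (x \<bullet> b)) \<partial>lborel) = (\<Prod>b\<in>Basis. \<integral>t. f b t \<partial>lborel)"
    by (subst lborel_eq, subst integral_distr[OF T fm], unfold eq)
       (intro product_integral_prod f finite_Basis)
qed

text \<open>Up to the factor \<open>sqrt (2 * pi)\<close> this is the characteristic function of the
  standard normal distribution.\<close>

lemma gaussian_fourier_real:
  fixes t :: real
  shows "integrable lborel (\<lambda>x. complex_of_real (exp (- (x * x) / 2)) * iexp (t * x))" (is ?I)
    and "(\<integral>x. complex_of_real (exp (- (x * x) / 2)) * iexp (t * x) \<partial>lborel) = complex_of_real (sqrt (2 * pi) * exp (- (t * t) / 2))"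
proof -
  let ?n = "\<lambda>x. std_normal_density x *\<^sub>R iexp (t * x)"
  have eq: "complex_of_real (exp (- (x * x) / 2)) * iexp (t * x) = complex_of_real (sqrt (2 * pi)) * ?n x" for x :: real
    by (simp add: std_normal_density_def scaleR_conv_of_real power2_eq_square exp_of_real[symmetric])
  have i: "integrable lborel ?n"
    by (rule Bochner_Integration.integrable_bound[OF integrable_normal_density[of 1 0]]) auto
  have "char std_normal_distribution t = (\<integral>x. ?n x \<partial>lborel)"
    unfolding char_def by (subst integral_density) auto
  then have I: "(\<integral>x. ?n x \<partial>lborel) = complex_of_real (exp (- (t * t) / 2))"
    by (simp add: char_std_normal_distribution power2_eq_square)
  show ?I unfolding eq by (intro integrable_mult_right i)
  show "(\<integral>x. complex_of_real (exp (- (x * x) / 2)) * iexp (t * x) \<partial>lborel) = complex_of_real (sqrt (2 * pi) * exp (- (t * t) / 2))"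
    unfolding eq integral_mult_right_zero I by simp
qed

definition gaussian :: "'a::euclidean_space \<Rightarrow> real" where
  "gaussian x = exp (- (x \<bullet> x) / 2)"

lemma gaussian_measurable [measurable]: "gaussian \<in> borel_measurable borel"
  unfolding gaussian_def[abs_def] by measurable

lemma gaussian_bounds [simp]: "0 \<le> gaussian x" "gaussian x \<le> 1" "\<bar>gaussian x\<bar> = gaussian x"
  by (auto simp: gaussian_def)

lemma gaussian_fourier:
  fixes y :: "'a::euclidean_space"
  shows "integrable lborel (\<lambda>x. gaussian x * iexp (y \<bullet> x))" (is ?I)
    and "(\<integral>x. gaussian x * iexp (y \<bullet> x) \<partial>lborel)
       = complex_of_real ((2 * pi) powr (real DIM('a) / 2) * gaussian y)" (is ?E)
proof -
  let ?f = "\<lambda>b x. complex_of_real (exp (- (x * x) / 2)) * iexp ((y \<bullet> b) * x)"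
  have eq: "gaussian x * iexp (y \<bullet> x) = (\<Prod>b\<in>Basis. ?f b (x \<bullet> b))" for x :: 'a
  proof -
    have "complex_of_real (gaussian x) = (\<Prod>b\<in>Basis. complex_of_real (exp (- ((x \<bullet> b) * (x \<bullet> b)) / 2)))"
      unfolding gaussian_def by (subst euclidean_inner) (simp add: exp_sum sum_negf[symmetric] sum_divide_distrib)
    moreover have "iexp (y \<bullet> x) = (\<Prod>b\<in>Basis. iexp ((y \<bullet> b) * (x \<bullet> b)))"
      by (subst euclidean_inner) (simp add: exp_sum sum_distrib_left)
    ultimately show ?thesis by (simp add: prod.distrib)
  qed
  show ?I unfolding eq by (intro lborel_prod_coordinates gaussian_fourier_real)
  have "(\<integral>x. gaussian x * iexp (y \<bullet> x) \<partial>lborel)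
     = (\<Prod>b\<in>Basis. complex_of_real (sqrt (2 * pi) * exp (- ((y \<bullet> b) * (y \<bullet> b)) / 2)))"
    unfolding eq by (subst lborel_prod_coordinates(2)) (simp_all only: gaussian_fourier_real)
  also have "\<dots> = complex_of_real (sqrt (2 * pi) ^ DIM('a) * (\<Prod>b\<in>Basis. exp (- ((y \<bullet> b) * (y \<bullet> b)) / 2)))"
    by (simp add: prod.distrib)
  also have "(\<Prod>b\<in>Basis. exp (- ((y \<bullet> b) * (y \<bullet> b)) / 2)) = gaussian y"
    unfolding gaussian_def by (subst (2) euclidean_inner) (simp add: exp_sum sum_negf[symmetric] sum_divide_distrib)
  also have "sqrt (2 * pi) ^ DIM('a) = (2 * pi) powr (real DIM('a) / 2)"
    by (simp add: powr_half_sqrt[symmetric] powr_realpow[symmetric] powr_powr)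
  finally show ?E .
qed

lemma gaussian_integrable: "integrable lborel (gaussian :: 'a::euclidean_space \<Rightarrow> real)"
proof -
  have "integrable lborel (\<lambda>x::'a. complex_of_real (gaussian x))"
    using gaussian_fourier(1)[of "0::'a"] by simp
  then show ?thesis by (subst (asm) complex_of_real_integrable_eq)
qed

lemma ft_integrand_integrable:
  assumes "integrable lborel (f :: 'a::euclidean_space \<Rightarrow> complex)"
  shows "integrable lborel (\<lambda>x. f x * exp (- (\<i> * complex_of_real (x \<bullet> \<xi>))))"
    "integrable lborel (\<lambda>x. f x * iexp (\<xi> \<bullet> x))"
proof -
  have [measurable]: "f \<in> borel_measurable borel" using assms by auto
  show "integrable lborel (\<lambda>x. f x * exp (- (\<i> * complex_of_real (x \<bullet> \<xi>))))"
    "integrable lborel (\<lambda>x. f x * iexp (\<xi> \<bullet> x))"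
    by (rule Bochner_Integration.integrable_bound[OF assms]; simp add: norm_mult)+
qed

lemma ft_continuous:
  fixes f :: "'a::euclidean_space \<Rightarrow> complex"
  assumes f: "integrable lborel f"
  shows "continuous_on UNIV (ft f)"
proof -
  have [measurable]: "f \<in> borel_measurable borel" using f by auto
  show ?thesis
  proof (rule continuous_on_sequentiallyI)
    fix u and a :: 'a assume u: "u \<longlonglongrightarrow> a"
    have "(\<lambda>n. \<integral>x. f x * exp (- (\<i> * complex_of_real (x \<bullet> u n))) \<partial>lborel)
        \<longlonglongrightarrow> (\<integral>x. f x * exp (- (\<i> * complex_of_real (x \<bullet> a))) \<partial>lborel)"
    proof (rule integral_dominated_convergence[where w="\<lambda>x. norm (f x)"])
      show "AE x in lborel. (\<lambda>n. f x * exp (- (\<i> * complex_of_real (x \<bullet> u n))))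
         \<longlonglongrightarrow> f x * exp (- (\<i> * complex_of_real (x \<bullet> a)))"
        using u by (intro AE_I2 tendsto_intros)
    qed (use f in \<open>auto simp: norm_mult\<close>)
    then show "(\<lambda>n. ft f (u n)) \<longlonglongrightarrow> ft f a"
      unfolding ft_def by (intro tendsto_intros)
  qed
qed

lemma two_pi_powr_cancel:
  "complex_of_real ((2 * pi) powr (- real n / 2)) * complex_of_real ((2 * pi) powr (real n / 2)) = 1"
  unfolding of_real_mult[symmetric] powr_add[symmetric] by simp

text \<open>Gaussian summation: the factor \<open>gaussian (\<xi> / m)\<close> makes Fubini's
  theorem applicable, and the regularised inverse transform becomes the Gaussian mean of
  \<open>f (x - v / m)\<close>. Dominated convergence applies on both sides, with majorant
  \<open>norm (ft f \<xi>)\<close> on the left and, by boundedness of \<open>f\<close>,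
  \<open>B * gaussian v\<close> on the right; continuity of \<open>f\<close> identifies the
  limit.\<close>

theorem fourier_inversion:
  fixes f :: "'a::euclidean_space \<Rightarrow> complex"
  assumes f: "integrable lborel f" "continuous_on UNIV f" and B: "\<And>x. norm (f x) \<le> B"
    and F: "integrable lborel (ft f)"
  shows "ift (ft f) x = f x"
proof -
  have [measurable]: "f \<in> borel_measurable borel" "ft f \<in> borel_measurable borel" using f F by auto
  let ?c = "complex_of_real ((2 * pi) powr (- real DIM('a) / 2))"
  let ?c' = "complex_of_real ((2 * pi) powr (real DIM('a) / 2))"
  let ?m = "\<lambda>n. real (Suc n)"
  define I where "I n = (\<integral>\<xi>. ft f \<xi> * iexp (x \<bullet> \<xi>) * gaussian (\<xi> /\<^sub>R ?m n) \<partial>lborel)" for n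
  have inv0: "(\<lambda>n. inverse (?m n)) \<longlonglongrightarrow> 0" by (rule LIMSEQ_inverse_real_of_nat)
  have "I \<longlonglongrightarrow> (\<integral>\<xi>. ft f \<xi> * iexp (x \<bullet> \<xi>) \<partial>lborel)"
    unfolding I_def
  proof (rule integral_dominated_convergence[where w="\<lambda>\<xi>. norm (ft f \<xi>)"])
    have "(\<lambda>n. ft f \<xi> * iexp (x \<bullet> \<xi>) * complex_of_real (gaussian (\<xi> /\<^sub>R ?m n)))
        \<longlonglongrightarrow> ft f \<xi> * iexp (x \<bullet> \<xi>) * complex_of_real (exp (- ((0 *\<^sub>R \<xi>) \<bullet> (0 *\<^sub>R \<xi>)) / 2))" for \<xi>
      unfolding gaussian_def by (intro tendsto_intros inv0) auto
    then show "AE \<xi> in lborel. (\<lambda>n. ft f \<xi> * iexp (x \<bullet> \<xi>) * gaussian (\<xi> /\<^sub>R ?m n))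
        \<longlonglongrightarrow> ft f \<xi> * iexp (x \<bullet> \<xi>)" by simp
    show "AE \<xi> in lborel. norm (ft f \<xi> * iexp (x \<bullet> \<xi>) * gaussian (\<xi> /\<^sub>R ?m n)) \<le> norm (ft f \<xi>)" for n
      by (auto simp: norm_mult intro!: AE_I2 mult_left_le)
  qed (use F in auto)
  then have L1: "(\<lambda>n. ?c * I n) \<longlonglongrightarrow> ift (ft f) x" unfolding ift_def by (intro tendsto_intros)
  have Eq: "?c * I n = ?c * (\<integral>v. f (x - v /\<^sub>R ?m n) * gaussian v \<partial>lborel)" for n
  proof -
    let ?s = "?m n"
    have s: "?s \<noteq> 0" "0 < ?s" by auto
    have gi: "integrable lborel (\<lambda>\<xi>::'a. gaussian (\<xi> /\<^sub>R ?s))"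
      using lborel_integrable_scale[OF gaussian_integrable, of "inverse ?s" 0] by simp
    define H where "H \<xi> y = ?c * (f y * exp (- (\<i> * complex_of_real (y \<bullet> \<xi>)))) * iexp (x \<bullet> \<xi>) * complex_of_real (gaussian (\<xi> /\<^sub>R ?s))" for \<xi> y
    have Hm: "(\<lambda>(\<xi>, y). H \<xi> y) \<in> borel_measurable (lborel \<Otimes>\<^sub>M lborel)" unfolding H_def by measurable
    have "I n = (\<integral>\<xi>. (\<integral>y. H \<xi> y \<partial>lborel) \<partial>lborel)"
      unfolding I_def ft_def H_def by simp
    also have "\<dots> = (\<integral>y. (\<integral>\<xi>. H \<xi> y \<partial>lborel) \<partial>lborel)"
    proof (rule lborel_pair.Fubini_integral[symmetric], rule lborel_pair.Fubini_integrable[OF Hm])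
      have nH: "norm (H \<xi> y) = norm ?c * norm (f y) * gaussian (\<xi> /\<^sub>R ?s)" for \<xi> y
        using gaussian_bounds(1)[of "\<xi> /\<^sub>R ?s"] by (simp add: H_def norm_mult)
      show "integrable lborel (\<lambda>\<xi>. \<integral>y. norm (case (\<xi>, y) of (\<xi>, y) \<Rightarrow> H \<xi> y) \<partial>lborel)"
        using gi by (simp add: nH)
      show "AE \<xi> in lborel. integrable lborel (\<lambda>y. case (\<xi>, y) of (\<xi>, y) \<Rightarrow> H \<xi> y)"
        using ft_integrand_integrable(1)[OF f(1)] by (simp add: H_def)
    qed
    also have "\<dots> = (\<integral>y. ?s ^ DIM('a) * (f y * gaussian (?s *\<^sub>R (x - y))) \<partial>lborel)"
    proof (intro Bochner_Integration.integral_cong refl)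
      fix y
      let ?g = "\<lambda>\<xi>. gaussian (\<xi> /\<^sub>R ?s) * iexp ((x - y) \<bullet> \<xi>)"
      have "integrable lborel (\<lambda>\<xi>::'a. complex_of_real (gaussian (\<xi> /\<^sub>R ?s)))" using gi by (subst complex_of_real_integrable_eq)
      from ft_integrand_integrable(2)[OF this] have gI: "integrable lborel ?g" .
      have "iexp ((x - y) \<bullet> \<xi>) = exp (- (\<i> * complex_of_real (y \<bullet> \<xi>))) * iexp (x \<bullet> \<xi>)" for \<xi>
        by (simp add: exp_add[symmetric] inner_diff_left right_diff_distrib)
      then have "(\<integral>\<xi>. H \<xi> y \<partial>lborel) = (\<integral>\<xi>. ?c * f y * ?g \<xi> \<partial>lborel)"
        by (intro Bochner_Integration.integral_cong refl) (simp add: H_def)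
      also have "\<dots> = ?c * f y * (\<integral>\<xi>. ?g \<xi> \<partial>lborel)" by simp
      also have "(\<integral>\<xi>. ?g \<xi> \<partial>lborel) = ?s ^ DIM('a) *\<^sub>R (\<integral>\<xi>. gaussian \<xi> * exp (\<i> * complex_of_real ((?s *\<^sub>R (x - y)) \<bullet> \<xi>)) \<partial>lborel)"
        using lborel_integral_scale[OF gI s(1), of 0] by simp
      also have "\<dots> = ?s ^ DIM('a) *\<^sub>R (?c' * gaussian (?s *\<^sub>R (x - y)))"
        by (subst gaussian_fourier(2)) simp
      also have "?c * f y * \<dots> = (?c * ?c') * (?s ^ DIM('a) * (f y * gaussian (?s *\<^sub>R (x - y))))"
        by (simp add: scaleR_conv_of_real ac_simps)
      finally show "(\<integral>\<xi>. H \<xi> y \<partial>lborel) = ?s ^ DIM('a) * (f y * gaussian (?s *\<^sub>R (x - y)))"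
        unfolding two_pi_powr_cancel by simp
    qed
    also have "\<dots> = ?s ^ DIM('a) * (\<integral>y. f y * gaussian (?s *\<^sub>R (x - y)) \<partial>lborel)" by simp
    also have "(\<integral>y. f y * gaussian (?s *\<^sub>R (x - y)) \<partial>lborel)
       = (\<bar>- inverse ?s\<bar> ^ DIM('a)) *\<^sub>R (\<integral>v. f (x - v /\<^sub>R ?s) * gaussian v \<partial>lborel)"
    proof -
      have "integrable lborel (\<lambda>y. f y * gaussian (?s *\<^sub>R (x - y)))"
        by (rule Bochner_Integration.integrable_bound[OF f(1)])
          (auto simp: norm_mult gaussian_bounds intro!: mult_left_le)
      from lborel_integral_scale[OF this, of "- inverse ?s" x] show ?thesis
        using s by simp
    qed
    also have "?s ^ DIM('a) * (\<bar>- inverse ?s\<bar> ^ DIM('a)) *\<^sub>R (\<integral>v. f (x - v /\<^sub>R ?s) * gaussian v \<partial>lborel)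
       = (\<integral>v. f (x - v /\<^sub>R ?s) * gaussian v \<partial>lborel)"
      using s by (simp add: scaleR_conv_of_real power_mult_distrib[symmetric] mult.assoc[symmetric] del: of_nat_Suc)
    finally show ?thesis by simp
  qed
  have "(\<lambda>n. \<integral>v. f (x - v /\<^sub>R ?m n) * gaussian v \<partial>lborel) \<longlonglongrightarrow> (\<integral>v. f x * gaussian (v::'a) \<partial>lborel)"
  proof (rule integral_dominated_convergence[where w="\<lambda>v::'a. B * gaussian v"])
    show "integrable lborel (\<lambda>v::'a. B * gaussian v)" by (intro integrable_mult_right gaussian_integrable)
    show "AE v in lborel. norm (f (x - v /\<^sub>R ?m n) * gaussian v) \<le> B * gaussian v" for n
      using B gaussian_bounds by (auto simp: norm_mult intro!: mult_right_mono)
    have "(\<lambda>n. x - v /\<^sub>R ?m n) \<longlonglongrightarrow> x - 0 *\<^sub>R v" for v :: 'a by (intro tendsto_intros inv0)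
    then have "(\<lambda>n. f (x - v /\<^sub>R ?m n)) \<longlonglongrightarrow> f x" for v :: 'a
      using f(2) by (intro continuous_on_tendsto_compose[OF f(2)]) auto
    then show "AE v in lborel. (\<lambda>n. f (x - v /\<^sub>R ?m n) * gaussian v) \<longlonglongrightarrow> f x * gaussian v"
      by (intro AE_I2 tendsto_intros)
  qed auto
  then have L2: "(\<lambda>n. ?c * (\<integral>v. f (x - v /\<^sub>R ?m n) * gaussian v \<partial>lborel)) \<longlonglongrightarrow> ?c * (\<integral>v. f x * gaussian (v::'a) \<partial>lborel)"
    by (intro tendsto_intros)
  have E: "?c * (\<integral>v. f x * gaussian (v::'a) \<partial>lborel) = f x"
  proof -
    have "(\<integral>v. complex_of_real (gaussian (v::'a)) \<partial>lborel) = ?c'"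
      using gaussian_fourier(2)[of "0::'a"] by (simp add: gaussian_def)
    then have "?c * (\<integral>v. f x * gaussian (v::'a) \<partial>lborel) = ?c * ?c' * f x" by simp
    then show ?thesis unfolding two_pi_powr_cancel by simp
  qed
  show ?thesis using LIMSEQ_unique[OF L1[unfolded Eq] L2] unfolding E .
qed

section \<open>Integrability of Schwartz functions and the kernels of the dyadic blocks\<close>

lemma schwartz_decay:
  assumes "\<phi> \<in> schwartz" "set vs \<subseteq> Basis"
  obtains C where "0 \<le> C" "\<And>x. norm (dderiv vs \<phi> x) \<le> C * (1 + norm x) powr - real N"
proof -
  from assms obtain C where C: "\<And>x. (1 + norm x) ^ N * norm (dderiv vs \<phi> x) \<le> C"
    unfolding schwartz_def by blast
  show ?thesis
  proof (rule that[of C])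
    show "0 \<le> C" using C[of 0] by (auto intro: order_trans[OF norm_ge_zero])
    fix x :: 'a
    have pos: "0 < (1 + norm x) ^ N" by (simp add: add_pos_nonneg)
    have "(1 + norm x) powr - real N = 1 / (1 + norm x) ^ N"
      by (simp add: powr_minus_divide powr_realpow add_pos_nonneg)
    then show "norm (dderiv vs \<phi> x) \<le> C * (1 + norm x) powr - real N"
      using C[of x] pos by (simp add: pos_le_divide_eq mult.commute)
  qed
qed

lemma schwartz_continuous:
  assumes "\<phi> \<in> schwartz" "set vs \<subseteq> Basis"
  shows "continuous_on UNIV (dderiv vs \<phi>)"
  using assms unfolding schwartz_def
  by (auto intro!: continuous_at_imp_continuous_on differentiable_imp_continuous_within)

lemma schwartz_continuous0: "\<phi> \<in> schwartz \<Longrightarrow> continuous_on UNIV \<phi>"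
  using schwartz_continuous[of \<phi> "[]"] by simp

lemma schwartz_measurable: "\<phi> \<in> schwartz \<Longrightarrow> \<phi> \<in> borel_measurable borel"
  by (intro borel_measurable_continuous_onI schwartz_continuous0)

lemma decay_integrable:
  assumes "real DIM('a::euclidean_space) < M"
  shows "integrable lborel (\<lambda>x::'a. (1 + norm x) powr - M)"
proof -
  obtain C where "(\<integral>\<^sup>+y. ennreal ((1 + norm (y::'a)) powr - M) \<partial>lborel) \<le> ennreal C"
    using nn_integral_decay[OF assms] by blast
  then have "(\<integral>\<^sup>+y. ennreal (norm ((1 + norm (y::'a)) powr - M)) \<partial>lborel) < \<infinity>"
    by (auto simp: le_less_trans)
  then show ?thesis by (intro integrableI_bounded) auto
qed

lemma schwartz_weighted_integrable:
  fixes \<phi> :: "'a::euclidean_space \<Rightarrow> complex"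
  assumes \<phi>: "\<phi> \<in> schwartz"
  shows "integrable lborel (\<lambda>x. (1 + norm x) ^ m * norm (\<phi> x))"
proof -
  let ?N = "m + DIM('a) + 1"
  obtain C where C: "0 \<le> C" "\<And>x. norm (dderiv [] \<phi> x) \<le> C * (1 + norm x) powr - real ?N"
    by (rule schwartz_decay[OF \<phi>, of "[]" ?N]) auto
  have [measurable]: "\<phi> \<in> borel_measurable borel" by (rule schwartz_measurable[OF \<phi>])
  show ?thesis
  proof (rule Bochner_Integration.integrable_bound)
    show "integrable lborel (\<lambda>x::'a. C * (1 + norm x) powr - (real DIM('a) + 1))"
      by (intro integrable_mult_right decay_integrable) auto
    show "AE x in lborel. norm ((1 + norm x) ^ m * norm (\<phi> x)) \<le> norm (C * (1 + norm x) powr - (real DIM('a) + 1))"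
    proof (intro AE_I2)
      fix x :: 'a
      have pos: "0 < 1 + norm x" by (simp add: add_pos_nonneg)
      have "(1 + norm x) ^ m * norm (\<phi> x) \<le> (1 + norm x) powr real m * (C * (1 + norm x) powr - real ?N)"
        using C(2)[of x] pos by (simp add: powr_realpow mult_left_mono)
      also have "\<dots> = C * (1 + norm x) powr - (real DIM('a) + 1)"
        by (simp add: mult.left_commute[of _ C] powr_add[symmetric])
      finally show "norm ((1 + norm x) ^ m * norm (\<phi> x)) \<le> norm (C * (1 + norm x) powr - (real DIM('a) + 1))"
        using C(1) by (simp add: abs_mult)
    qed
  qed measurable
qed

lemma schwartz_integrable:
  fixes \<phi> :: "'a::euclidean_space \<Rightarrow> complex"
  assumes "\<phi> \<in> schwartz" shows "integrable lborel \<phi>"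
proof -
  have [measurable]: "\<phi> \<in> borel_measurable borel" by (rule schwartz_measurable[OF assms])
  have "integrable lborel (\<lambda>x. norm (\<phi> x))" using schwartz_weighted_integrable[OF assms, of 0] by simp
  then show ?thesis by (subst (asm) integrable_norm_iff) auto
qed

lemma compact_support_integrable:
  fixes m :: "'a::euclidean_space \<Rightarrow> complex"
  assumes "continuous_on UNIV m" "\<And>\<xi>. r \<le> norm \<xi> \<Longrightarrow> m \<xi> = 0"
  shows "integrable lborel m"
proof -
  have "integrable lborel (\<lambda>\<xi>. indicator (cball 0 r) \<xi> *\<^sub>R m \<xi>)"
    by (intro borel_integrable_compact continuous_on_subset[OF assms(1)]) auto
  moreover have "indicator (cball 0 r) \<xi> *\<^sub>R m \<xi> = m \<xi>" for \<xi>
    using assms(2)[of \<xi>] by (auto simp: indicator_def)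
  ultimately show ?thesis by simp
qed

lemma ift_scale:
  fixes m :: "'a::euclidean_space \<Rightarrow> complex"
  assumes m: "integrable lborel m" and a: "0 < a"
  shows "ift (\<lambda>\<xi>. m (a *\<^sub>R \<xi>)) x = complex_of_real ((1 / a) ^ DIM('a)) * ift m (x /\<^sub>R a)"
proof -
  let ?g = "\<lambda>\<xi>. m (a *\<^sub>R \<xi>) * iexp (x \<bullet> \<xi>)"
  have "integrable lborel (\<lambda>\<xi>. m (a *\<^sub>R \<xi>))"
    using lborel_integrable_scale[OF m, of a 0] a by simp
  then have "integrable lborel ?g" by (rule ft_integrand_integrable)
  then have "(\<integral>\<xi>. ?g \<xi> \<partial>lborel) = (\<bar>1 / a\<bar> ^ DIM('a)) *\<^sub>R (\<integral>\<xi>. ?g (0 + (1 / a) *\<^sub>R \<xi>) \<partial>lborel)"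
    using a by (intro lborel_integral_scale) auto
  also have "(\<integral>\<xi>. ?g (0 + (1 / a) *\<^sub>R \<xi>) \<partial>lborel) = (\<integral>\<xi>. m \<xi> * iexp ((x /\<^sub>R a) \<bullet> \<xi>) \<partial>lborel)"
    using a by (simp add: divide_inverse)
  finally have I: "(\<integral>\<xi>. ?g \<xi> \<partial>lborel) = complex_of_real ((1 / a) ^ DIM('a)) * (\<integral>\<xi>. m \<xi> * iexp ((x /\<^sub>R a) \<bullet> \<xi>) \<partial>lborel)"
    using a by (simp only: scaleR_conv_of_real abs_of_pos zero_less_divide_1_iff)
  show ?thesis unfolding ift_def I by (simp only: ac_simps)
qed

lemma ift_diff:
  fixes m n :: "'a::euclidean_space \<Rightarrow> complex"
  assumes "integrable lborel m" "integrable lborel n"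
  shows "ift (\<lambda>\<xi>. m \<xi> - n \<xi>) x = ift m x - ift n x"
  using ft_integrand_integrable(2)[OF assms(1), of x] ft_integrand_integrable(2)[OF assms(2), of x]
  unfolding ift_def by (simp add: left_diff_distrib right_diff_distrib)

text \<open>The dilation that preserves the integral for positive \<open>t\<close>; on the Fourier
  side it is \<open>ft f (\<xi> / t)\<close>.\<close>

definition dilate :: "real \<Rightarrow> ('a::euclidean_space \<Rightarrow> complex) \<Rightarrow> 'a \<Rightarrow> complex" where
  "dilate t f x = complex_of_real (t ^ DIM('a)) * f (t *\<^sub>R x)"

text \<open>Convolution with \<open>dilate s \<phi>\<close> multiplies the spectrum by
  \<open>ft \<phi> (\<xi> / s)\<close>, which is 1 wherever \<open>m\<close> does not vanish. With
  \<open>ift m\<close> written as an integral this is one application of Fubini's theorem.\<close>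

lemma band_limited_reproducing:
  fixes \<phi> m :: "'a::euclidean_space \<Rightarrow> complex"
  assumes \<phi>: "integrable lborel \<phi>" and m: "integrable lborel m" and s: "0 < s"
    and supp: "\<And>\<xi>. m \<xi> \<noteq> 0 \<Longrightarrow> ft \<phi> (\<xi> /\<^sub>R s) = 1"
  shows "(\<integral>z. complex_of_real ((2 * pi) powr (- real DIM('a) / 2)) * dilate s \<phi> z * ift m (u - z) \<partial>lborel) = ift m u"
proof -
  have [measurable]: "\<phi> \<in> borel_measurable borel" "m \<in> borel_measurable borel" using \<phi> m by auto
  let ?c = "complex_of_real ((2 * pi) powr (- real DIM('a) / 2))"
  have di: "integrable lborel (dilate s \<phi>)"
    using lborel_integrable_scale[OF \<phi>, of s 0] s unfolding dilate_def by simp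
  have [measurable]: "dilate s \<phi> \<in> borel_measurable borel" using di by auto
  define H where "H z \<xi> = ?c * dilate s \<phi> z * (?c * (m \<xi> * iexp ((u - z) \<bullet> \<xi>)))" for z \<xi>
  have Hm: "(\<lambda>(z, \<xi>). H z \<xi>) \<in> borel_measurable (lborel \<Otimes>\<^sub>M lborel)" unfolding H_def by measurable
  have "(\<integral>z. ?c * dilate s \<phi> z * ift m (u - z) \<partial>lborel) = (\<integral>z. (\<integral>\<xi>. H z \<xi> \<partial>lborel) \<partial>lborel)"
    unfolding H_def ift_def by simp
  also have "\<dots> = (\<integral>\<xi>. (\<integral>z. H z \<xi> \<partial>lborel) \<partial>lborel)"
  proof (rule lborel_pair.Fubini_integral[symmetric], rule lborel_pair.Fubini_integrable[OF Hm])
    have nH: "norm (H z \<xi>) = norm ?c * norm (dilate s \<phi> z) * (norm ?c * norm (m \<xi>))" for z \<xi>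
      by (simp add: H_def norm_mult)
    show "integrable lborel (\<lambda>z. \<integral>\<xi>. norm (case (z, \<xi>) of (z, \<xi>) \<Rightarrow> H z \<xi>) \<partial>lborel)"
      using di by (simp add: nH)
    show "AE z in lborel. integrable lborel (\<lambda>\<xi>. case (z, \<xi>) of (z, \<xi>) \<Rightarrow> H z \<xi>)"
      using ft_integrand_integrable(2)[OF m] by (simp add: H_def)
  qed
  also have "\<dots> = (\<integral>\<xi>. ?c * (m \<xi> * iexp (u \<bullet> \<xi>)) \<partial>lborel)"
  proof (intro Bochner_Integration.integral_cong refl)
    fix \<xi>
    let ?g = "\<lambda>z. dilate s \<phi> z * exp (- (\<i> * complex_of_real (z \<bullet> \<xi>)))"
    have "iexp ((u - z) \<bullet> \<xi>) = exp (- (\<i> * complex_of_real (z \<bullet> \<xi>))) * iexp (u \<bullet> \<xi>)" for z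
      by (simp add: exp_add[symmetric] inner_diff_left right_diff_distrib)
    then have "H z \<xi> = ?c * (m \<xi> * iexp (u \<bullet> \<xi>)) * (?c * ?g z)" for z
      by (simp add: H_def)
    then have "(\<integral>z. H z \<xi> \<partial>lborel) = ?c * (m \<xi> * iexp (u \<bullet> \<xi>)) * (?c * (\<integral>z. ?g z \<partial>lborel))"
      by simp
    also have "?c * (\<integral>z. ?g z \<partial>lborel) = ft \<phi> (\<xi> /\<^sub>R s)"
    proof -
      have "(\<integral>z. ?g z \<partial>lborel) = (\<bar>1 / s\<bar> ^ DIM('a)) *\<^sub>R (\<integral>z. ?g (0 + (1 / s) *\<^sub>R z) \<partial>lborel)"
        using s ft_integrand_integrable(1)[OF di] by (intro lborel_integral_scale) auto
      also have "\<dots> = (\<integral>z. \<phi> z * exp (- (\<i> * complex_of_real (z \<bullet> (\<xi> /\<^sub>R s)))) \<partial>lborel)"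
      proof -
        have "(\<integral>z. ?g (0 + (1 / s) *\<^sub>R z) \<partial>lborel)
           = (\<integral>z. complex_of_real (s ^ DIM('a)) * (\<phi> z * exp (- (\<i> * complex_of_real (z \<bullet> (\<xi> /\<^sub>R s))))) \<partial>lborel)"
          using s by (intro Bochner_Integration.integral_cong refl) (simp add: dilate_def divide_inverse)
        also have "\<dots> = s ^ DIM('a) *\<^sub>R (\<integral>z. \<phi> z * exp (- (\<i> * complex_of_real (z \<bullet> (\<xi> /\<^sub>R s)))) \<partial>lborel)"
          unfolding scaleR_conv_of_real by (rule integral_mult_right_zero)
        finally show ?thesis using s by (simp add: power_divide)
      qed
      finally show ?thesis unfolding ft_def by simp
    qed
    also have "?c * (m \<xi> * iexp (u \<bullet> \<xi>)) * ft \<phi> (\<xi> /\<^sub>R s) = ?c * (m \<xi> * iexp (u \<bullet> \<xi>))"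
      using supp[of \<xi>] by (cases "m \<xi> = 0") auto
    finally show "(\<integral>z. H z \<xi> \<partial>lborel) = ?c * (m \<xi> * iexp (u \<bullet> \<xi>))" .
  qed
  also have "\<dots> = ift m u" unfolding ift_def by simp
  finally show ?thesis .
qed

text \<open>Fourier inversion writes the kernels as differences of dilates of \<open>\<phi>\<close>, so that they are
  Schwartz functions without any regularity theory for \<open>ft\<close>. The reproducing formula uses
  the factor \<open>ft \<phi> (2^-(k+1) \<xi>)\<close>, which is \<open>1\<close> on the support of \<open>phihat \<phi> k\<close>.\<close>

lemma phihat_kernel:
  fixes \<phi> :: "'a::euclidean_space \<Rightarrow> complex"
  assumes \<phi>: "\<phi> \<in> schwartz"
    and one: "\<And>\<xi>. norm \<xi> \<le> 1 \<Longrightarrow> ft \<phi> \<xi> = 1"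
    and zero: "\<And>\<xi>. norm \<xi> \<ge> 3/2 \<Longrightarrow> ft \<phi> \<xi> = 0"
  shows "ift (phihat \<phi> k) x = dilate (2 ^ k) \<phi> x - (if k = 0 then 0 else dilate (2 ^ (k - 1)) \<phi> x)" (is ?A)
    and "(\<integral>z. complex_of_real ((2 * pi) powr (- real DIM('a) / 2)) * dilate (2 ^ (k + 1)) \<phi> z * ift (phihat \<phi> k) (x - z) \<partial>lborel)
      = ift (phihat \<phi> k) x" (is ?B)
proof -
  have i: "integrable lborel \<phi>" by (rule schwartz_integrable[OF \<phi>])
  have F: "integrable lborel (ft \<phi>)"
    using zero by (rule compact_support_integrable[OF ft_continuous[OF i]])
  obtain B where B: "\<And>x. norm (dderiv [] \<phi> x) \<le> B * (1 + norm x) powr - real 0"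
    by (rule schwartz_decay[OF \<phi>, of "[]" 0]) auto
  have inv: "ift (ft \<phi>) y = \<phi> y" for y
  proof (rule fourier_inversion[OF i schwartz_continuous0[OF \<phi>] _ F])
    show "norm (\<phi> x) \<le> B" for x using B[of x] by (simp split: if_splits add: add_nonneg_eq_0_iff)
  qed
  define a where "a k = 2 powr (- real k)" for k
  have a: "0 < a k" "a k = 1 / 2 ^ k" for k by (auto simp: a_def powr_minus_divide powr_realpow)
  have ak: "integrable lborel (\<lambda>\<xi>. ft \<phi> (a k *\<^sub>R \<xi>))" for k
    using lborel_integrable_scale[OF F, of "a k" 0] a(1)[of k] by simp
  have ia: "ift (\<lambda>\<xi>. ft \<phi> (a k *\<^sub>R \<xi>)) x = dilate (2 ^ k) \<phi> x" for k
    using ift_scale[OF F a(1), of k x] by (simp add: inv dilate_def a(2))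
  \<comment> \<open>For positive \<open>k\<close> the scale \<open>2 powr (- real k + 1)\<close> is
    \<open>a (k - 1)\<close>; the case distinction keeps the truncated subtraction harmless at
    \<open>k = 0\<close>.\<close>
  have ph: "phihat \<phi> k = (\<lambda>\<xi>. ft \<phi> (a k *\<^sub>R \<xi>) - (if k = 0 then 0 else ft \<phi> (a (k - 1) *\<^sub>R \<xi>)))"
    by (rule ext) (auto simp: phihat_def a_def of_nat_diff)
  show ?A
  proof (cases "k = 0")
    case True then show ?thesis using ia[of k] unfolding ph by simp
  next
    case False then show ?thesis using ift_diff[OF ak ak, of k "k - 1" x] unfolding ph by (simp add: ia)
  qed
  have pi: "integrable lborel (phihat \<phi> k)"
    unfolding ph using ak by (cases "k = 0") auto
  show ?B
  proof (rule band_limited_reproducing[OF i pi])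
    fix \<xi> assume nz: "phihat \<phi> k \<xi> \<noteq> 0"
    \<comment> \<open>Beyond this radius both terms of \<open>phihat\<close> vanish, the subtracted
      one already beyond half of it. The dilate of \<open>ft \<phi>\<close> at level
      \<open>k\<close> is 1 only up to \<open>2^k\<close>; at level \<open>k + 1\<close> it is 1 up
      to \<open>2^(k+1)\<close>, which exceeds the radius.\<close>
    have "norm \<xi> < 3 / 2 * 2 ^ k"
    proof (rule ccontr)
      assume "\<not> norm \<xi> < 3 / 2 * 2 ^ k"
      then have n: "norm \<xi> \<ge> 3 / 2 * 2 ^ k" by simp
      then have 1: "norm (a k *\<^sub>R \<xi>) \<ge> 3 / 2" by (simp add: a(2) field_simps)
      have "norm (a (k - 1) *\<^sub>R \<xi>) \<ge> 3 / 2" if "k \<noteq> 0"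
      proof -
        have "a k \<le> a (k - 1)" by (simp add: a_def)
        then have "norm (a k *\<^sub>R \<xi>) \<le> norm (a (k - 1) *\<^sub>R \<xi>)"
          using a(1)[of k] a(1)[of "k - 1"] by (simp add: mult_right_mono)
        then show ?thesis using 1 by linarith
      qed
      then show False using nz 1 zero unfolding ph by (auto split: if_splits)
    qed
    moreover have "0 < (2::real) ^ k" by simp
    ultimately have "norm \<xi> \<le> 2 ^ (k + 1)" by (simp only: power_add power_one_right)
    then show "ft \<phi> (\<xi> /\<^sub>R 2 ^ (k + 1)) = 1"
      by (intro one) (simp add: field_simps)
  qed simp
qed

section \<open>Schwartz functions and tempered distributions\<close>

lemma schwartz_has_derivative:
  assumes "f \<in> schwartz" "set vs \<subseteq> Basis"
  shows "(dderiv vs f has_derivative frechet_derivative (dderiv vs f) (at x)) (at x)"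
  using assms unfolding schwartz_def by (auto simp: frechet_derivative_works[symmetric])

lemma schwartz_bound:
  assumes "f \<in> schwartz" "set vs \<subseteq> Basis"
  obtains C where "0 \<le> C" "\<And>x. (1 + norm x) ^ N * norm (dderiv vs f x) \<le> C"
proof -
  from assms obtain C where C: "\<And>x. (1 + norm x) ^ N * norm (dderiv vs f x) \<le> C"
    unfolding schwartz_def by blast
  moreover have "0 \<le> C" using C[of 0] by (auto intro: order_trans[OF norm_ge_zero])
  ultimately show ?thesis using that by blast
qed

lemma dderiv_add:
  assumes "f \<in> schwartz" "g \<in> schwartz" "set vs \<subseteq> Basis"
  shows "dderiv vs (\<lambda>x. f x + g x) = (\<lambda>x. dderiv vs f x + dderiv vs g x)"
  using assms(3)
proof (induction vs)
  case (Cons v vs)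
  then have IH: "dderiv vs (\<lambda>x. f x + g x) = (\<lambda>x. dderiv vs f x + dderiv vs g x)" and vs: "set vs \<subseteq> Basis" by auto
  show ?case
    using frechet_derivative_at[OF has_derivative_add[OF schwartz_has_derivative[OF assms(1) vs] schwartz_has_derivative[OF assms(2) vs]]]
    by (simp add: IH fun_eq_iff)
qed simp

lemma dderiv_cmult:
  assumes "f \<in> schwartz" "set vs \<subseteq> Basis"
  shows "dderiv vs (\<lambda>x. c * f x) = (\<lambda>x. c * dderiv vs f x)"
  using assms(2)
proof (induction vs)
  case (Cons v vs)
  then have IH: "dderiv vs (\<lambda>x. c * f x) = (\<lambda>x. c * dderiv vs f x)" and vs: "set vs \<subseteq> Basis" by auto
  show ?case
    using frechet_derivative_at[OF has_derivative_mult_right[OF schwartz_has_derivative[OF assms(1) vs], of c]]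
    by (simp add: IH fun_eq_iff)
qed simp

lemma dderiv_affine:
  assumes "f \<in> schwartz" "set vs \<subseteq> Basis"
  shows "dderiv vs (\<lambda>x. f (a + t *\<^sub>R x)) = (\<lambda>x. complex_of_real (t ^ length vs) * dderiv vs f (a + t *\<^sub>R x))"
  using assms(2)
proof (induction vs)
  case (Cons v vs)
  then have IH: "dderiv vs (\<lambda>x. f (a + t *\<^sub>R x)) = (\<lambda>x. complex_of_real (t ^ length vs) * dderiv vs f (a + t *\<^sub>R x))"
    and vs: "set vs \<subseteq> Basis" by auto
  have "((\<lambda>x. dderiv vs f (a + t *\<^sub>R x)) has_derivative (\<lambda>h. frechet_derivative (dderiv vs f) (at (a + t *\<^sub>R x)) (t *\<^sub>R h))) (at x)" for x
  proof -
    have "((\<lambda>x. a + t *\<^sub>R x) has_derivative (\<lambda>h. t *\<^sub>R h)) (at x)"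
      by (auto intro!: derivative_eq_intros)
    from has_derivative_compose[OF this schwartz_has_derivative[OF assms(1) vs]] show ?thesis .
  qed
  then have "frechet_derivative (\<lambda>x. complex_of_real (t ^ length vs) * dderiv vs f (a + t *\<^sub>R x)) (at x)
     = (\<lambda>h. complex_of_real (t ^ length vs) * frechet_derivative (dderiv vs f) (at (a + t *\<^sub>R x)) (t *\<^sub>R h))" for x
    by (intro frechet_derivative_at[symmetric] has_derivative_mult_right)
  moreover have "frechet_derivative (dderiv vs f) (at y) (t *\<^sub>R v) = t *\<^sub>R frechet_derivative (dderiv vs f) (at y) v" for y
    using schwartz_has_derivative[OF assms(1) vs, of y]
    by (intro linear_scale) (auto dest: has_derivative_linear)
  ultimately show ?case
    by (simp add: IH fun_eq_iff scaleR_conv_of_real)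
qed simp

lemma schwartz_add:
  assumes f: "f \<in> schwartz" and g: "g \<in> schwartz"
  shows "(\<lambda>x. f x + g x) \<in> schwartz"
  unfolding schwartz_def
proof (intro CollectI allI impI conjI)
  fix vs :: "'a list" assume vs: "set vs \<subseteq> Basis"
  show "dderiv vs (\<lambda>x. f x + g x) differentiable at x" for x
    unfolding dderiv_add[OF f g vs] using f g vs by (auto simp: schwartz_def)
  fix N
  obtain A where A: "\<And>x. (1 + norm x) ^ N * norm (dderiv vs f x) \<le> A" using schwartz_bound[OF f vs, of N] by blast
  obtain B where B: "\<And>x. (1 + norm x) ^ N * norm (dderiv vs g x) \<le> B" using schwartz_bound[OF g vs, of N] by blast
  show "\<exists>C. \<forall>x. (1 + norm x) ^ N * norm (dderiv vs (\<lambda>x. f x + g x) x) \<le> C"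
  proof (intro exI[of _ "A + B"] allI)
    fix x
    have "(1 + norm x) ^ N * norm (dderiv vs f x + dderiv vs g x)
       \<le> (1 + norm x) ^ N * (norm (dderiv vs f x) + norm (dderiv vs g x))"
      by (intro mult_left_mono norm_triangle_ineq) auto
    also have "\<dots> \<le> A + B" using A[of x] B[of x] by (simp add: distrib_left)
    finally show "(1 + norm x) ^ N * norm (dderiv vs (\<lambda>x. f x + g x) x) \<le> A + B"
      unfolding dderiv_add[OF f g vs] .
  qed
qed

lemma schwartz_cmult:
  assumes f: "f \<in> schwartz"
  shows "(\<lambda>x. c * f x) \<in> schwartz"
  unfolding schwartz_def
proof (intro CollectI allI impI conjI)
  fix vs :: "'a list" assume vs: "set vs \<subseteq> Basis"
  show "dderiv vs (\<lambda>x. c * f x) differentiable at x" for x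
    unfolding dderiv_cmult[OF f vs] using f vs by (auto simp: schwartz_def intro!: differentiable_mult)
  fix N
  obtain A where A: "\<And>x. (1 + norm x) ^ N * norm (dderiv vs f x) \<le> A" using schwartz_bound[OF f vs, of N] by blast
  show "\<exists>C. \<forall>x. (1 + norm x) ^ N * norm (dderiv vs (\<lambda>x. c * f x) x) \<le> C"
    unfolding dderiv_cmult[OF f vs]
    using mult_left_mono[OF A norm_ge_zero[of c]]
    by (intro exI[of _ "norm c * A"]) (simp add: norm_mult mult.left_commute)
qed

lemma schwartz_affine:
  assumes f: "f \<in> schwartz" and t: "t \<noteq> 0"
  shows "(\<lambda>x. f (a + t *\<^sub>R x)) \<in> schwartz"
  unfolding schwartz_def
proof (intro CollectI allI impI conjI)
  fix vs :: "'a list" assume vs: "set vs \<subseteq> Basis"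
  have d: "(\<lambda>x. dderiv vs f (a + t *\<^sub>R x)) differentiable at x" for x
    using f vs by (intro differentiable_compose[of "dderiv vs f" "\<lambda>x. a + t *\<^sub>R x"]) (auto simp: schwartz_def)
  show "dderiv vs (\<lambda>x. f (a + t *\<^sub>R x)) differentiable at x" for x
    unfolding dderiv_affine[OF f vs] by (intro differentiable_mult d) auto
  fix N
  obtain A where A: "0 \<le> A" "\<And>x. (1 + norm x) ^ N * norm (dderiv vs f x) \<le> A" by (rule schwartz_bound[OF f vs, of N]) (rule that)
  define D where "D = 1 + (1 + norm a) / \<bar>t\<bar>"
  have D: "1 + norm x \<le> D * (1 + norm (a + t *\<^sub>R x))" for x
  proof -
    have "\<bar>t\<bar> * norm x \<le> norm (a + t *\<^sub>R x) + norm a"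
      using norm_triangle_ineq4[of "a + t *\<^sub>R x" a] by simp
    also have "\<dots> \<le> (1 + norm a) * (1 + norm (a + t *\<^sub>R x))" by (simp add: algebra_simps)
    finally have "norm x \<le> (1 + norm a) / \<bar>t\<bar> * (1 + norm (a + t *\<^sub>R x))"
      using t by (simp add: field_simps)
    then show ?thesis by (simp add: D_def distrib_right add_increasing)
  qed
  have "D \<ge> 0" by (simp add: D_def)
  show "\<exists>C. \<forall>x. (1 + norm x) ^ N * norm (dderiv vs (\<lambda>x. f (a + t *\<^sub>R x)) x) \<le> C"
  proof (intro exI allI)
    fix x
    let ?y = "a + t *\<^sub>R x"
    have "(1 + norm x) ^ N * norm (dderiv vs f ?y) \<le> (D * (1 + norm ?y)) ^ N * norm (dderiv vs f ?y)"
      by (intro mult_right_mono power_mono D) auto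
    also have "\<dots> = D ^ N * ((1 + norm ?y) ^ N * norm (dderiv vs f ?y))" by (simp add: power_mult_distrib)
    also have "\<dots> \<le> D ^ N * A" using \<open>D \<ge> 0\<close> by (intro mult_left_mono A) auto
    finally have "\<bar>t\<bar> ^ length vs * ((1 + norm x) ^ N * norm (dderiv vs f ?y)) \<le> \<bar>t\<bar> ^ length vs * (D ^ N * A)"
      by (intro mult_left_mono) auto
    then show "(1 + norm x) ^ N * norm (dderiv vs (\<lambda>x. f (a + t *\<^sub>R x)) x) \<le> \<bar>t\<bar> ^ length vs * (D ^ N * A)"
      unfolding dderiv_affine[OF f vs] by (simp add: norm_mult norm_power power_abs mult.left_commute)
  qed
qed

lemma schwartz_sum:
  assumes "finite F" "\<And>i. i \<in> F \<Longrightarrow> f i \<in> schwartz" "F \<noteq> {}"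
  shows "(\<lambda>x. \<Sum>i\<in>F. c i * f i x) \<in> schwartz"
  using assms(1,3,2)
  by (induction F rule: finite_ne_induct) (auto intro!: schwartz_add schwartz_cmult)

lemma dderiv_sum:
  assumes "finite F" "\<And>i. i \<in> F \<Longrightarrow> f i \<in> schwartz" "F \<noteq> {}" "set vs \<subseteq> Basis"
  shows "dderiv vs (\<lambda>x. \<Sum>i\<in>F. c i * f i x) = (\<lambda>x. \<Sum>i\<in>F. c i * dderiv vs (f i) x)"
  using assms(1,3,2)
proof (induction F rule: finite_ne_induct)
  case (singleton i)
  then show ?case by (simp add: dderiv_cmult assms(4))
next
  case (insert i F)
  then show ?case
    by (simp add: dderiv_add dderiv_cmult schwartz_cmult schwartz_sum assms(4))
qed

lemma finite_multi_directions:
  "finite {vs. set vs \<subseteq> (Basis :: 'a::euclidean_space set) \<and> length vs \<le> N}"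
  by (intro finite_lists_length_le finite_Basis)

text \<open>A supremum of reals can be estimated from below by its members only over a bounded set.
  The common bound \<open>B\<close> supplies boundedness, and the member with no derivatives at the
  origin shows that the seminorm is nonnegative.\<close>

lemma sw_seminorm_bounds:
  fixes f :: "'a::euclidean_space \<Rightarrow> complex"
  assumes f: "f \<in> schwartz"
    and B: "\<And>vs x. set vs \<subseteq> Basis \<Longrightarrow> length vs \<le> N \<Longrightarrow> (1 + norm x) ^ N * norm (dderiv vs f x) \<le> B"
  shows "0 \<le> sw_seminorm N f" "sw_seminorm N f \<le> B"
proof -
  let ?A = "{vs. set vs \<subseteq> (Basis :: 'a set) \<and> length vs \<le> N} \<times> (UNIV :: 'a set)"
  have ne: "([], 0) \<in> ?A" by simp
  have le: "(1 + norm (snd vx)) ^ N * norm (dderiv (fst vx) f (snd vx)) \<le> B" if "vx \<in> ?A" for vx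
    using that B by auto
  show "sw_seminorm N f \<le> B" unfolding sw_seminorm_def
  proof (rule cSUP_least)
    show "?A \<noteq> {}" using ne by blast
  qed (rule le)
  let ?g = "\<lambda>vx::'a list \<times> 'a. (1 + norm (snd vx)) ^ N * norm (dderiv (fst vx) f (snd vx))"
  have "0 \<le> ?g ([], 0)" by simp
  also have "\<dots> \<le> sw_seminorm N f"
    unfolding sw_seminorm_def by (rule cSUP_upper[OF ne]) (rule bdd_aboveI2[OF le])
  finally show "0 \<le> sw_seminorm N f" .
qed

text \<open>Trades the seminorm for an arbitrary common bound \<open>B\<close> on the weighted
  derivatives, so that later proofs estimate derivatives only and never touch the supremum.\<close>

lemma tempered_bound:
  fixes T :: "('a::euclidean_space \<Rightarrow> complex) \<Rightarrow> 'b::real_normed_vector"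
  assumes "tempered J T"
  obtains C N where "0 \<le> C" "\<And>f B. f \<in> schwartz \<Longrightarrow>
    (\<And>vs x. set vs \<subseteq> Basis \<Longrightarrow> length vs \<le> N \<Longrightarrow> (1 + norm x) ^ N * norm (dderiv vs f x) \<le> B) \<Longrightarrow> norm (T f) \<le> C * B"
proof -
  from assms obtain C N where C: "\<And>f. f \<in> schwartz \<Longrightarrow> norm (T f) \<le> C * sw_seminorm N f"
    unfolding tempered_def by blast
  show ?thesis
  proof (rule that[of "\<bar>C\<bar>" N])
    fix f :: "'a \<Rightarrow> complex" and B assume f: "f \<in> schwartz"
      and B: "\<And>vs x. set vs \<subseteq> Basis \<Longrightarrow> length vs \<le> N \<Longrightarrow> (1 + norm x) ^ N * norm (dderiv vs f x) \<le> B"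
    note sw = sw_seminorm_bounds[OF f B]
    have "norm (T f) \<le> C * sw_seminorm N f" by (rule C[OF f])
    also have "\<dots> \<le> \<bar>C\<bar> * sw_seminorm N f" using sw by (intro mult_right_mono) auto
    also have "\<dots> \<le> \<bar>C\<bar> * B" using sw by (intro mult_left_mono) auto
    finally show "norm (T f) \<le> \<bar>C\<bar> * B" .
  qed simp
qed

lemma tempered_add:
  assumes "tempered J T" "f \<in> schwartz" "g \<in> schwartz"
  shows "T (\<lambda>x. f x + g x) = T f + T g"
  using assms(1)[unfolded tempered_def, THEN conjunct1, rule_format, OF assms(2,3)] .

lemma tempered_cmult:
  assumes "tempered J T" "f \<in> schwartz"
  shows "T (\<lambda>x. c * f x) = cscale J c (T f)"
  using assms(1)[unfolded tempered_def, THEN conjunct2, THEN conjunct1, rule_format, OF assms(2)] .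

lemma tempered_diff:
  assumes T: "tempered J T" and f: "f \<in> schwartz" and g: "g \<in> schwartz"
  shows "T (\<lambda>x. f x - g x) = T f - T g"
proof -
  have "T (\<lambda>x. f x + (- 1) * g x) = T f + T (\<lambda>x. (- 1) * g x)"
    by (rule tempered_add[OF T f schwartz_cmult[OF g]])
  also have "T (\<lambda>x. (- 1) * g x) = cscale J (- 1) (T g)"
    by (rule tempered_cmult[OF T g])
  finally show ?thesis by (simp add: cscale_def)
qed

lemma tempered_sum_norm_le:
  assumes J: "complex_structure J" and T: "tempered J T"
    and F: "finite F" "F \<noteq> {}" and f: "\<And>i. i \<in> F \<Longrightarrow> f i \<in> schwartz"
  shows "norm (T (\<lambda>x. \<Sum>i\<in>F. c i * f i x)) \<le> (\<Sum>i\<in>F. norm (c i) * norm (T (f i)))"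
  using F f
proof (induction F rule: finite_ne_induct)
  have cm: "norm (T (\<lambda>x. c i * f i x)) = norm (c i) * norm (T (f i))" if "f i \<in> schwartz" for i
    using J that unfolding complex_structure_def by (simp add: tempered_cmult[OF T])
  {
    case (singleton i)
    then show ?case using cm[of i] by simp
  next
    case (insert i F)
    then have "T (\<lambda>x. c i * f i x + (\<Sum>i\<in>F. c i * f i x)) = T (\<lambda>x. c i * f i x) + T (\<lambda>x. \<Sum>i\<in>F. c i * f i x)"
      by (intro tempered_add[OF T] schwartz_cmult schwartz_sum) auto
    then have "norm (T (\<lambda>x. c i * f i x + (\<Sum>i\<in>F. c i * f i x)))
       \<le> norm (c i) * norm (T (f i)) + norm (T (\<lambda>x. \<Sum>i\<in>F. c i * f i x))"
      using cm[of i] insert norm_triangle_ineq[of "T (\<lambda>x. c i * f i x)" "T (\<lambda>x. \<Sum>i\<in>F. c i * f i x)"] by simp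
    also have "\<dots> \<le> norm (c i) * norm (T (f i)) + (\<Sum>i\<in>F. norm (c i) * norm (T (f i)))"
      using insert by auto
    finally show ?case using insert by simp
  }
qed

text \<open>Mean value inequality on the segment from \<open>x\<close> to \<open>y\<close>. The
  decay of the gradient at a point \<open>w\<close> of the segment is transferred to
  \<open>x\<close> by \<open>one_plus_norm_le\<close>, which costs the factor
  \<open>(1 + |x - y|)^N\<close>. The gradient is controlled by summing the bounds for the basis
  directions.\<close>

lemma schwartz_lipschitz:
  fixes f :: "'a::euclidean_space \<Rightarrow> complex"
  assumes f: "f \<in> schwartz" and vs: "set vs \<subseteq> Basis"
  obtains L where "0 \<le> L" "\<And>x y. (1 + norm x) ^ N * norm (dderiv vs f x - dderiv vs f y) \<le> L * norm (x - y) * (1 + norm (x - y)) ^ N"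
proof -
  have "\<forall>b\<in>Basis. \<exists>C. \<forall>x. (1 + norm x) ^ N * norm (dderiv (b # vs) f x) \<le> C"
  proof
    fix b :: 'a assume "b \<in> Basis"
    then have "set (b # vs) \<subseteq> Basis" using vs by auto
    then show "\<exists>C. \<forall>x. (1 + norm x) ^ N * norm (dderiv (b # vs) f x) \<le> C"
      using f unfolding schwartz_def by blast
  qed
  from bchoice[OF this] obtain C where C: "\<And>b x. b \<in> Basis \<Longrightarrow> (1 + norm x) ^ N * norm (frechet_derivative (dderiv vs f) (at x) b) \<le> C b"
    by auto
  define L where "L = (\<Sum>b\<in>(Basis::'a set). C b)"
  have C0: "0 \<le> C b" if "b \<in> Basis" for b
    using C[OF that, of 0] by (auto intro: order_trans[OF norm_ge_zero])
  let ?D = "\<lambda>x. frechet_derivative (dderiv vs f) (at x)"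
  have on: "onorm (?D w) \<le> L / (1 + norm w) ^ N" for w
  proof (rule onorm_le)
    fix h :: 'a
    have lin: "linear (?D w)" using schwartz_has_derivative[OF f vs] by (auto dest: has_derivative_linear)
    have "?D w h = ?D w (\<Sum>b\<in>Basis. (h \<bullet> b) *\<^sub>R b)" by (simp add: euclidean_representation)
    also have "\<dots> = (\<Sum>b\<in>Basis. (h \<bullet> b) *\<^sub>R ?D w b)"
      using lin by (simp add: linear_sum linear_scale)
    finally have "norm (?D w h) \<le> (\<Sum>b\<in>Basis. norm ((h \<bullet> b) *\<^sub>R ?D w b))"
      using norm_sum[of "\<lambda>b. (h \<bullet> b) *\<^sub>R ?D w b" Basis] by simp
    also have "\<dots> \<le> (\<Sum>b\<in>(Basis::'a set). norm h * (C b / (1 + norm w) ^ N))"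
    proof (intro sum_mono)
      fix b :: 'a assume b: "b \<in> Basis"
      have "norm (?D w b) \<le> C b / (1 + norm w) ^ N"
        using C[OF b, of w] by (simp add: le_divide_eq mult.commute add_pos_nonneg)
      then have "\<bar>h \<bullet> b\<bar> * norm (?D w b) \<le> norm h * (C b / (1 + norm w) ^ N)"
        using Basis_le_norm[OF b, of h] by (intro mult_mono) auto
      then show "norm ((h \<bullet> b) *\<^sub>R ?D w b) \<le> norm h * (C b / (1 + norm w) ^ N)" by simp
    qed
    also have "\<dots> = L / (1 + norm w) ^ N * norm h"
      by (simp add: L_def sum_distrib_left[symmetric] sum_divide_distrib[symmetric])
    finally show "norm (?D w h) \<le> L / (1 + norm w) ^ N * norm h" .
  qed
  show ?thesis
  proof (rule that[of L])
    show L0: "0 \<le> L" unfolding L_def by (intro sum_nonneg C0)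
    fix x y :: 'a
    let ?B = "L * (1 + norm (x - y)) ^ N / (1 + norm x) ^ N"
    let ?S = "{x + s *\<^sub>R (y - x) | s. s \<in> {0..1::real}}"
    have B: "onorm (?D w) \<le> ?B" if w: "w \<in> ?S" for w
    proof -
      obtain s where s01: "s \<in> {0..1}" and sw: "w = x + s *\<^sub>R (y - x)" using w by blast
      then have s: "w = x + s *\<^sub>R (y - x)" "0 \<le> s" "s \<le> 1" by auto
      have "norm (x - w) = s * norm (x - y)" using s by (simp add: norm_minus_commute)
      also have "\<dots> \<le> norm (x - y)" using s by (simp add: mult_left_le_one_le)
      finally have "(1 + norm (x - w)) * (1 + norm w) \<le> (1 + norm (x - y)) * (1 + norm w)"
        by (intro mult_right_mono) auto
      with one_plus_norm_le[of x w] have "1 + norm x \<le> (1 + norm (x - y)) * (1 + norm w)"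
        by (rule order_trans)
      then have "(1 + norm x) ^ N \<le> ((1 + norm (x - y)) * (1 + norm w)) ^ N" by (intro power_mono) auto
      then have "1 / (1 + norm w) ^ N \<le> (1 + norm (x - y)) ^ N / (1 + norm x) ^ N"
        by (simp add: power_mult_distrib divide_le_eq le_divide_eq add_pos_nonneg mult.commute)
      then have "L * (1 / (1 + norm w) ^ N) \<le> L * ((1 + norm (x - y)) ^ N / (1 + norm x) ^ N)"
        using L0 by (rule mult_left_mono)
      then show ?thesis using on[of w] by simp
    qed
    have "norm (dderiv vs f (x + (y - x)) - dderiv vs f x) \<le> norm (y - x) * ?B"
    proof (rule differentiable_bound_segment[where G="?S" and f'="?D"])
      show "(dderiv vs f has_derivative ?D w) (at w within ?S)" if "w \<in> ?S" for w
        by (rule has_derivative_at_withinI[OF schwartz_has_derivative[OF f vs]])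
      show "onorm (?D (x + s *\<^sub>R (y - x))) \<le> ?B" if "s \<in> {0..1}" for s
        by (rule B) (use that in blast)
    qed auto
    then have "norm (dderiv vs f x - dderiv vs f y) \<le> norm (x - y) * ?B" by (simp add: norm_minus_commute)
    then show "(1 + norm x) ^ N * norm (dderiv vs f x - dderiv vs f y) \<le> L * norm (x - y) * (1 + norm (x - y)) ^ N"
      by (simp add: le_divide_eq add_pos_nonneg mult.commute mult.left_commute)
  qed
qed

lemma schwartz_lipschitz_uniform:
  fixes f :: "'a::euclidean_space \<Rightarrow> complex"
  assumes f: "f \<in> schwartz"
  obtains L where "0 \<le> L" "\<And>vs x y. set vs \<subseteq> Basis \<Longrightarrow> length vs \<le> N \<Longrightarrow>
    (1 + norm x) ^ N * norm (dderiv vs f x - dderiv vs f y) \<le> L * norm (x - y) * (1 + norm (x - y)) ^ N"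
proof -
  let ?A = "{vs. set vs \<subseteq> (Basis :: 'a set) \<and> length vs \<le> N}"
  have "\<forall>vs\<in>?A. \<exists>L. 0 \<le> L \<and> (\<forall>x y. (1 + norm x) ^ N * norm (dderiv vs f x - dderiv vs f y) \<le> L * norm (x - y) * (1 + norm (x - y)) ^ N)"
  proof
    fix vs assume "vs \<in> ?A"
    then have vs: "set vs \<subseteq> Basis" by simp
    obtain L where "0 \<le> L" "\<And>x y. (1 + norm x) ^ N * norm (dderiv vs f x - dderiv vs f y) \<le> L * norm (x - y) * (1 + norm (x - y)) ^ N"
      by (rule schwartz_lipschitz[OF f vs, of N]) (rule that)
    then show "\<exists>L. 0 \<le> L \<and> (\<forall>x y. (1 + norm x) ^ N * norm (dderiv vs f x - dderiv vs f y) \<le> L * norm (x - y) * (1 + norm (x - y)) ^ N)"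
      by blast
  qed
  from bchoice[OF this] obtain L where L0: "\<And>vs. vs \<in> ?A \<Longrightarrow> 0 \<le> L vs"
    and L: "\<And>vs x y. vs \<in> ?A \<Longrightarrow> (1 + norm x) ^ N * norm (dderiv vs f x - dderiv vs f y) \<le> L vs * norm (x - y) * (1 + norm (x - y)) ^ N"
    by blast
  show ?thesis
  proof (rule that[of "\<Sum>vs\<in>?A. L vs"])
    show "0 \<le> (\<Sum>vs\<in>?A. L vs)" by (intro sum_nonneg L0)
    fix vs :: "'a list" and x y :: 'a assume vs: "set vs \<subseteq> Basis" "length vs \<le> N"
    then have "(1 + norm x) ^ N * norm (dderiv vs f x - dderiv vs f y) \<le> L vs * norm (x - y) * (1 + norm (x - y)) ^ N"
      by (intro L) simp
    also have "\<dots> \<le> (\<Sum>vs\<in>?A. L vs) * norm (x - y) * (1 + norm (x - y)) ^ N"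
      using vs L0 by (intro mult_right_mono member_le_sum finite_multi_directions) auto
    finally show "(1 + norm x) ^ N * norm (dderiv vs f x - dderiv vs f y) \<le> (\<Sum>vs\<in>?A. L vs) * norm (x - y) * (1 + norm (x - y)) ^ N" .
  qed
qed

lemma has_derivative_difference_quotients:
  assumes "(f has_derivative D) (at u)" "v \<noteq> 0"
  shows "(\<lambda>n. real (Suc n) *\<^sub>R (f (u + v /\<^sub>R real (Suc n)) - f u)) \<longlonglongrightarrow> D v"
proof -
  have lin: "linear D" and lim: "((\<lambda>h. norm (f (u + h) - f u - D h) / norm h) \<longlongrightarrow> 0) (at 0)"
    using assms(1) by (auto simp: has_derivative_at dest: bounded_linear.linear)
  have "(\<lambda>n. v /\<^sub>R real (Suc n)) \<longlonglongrightarrow> 0 *\<^sub>R v"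
    by (intro tendsto_scaleR LIMSEQ_inverse_real_of_nat tendsto_const)
  then have "filterlim (\<lambda>n. v /\<^sub>R real (Suc n)) (at 0) sequentially"
    using assms(2) by (simp add: filterlim_at del: of_nat_Suc)
  from filterlim_compose[OF lim this]
  have "(\<lambda>n. norm v * (norm (f (u + v /\<^sub>R real (Suc n)) - f u - D (v /\<^sub>R real (Suc n))) / norm (v /\<^sub>R real (Suc n)))) \<longlonglongrightarrow> norm v * 0"
    by (intro tendsto_mult tendsto_const)
  moreover have "norm v * (norm (f (u + v /\<^sub>R real (Suc n)) - f u - D (v /\<^sub>R real (Suc n))) / norm (v /\<^sub>R real (Suc n)))
     = norm (real (Suc n) *\<^sub>R (f (u + v /\<^sub>R real (Suc n)) - f u) - D v)" for n
  proof -
    let ?m = "real (Suc n)"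
    have "real (Suc n) *\<^sub>R (f (u + v /\<^sub>R ?m) - f u) - D v = ?m *\<^sub>R (f (u + v /\<^sub>R ?m) - f u - D (v /\<^sub>R ?m))"
      using lin by (simp add: linear_scale scaleR_diff_right del: of_nat_Suc)
    then show ?thesis using assms(2) by (simp add: divide_inverse del: of_nat_Suc) 
  qed
  ultimately have "(\<lambda>n. norm (real (Suc n) *\<^sub>R (f (u + v /\<^sub>R real (Suc n)) - f u) - D v)) \<longlonglongrightarrow> 0" by simp
  then show ?thesis by (simp add: LIM_zero_cancel tendsto_norm_zero_iff del: of_nat_Suc)
qed

text \<open>Induction on the number of derivatives: the difference quotients with step
  \<open>v / (n+1)\<close> are bounded by the Lipschitz constant of the preceding derivative, which
  permits dominated convergence under the integral. Integrability is stated for a general shift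
  \<open>r z\<close> because it is applied to the identity and to simple functions approximating
  it.\<close>

lemma dderiv_convolution:
  fixes f K :: "'a::euclidean_space \<Rightarrow> complex"
  assumes f: "f \<in> schwartz" and K: "integrable lborel K"
    and rep: "\<And>u. f u = (\<integral>z. K z * f (u - z) \<partial>lborel)" and vs: "set vs \<subseteq> Basis"
  shows "\<And>r. r \<in> borel_measurable borel \<Longrightarrow> integrable lborel (\<lambda>z. K z * dderiv vs f (u - r z))"
    and "dderiv vs f u = (\<integral>z. K z * dderiv vs f (u - z) \<partial>lborel)"
proof -
  have [measurable]: "K \<in> borel_measurable borel" using K by auto
  have int: "integrable lborel (\<lambda>z. K z * dderiv vs f (u - r z))"
    if vs: "set vs \<subseteq> Basis" and [measurable]: "r \<in> borel_measurable borel" for vs u r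
  proof -
    have [measurable]: "dderiv vs f \<in> borel_measurable borel"
      by (intro borel_measurable_continuous_onI schwartz_continuous f vs)
    obtain C where C: "0 \<le> C" "\<And>x. (1 + norm x) ^ 0 * norm (dderiv vs f x) \<le> C"
      by (rule schwartz_bound[OF f vs, of 0]) (rule that)
    show ?thesis
    proof (rule Bochner_Integration.integrable_bound)
      show "integrable lborel (\<lambda>z. norm (K z) * C)" using K by simp
      show "AE z in lborel. norm (K z * dderiv vs f (u - r z)) \<le> norm (norm (K z) * C)"
        using C by (auto simp: norm_mult intro!: AE_I2 mult_left_mono)
    qed measurable
  qed
  show "integrable lborel (\<lambda>z. K z * dderiv vs f (u - r z))" if "r \<in> borel_measurable borel" for r
    by (rule int[OF vs that])
  show "dderiv vs f u = (\<integral>z. K z * dderiv vs f (u - z) \<partial>lborel)"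
    using vs
  proof (induction vs arbitrary: u)
    case Nil
    show ?case unfolding dderiv.simps by (rule rep)
  next
    case (Cons v vs)
    from Cons.prems have vs: "set vs \<subseteq> Basis" and v: "v \<in> Basis" "v \<noteq> 0" by auto
    note IH = Cons.IH[OF vs]
    have [measurable]: "dderiv vs f \<in> borel_measurable borel" "dderiv (v # vs) f \<in> borel_measurable borel"
      using Cons.prems vs by (auto intro!: borel_measurable_continuous_onI schwartz_continuous f simp del: dderiv.simps)
    let ?q = "\<lambda>n w. real (Suc n) *\<^sub>R (dderiv vs f (w + v /\<^sub>R real (Suc n)) - dderiv vs f w)"
    have q: "(\<lambda>n. ?q n w) \<longlonglongrightarrow> dderiv (v # vs) f w" for w
      using has_derivative_difference_quotients[OF schwartz_has_derivative[OF f vs] v(2)] by simp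
    obtain L where L: "0 \<le> L" "\<And>x y. (1 + norm x) ^ 0 * norm (dderiv vs f x - dderiv vs f y) \<le> L * norm (x - y) * (1 + norm (x - y)) ^ 0"
      by (rule schwartz_lipschitz[OF f vs, of 0]) (rule that)
    have "(\<lambda>n. \<integral>z. K z * ?q n (u - z) \<partial>lborel) \<longlonglongrightarrow> (\<integral>z. K z * dderiv (v # vs) f (u - z) \<partial>lborel)"
    proof (rule integral_dominated_convergence[where w="\<lambda>z. norm (K z) * L"])
      show "integrable lborel (\<lambda>z. norm (K z) * L)" using K by simp
      show "AE z in lborel. (\<lambda>n. K z * ?q n (u - z)) \<longlonglongrightarrow> K z * dderiv (v # vs) f (u - z)"
        by (intro AE_I2 tendsto_mult tendsto_const q)
      have "norm (?q n w) \<le> L" for n w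
      proof -
        have "norm (dderiv vs f (w + v /\<^sub>R real (Suc n)) - dderiv vs f w) \<le> L * (norm v / real (Suc n))"
          using L(2)[of "w + v /\<^sub>R real (Suc n)" w] by (simp add: divide_inverse mult.commute del: of_nat_Suc)
        then have "real (Suc n) * norm (dderiv vs f (w + v /\<^sub>R real (Suc n)) - dderiv vs f w) \<le> L"
          using v by (simp add: field_simps del: of_nat_Suc)
        then show ?thesis by simp
      qed
      then show "AE z in lborel. norm (K z * ?q n (u - z)) \<le> norm (K z) * L" for n
        by (auto simp only: norm_mult intro!: AE_I2 mult_left_mono norm_ge_zero)
    qed measurable
    moreover have "(\<integral>z. K z * ?q n (u - z) \<partial>lborel) = ?q n u" for n
    proof -
      let ?m = "real (Suc n)"
      have "(\<integral>z. K z * ?q n (u - z) \<partial>lborel)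
         = (\<integral>z. ?m *\<^sub>R (K z * dderiv vs f ((u + v /\<^sub>R ?m) - z) - K z * dderiv vs f (u - z)) \<partial>lborel)"
        by (intro Bochner_Integration.integral_cong refl) (simp add: algebra_simps)
      also have "\<dots> = ?m *\<^sub>R ((\<integral>z. K z * dderiv vs f ((u + v /\<^sub>R ?m) - z) \<partial>lborel) - (\<integral>z. K z * dderiv vs f (u - z) \<partial>lborel))"
        using int[OF vs, of "\<lambda>z. z" "u + v /\<^sub>R ?m"] int[OF vs, of "\<lambda>z. z" u] by simp
      also have "\<dots> = ?q n u" by (simp only: IH[symmetric])
      finally show ?thesis .
    qed
    ultimately show ?case using LIMSEQ_unique[OF q] by simp
  qed
qed

lemma schwartz_reflect: "f \<in> schwartz \<Longrightarrow> (\<lambda>y. f (w - y)) \<in> schwartz"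
  using schwartz_affine[of f "- 1" w] by simp

lemma dderiv_reflect:
  assumes "f \<in> schwartz" "set vs \<subseteq> Basis"
  shows "dderiv vs (\<lambda>y. f (w - y)) y = (- 1) ^ length vs * dderiv vs f (w - y)"
  using fun_cong[OF dderiv_affine[OF assms, of w "- 1"], of y] by simp

section \<open>Tempered distributions on translates of a Schwartz function\<close>

context
  fixes J :: "'b::real_normed_vector \<Rightarrow> 'b" and T :: "('a::euclidean_space \<Rightarrow> complex) \<Rightarrow> 'b" and f :: "'a \<Rightarrow> complex"
  assumes T: "tempered J T" and f: "f \<in> schwartz"
begin

text \<open>Continuity of \<open>T\<close> turns a Lipschitz bound in the Schwartz seminorms into a
  Lipschitz bound for \<open>T\<close> on translates, with polynomial growth in \<open>w\<close>.
  The boundedness of \<open>T\<close> and the bound on the derivatives are exported too, because the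
  convolution estimate needs all three with the same \<open>C\<close>, \<open>L\<close> and
  \<open>N\<close>.\<close>

lemma tempered_translate_perturbation:
  obtains C L N where "0 \<le> C" "0 \<le> L"
    "\<And>w w'. norm (T (\<lambda>y. f (w - y)) - T (\<lambda>y. f (w' - y))) \<le> C * (L * norm (w - w') * (1 + norm w) ^ N * (1 + norm (w - w')) ^ N)"
    "\<And>g B. g \<in> schwartz \<Longrightarrow> (\<And>vs x. set vs \<subseteq> Basis \<Longrightarrow> length vs \<le> N \<Longrightarrow> (1 + norm x) ^ N * norm (dderiv vs g x) \<le> B) \<Longrightarrow> norm (T g) \<le> C * B"
    "\<And>vs w w' y. set vs \<subseteq> Basis \<Longrightarrow> length vs \<le> N \<Longrightarrow> (1 + norm y) ^ N * norm (dderiv vs f (w - y) - dderiv vs f (w' - y))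
       \<le> L * norm (w - w') * (1 + norm w) ^ N * (1 + norm (w - w')) ^ N"
proof -
  obtain C N where C: "0 \<le> C" "\<And>g B. g \<in> schwartz \<Longrightarrow>
      (\<And>vs x. set vs \<subseteq> Basis \<Longrightarrow> length vs \<le> N \<Longrightarrow> (1 + norm x) ^ N * norm (dderiv vs g x) \<le> B) \<Longrightarrow> norm (T g) \<le> C * B"
    using tempered_bound[OF T] by metis
  obtain L where L: "0 \<le> L" "\<And>vs x y. set vs \<subseteq> Basis \<Longrightarrow> length vs \<le> N \<Longrightarrow>
      (1 + norm x) ^ N * norm (dderiv vs f x - dderiv vs f y) \<le> L * norm (x - y) * (1 + norm (x - y)) ^ N"
    by (rule schwartz_lipschitz_uniform[OF f, of N]) (rule that)
  have key: "(1 + norm y) ^ N * norm (dderiv vs f (w - y) - dderiv vs f (w' - y))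
       \<le> L * norm (w - w') * (1 + norm w) ^ N * (1 + norm (w - w')) ^ N"
    if "set vs \<subseteq> Basis" "length vs \<le> N" for vs w w' y
  proof -
    have "1 + norm y \<le> (1 + norm (w - y)) * (1 + norm w)"
      using one_plus_norm_le[of y w] by (simp add: norm_minus_commute)
    then have "(1 + norm y) ^ N \<le> (1 + norm w) ^ N * (1 + norm (w - y)) ^ N"
      unfolding power_mult_distrib[symmetric] by (intro power_mono) (auto simp: mult.commute)
    then have "(1 + norm y) ^ N * norm (dderiv vs f (w - y) - dderiv vs f (w' - y))
       \<le> (1 + norm w) ^ N * ((1 + norm (w - y)) ^ N * norm (dderiv vs f (w - y) - dderiv vs f (w' - y)))"
      by (simp add: mult_right_mono mult.assoc[symmetric])
    also have "\<dots> \<le> (1 + norm w) ^ N * (L * norm (w - w') * (1 + norm (w - w')) ^ N)"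
      using L(2)[OF that, of "w - y" "w' - y"] by (intro mult_left_mono) auto
    finally show ?thesis by (simp only: ac_simps)
  qed
  show ?thesis
  proof (rule that[OF C(1) L(1) _ C(2) key])
    fix w w'
    have sw: "(\<lambda>y. f (w - y)) \<in> schwartz" "(\<lambda>y. f (w' - y)) \<in> schwartz" by (auto intro: schwartz_reflect f)
    have d: "(\<lambda>y. f (w - y) + (- 1) * f (w' - y)) \<in> schwartz"
      by (intro schwartz_add schwartz_cmult sw)
    have "norm (T (\<lambda>y. f (w - y) + (- 1) * f (w' - y))) \<le> C * (L * norm (w - w') * (1 + norm w) ^ N * (1 + norm (w - w')) ^ N)"
    proof (rule C(2)[OF d])
      fix vs :: "'a list" and y :: 'a assume vs: "set vs \<subseteq> Basis" "length vs \<le> N"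
      have "dderiv vs (\<lambda>y. f (w - y) + (- 1) * f (w' - y)) y = (- 1) ^ length vs * (dderiv vs f (w - y) - dderiv vs f (w' - y))"
        unfolding dderiv_add[OF sw(1) schwartz_cmult[OF sw(2)] vs(1)] dderiv_cmult[OF sw(2) vs(1)] dderiv_reflect[OF f vs(1)]
        by (simp add: algebra_simps)
      then show "(1 + norm y) ^ N * norm (dderiv vs (\<lambda>y. f (w - y) + (- 1) * f (w' - y)) y)
         \<le> L * norm (w - w') * (1 + norm w) ^ N * (1 + norm (w - w')) ^ N"
        using key[OF vs, of y w w'] by (simp add: norm_mult norm_power)
    qed
    then show "norm (T (\<lambda>y. f (w - y)) - T (\<lambda>y. f (w' - y))) \<le> C * (L * norm (w - w') * (1 + norm w) ^ N * (1 + norm (w - w')) ^ N)"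
      by (simp add: tempered_diff[OF T sw])
  qed
qed

lemma tempered_translate_continuous: "continuous_on UNIV (\<lambda>x. T (\<lambda>y. f (x - y)))"
proof (rule tempered_translate_perturbation)
  fix C L :: real and N :: nat
  assume le: "\<And>w w'. norm (T (\<lambda>y. f (w - y)) - T (\<lambda>y. f (w' - y))) \<le> C * (L * norm (w - w') * (1 + norm w) ^ N * (1 + norm (w - w')) ^ N)"
  show ?thesis
  proof (intro continuous_at_imp_continuous_on ballI)
    fix x :: 'a
    have "((\<lambda>w. C * (L * norm (x - w) * (1 + norm x) ^ N * (1 + norm (x - w)) ^ N)) \<longlongrightarrow>
        C * (L * norm (x - x) * (1 + norm x) ^ N * (1 + norm (x - x)) ^ N)) (at x)"
      by (intro tendsto_intros)
    then have "((\<lambda>w. C * (L * norm (x - w) * (1 + norm x) ^ N * (1 + norm (x - w)) ^ N)) \<longlongrightarrow> 0) (at x)" by simp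
    then have "((\<lambda>w. T (\<lambda>y. f (w - y)) - T (\<lambda>y. f (x - y))) \<longlongrightarrow> 0) (at x)"
    proof (rule Lim_null_comparison[rotated])
      show "\<forall>\<^sub>F w in at x. norm (T (\<lambda>y. f (w - y)) - T (\<lambda>y. f (x - y))) \<le> C * (L * norm (x - w) * (1 + norm x) ^ N * (1 + norm (x - w)) ^ N)"
        by (intro always_eventually allI) (subst norm_minus_commute, rule le)
    qed
    then show "isCont (\<lambda>x. T (\<lambda>y. f (x - y))) x" unfolding isCont_def by (rule LIM_zero_cancel)
  qed
qed

text \<open>The convolution integral is approximated by finite sums over the values of simple functions
  \<open>r n\<close> tending to the identity; the sums converge in the Schwartz seminorms.\<close>

lemma tempered_convolution_norm_le:
  fixes K :: "'a \<Rightarrow> complex"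
  assumes J: "complex_structure J"
    and Km [measurable]: "K \<in> borel_measurable borel" and Kint: "\<And>m. integrable lborel (\<lambda>z. (1 + norm z) ^ m * norm (K z))"
    and rep: "\<And>u. f u = (\<integral>z. K z * f (u - z) \<partial>lborel)"
  shows "ennreal (norm (T (\<lambda>y. f (x - y)))) \<le> (\<integral>\<^sup>+z. ennreal (norm (K z) * norm (T (\<lambda>y. f (x - z - y)))) \<partial>lborel)"
proof (rule tempered_translate_perturbation)
  fix C L :: real and N
  assume C0: "0 \<le> C" and L0: "0 \<le> L"
    and pert: "\<And>w w'. norm (T (\<lambda>y. f (w - y)) - T (\<lambda>y. f (w' - y))) \<le> C * (L * norm (w - w') * (1 + norm w) ^ N * (1 + norm (w - w')) ^ N)"
    and bnd: "\<And>g B. g \<in> schwartz \<Longrightarrow> (\<And>vs x. set vs \<subseteq> Basis \<Longrightarrow> length vs \<le> N \<Longrightarrow> (1 + norm x) ^ N * norm (dderiv vs g x) \<le> B) \<Longrightarrow> norm (T g) \<le> C * B"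
    and key: "\<And>vs w w' y. set vs \<subseteq> Basis \<Longrightarrow> length vs \<le> N \<Longrightarrow> (1 + norm y) ^ N * norm (dderiv vs f (w - y) - dderiv vs f (w' - y))
       \<le> L * norm (w - w') * (1 + norm w) ^ N * (1 + norm (w - w')) ^ N"
  define g where "g w = T (\<lambda>y. f (w - y))" for w
  have [measurable]: "g \<in> borel_measurable borel"
    unfolding g_def[abs_def] by (intro borel_measurable_continuous_onI tempered_translate_continuous)
  have Ki: "integrable lborel K"
  proof -
    have "integrable lborel (\<lambda>z. norm (K z))" using Kint[of 0] by simp
    then show ?thesis by (subst (asm) integrable_norm_iff) auto
  qed
  \<comment> \<open>The bound \<open>2 * norm z\<close>, uniform in \<open>n\<close>, is what
    provides an integrable majorant; it is the source of the 3 in \<open>Dom\<close>.\<close>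
  obtain r :: "nat \<Rightarrow> 'a \<Rightarrow> 'a" where r: "\<And>n. simple_function lborel (r n)" "\<And>z. (\<lambda>n. r n z) \<longlonglongrightarrow> z" "\<And>n z. norm (r n z) \<le> 2 * norm z"
    using borel_measurable_implies_sequence_metric[of "\<lambda>z::'a. z" lborel 0] by auto
  have rm [measurable]: "r n \<in> borel_measurable borel" for n
    using borel_measurable_simple_function[OF r(1)[of n]] by simp
  \<comment> \<open>The error at \<open>z\<close> of replacing the translate by \<open>x - z\<close>
    with the translate by \<open>x - r n z\<close>, uniform over the seminorms seen by
    \<open>T\<close>.\<close>
  define D where "D n z = norm (K z) * (L * norm (r n z - z) * (1 + norm (x - z)) ^ N * (1 + norm (r n z - z)) ^ N)" for n z
  have D0: "0 \<le> D n z" for n z using L0 by (simp add: D_def)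
  have Dm [measurable]: "D n \<in> borel_measurable borel" for n unfolding D_def by measurable
  \<comment> \<open>The power \<open>1 + N + N\<close> collects one factor from
    \<open>r n z - z\<close> and \<open>N\<close> from each of the two weights in \<open>D\<close>;
    it is absorbed by the decay of \<open>K\<close>.\<close>
  define Dom where "Dom z = L * 3 * (1 + norm x) ^ N * 3 ^ N * ((1 + norm z) ^ (1 + N + N) * norm (K z))" for z
  have Domi: "integrable lborel Dom" unfolding Dom_def by (intro integrable_mult_right Kint)
  have DDom: "D n z \<le> Dom z" for n z
  proof -
    have "norm (r n z - z) \<le> norm (r n z) + norm z" by (rule norm_triangle_ineq4)
    then have 1: "norm (r n z - z) \<le> 3 * norm z" using r(3)[of n z] by simp
    have 2: "1 + norm (x - z) \<le> (1 + norm x) * (1 + norm z)"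
      using norm_triangle_ineq4[of x z] mult_nonneg_nonneg[OF norm_ge_zero[of x] norm_ge_zero[of z]]
      unfolding distrib_left distrib_right by linarith
    have "L * norm (r n z - z) * (1 + norm (x - z)) ^ N * (1 + norm (r n z - z)) ^ N
       \<le> L * (3 * (1 + norm z)) * ((1 + norm x) * (1 + norm z)) ^ N * (3 * (1 + norm z)) ^ N"
      using 1 2 L0 by (intro mult_mono power_mono) auto
    also have "\<dots> = L * 3 * (1 + norm x) ^ N * 3 ^ N * (1 + norm z) ^ (1 + N + N)"
      by (simp only: power_mult_distrib power_add power_one_right ac_simps)
    finally have "D n z \<le> norm (K z) * (L * 3 * (1 + norm x) ^ N * 3 ^ N * (1 + norm z) ^ (1 + N + N))"
      unfolding D_def by (intro mult_left_mono) auto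
    then show ?thesis by (simp only: Dom_def ac_simps)
  qed
  have Di: "integrable lborel (D n)" for n
    by (rule Bochner_Integration.integrable_bound[OF Domi]) (use D0 DDom in \<open>auto intro!: AE_I2 order_trans[OF DDom]\<close>)
  define E where "E n = (\<integral>z. D n z \<partial>lborel)" for n
  have E0: "0 \<le> E n" for n unfolding E_def by (intro integral_nonneg_AE AE_I2 D0)
  have "E \<longlonglongrightarrow> integral\<^sup>L lborel (\<lambda>z::'a. 0)"
    unfolding E_def
  proof (rule integral_dominated_convergence[OF _ _ Domi])
    have "(\<lambda>n. D n z) \<longlonglongrightarrow> norm (K z) * (L * norm (z - z) * (1 + norm (x - z)) ^ N * (1 + norm (z - z)) ^ N)" for z
      unfolding D_def by (intro tendsto_intros r(2))
    then show "AE z in lborel. (\<lambda>n. D n z) \<longlonglongrightarrow> 0" by simp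
    show "AE z in lborel. norm (D n z) \<le> Dom z" for n using D0 DDom by (intro AE_I2) simp
  qed auto
  then have E: "E \<longlonglongrightarrow> 0" by simp
  \<comment> \<open>The error occurs twice: once when \<open>f\<close> is replaced by the finite sum
    inside \<open>T\<close>, and once when \<open>g (x - r n z)\<close> is replaced by
    \<open>g (x - z)\<close> in the resulting bound.\<close>
  have main: "ennreal (norm (g x)) \<le> (\<integral>\<^sup>+z. ennreal (norm (K z) * norm (g (x - z))) \<partial>lborel) + ennreal (2 * (C * E n))" for n
  proof -
    define W where "W = range (r n)"
    have W: "finite W" "W \<noteq> {}" using simple_functionD(1)[OF r(1)[of n]] by (auto simp: W_def)
    \<comment> \<open>The mass of \<open>K\<close> on a level set of \<open>r n\<close>. With these
      coefficients the finite sum is the convolution evaluated at the rounded shift, and the norm of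
      its image under \<open>T\<close> is bounded by the triangle inequality, without any X-valued
      integral.\<close>
    define c where "c w = (\<integral>z. indicator (r n -` {w}) z *\<^sub>R K z \<partial>lborel)" for w
    have [measurable]: "r n -` {w} \<in> sets borel" for w
      using measurable_sets[OF rm[of n], of "{w}"] by simp
    have ci: "integrable lborel (\<lambda>z. indicator (r n -` {w}) z *\<^sub>R K z)" for w
      by (rule Bochner_Integration.integrable_bound[OF Ki]) (auto simp: indicator_def)
    have collect: "(\<Sum>w\<in>W. indicator (r n -` {w}) z * F w) = F (r n z)" for z and F :: "'a \<Rightarrow> real"
    proof -
      have "(\<Sum>w\<in>W. indicator (r n -` {w}) z * F w) = (\<Sum>w\<in>W. if w = r n z then F w else 0)"
        by (intro sum.cong) (auto simp: indicator_def)
      then show ?thesis using W by (simp add: W_def)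
    qed
    have collectc: "(\<Sum>w\<in>W. (indicator (r n -` {w}) z *\<^sub>R K z) * F w) = K z * F (r n z)" for z and F :: "'a \<Rightarrow> complex"
    proof -
      have "(\<Sum>w\<in>W. (indicator (r n -` {w}) z *\<^sub>R K z) * F w) = (\<Sum>w\<in>W. if w = r n z then K z * F w else 0)"
        by (intro sum.cong) (auto simp: indicator_def)
      then show ?thesis using W by (simp add: W_def)
    qed
    let ?G = "\<lambda>y. \<Sum>w\<in>W. c w * f (x - w - y)"
    have sch: "(\<lambda>y. f (x - w - y)) \<in> schwartz" "(\<lambda>y. f (x - y)) \<in> schwartz" for w by (auto intro: schwartz_reflect f)
    have Gs: "?G \<in> schwartz" using W sch by (intro schwartz_sum) auto
    have ds: "(\<lambda>y. f (x - y) + (- 1) * ?G y) \<in> schwartz"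
      by (intro schwartz_add schwartz_cmult sch Gs)
    have "norm (T (\<lambda>y. f (x - y) + (- 1) * ?G y)) \<le> C * E n"
    proof (rule bnd[OF ds])
      fix vs :: "'a list" and y :: 'a assume vs: "set vs \<subseteq> Basis" "length vs \<le> N"
      let ?d = "dderiv vs f"
      have i1: "integrable lborel (\<lambda>z. K z * ?d (x - y - z))"
        by (rule dderiv_convolution(1)[OF f Ki rep vs(1)]) measurable
      have i2: "integrable lborel (\<lambda>z. K z * ?d (x - y - r n z))"
        by (rule dderiv_convolution(1)[OF f Ki rep vs(1)]) measurable
      have "(\<Sum>w\<in>W. c w * ?d (x - w - y)) = (\<Sum>w\<in>W. \<integral>z. (indicator (r n -` {w}) z *\<^sub>R K z) * ?d (x - w - y) \<partial>lborel)"
        unfolding c_def by (intro sum.cong refl integral_mult_left_zero[symmetric])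
      also have "\<dots> = (\<integral>z. (\<Sum>w\<in>W. (indicator (r n -` {w}) z *\<^sub>R K z) * ?d (x - w - y)) \<partial>lborel)"
        by (rule Bochner_Integration.integral_sum[symmetric]) (intro integrable_mult_left ci)
      also have "\<dots> = (\<integral>z. K z * ?d (x - r n z - y) \<partial>lborel)"
        by (intro Bochner_Integration.integral_cong refl) (rule collectc)
      also have "\<dots> = (\<integral>z. K z * ?d (x - y - r n z) \<partial>lborel)"
        by (intro Bochner_Integration.integral_cong refl) (simp add: algebra_simps)
      finally have s: "(\<Sum>w\<in>W. c w * ?d (x - w - y)) = (\<integral>z. K z * ?d (x - y - r n z) \<partial>lborel)" .
      have "dderiv vs (\<lambda>y. f (x - y) + (- 1) * ?G y) y = (- 1) ^ length vs * (?d (x - y) - (\<Sum>w\<in>W. c w * ?d (x - w - y)))"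
        unfolding dderiv_add[OF sch(2) schwartz_cmult[OF Gs] vs(1)] dderiv_cmult[OF Gs vs(1)] dderiv_sum[OF W(1) sch(1) W(2) vs(1)]
          dderiv_reflect[OF f vs(1)]
        by (simp add: right_diff_distrib sum_distrib_left mult.left_commute sum_negf)
      also have "?d (x - y) - (\<Sum>w\<in>W. c w * ?d (x - w - y)) = (\<integral>z. K z * ?d (x - y - z) \<partial>lborel) - (\<integral>z. K z * ?d (x - y - r n z) \<partial>lborel)"
        unfolding s by (subst dderiv_convolution(2)[OF f Ki rep vs(1)]) simp
      also have "\<dots> = (\<integral>z. K z * ?d (x - y - z) - K z * ?d (x - y - r n z) \<partial>lborel)"
        using i1 i2 by simp
      finally have "norm (dderiv vs (\<lambda>y. f (x - y) + (- 1) * ?G y) y) = norm (\<integral>z. K z * ?d (x - y - z) - K z * ?d (x - y - r n z) \<partial>lborel)"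
        by (simp add: norm_mult norm_power)
      also have "\<dots> \<le> (\<integral>z. D n z / (1 + norm y) ^ N \<partial>lborel)"
      proof (rule order_trans[OF integral_norm_bound integral_mono])
        show "integrable lborel (\<lambda>z. norm (K z * ?d (x - y - z) - K z * ?d (x - y - r n z)))"
          using i1 i2 by (intro integrable_norm Bochner_Integration.integrable_diff)
        show "integrable lborel (\<lambda>z. D n z / (1 + norm y) ^ N)" using Di by (intro integrable_divide) 
        fix z
        have "(1 + norm y) ^ N * norm (?d ((x - z) - y) - ?d ((x - r n z) - y))
           \<le> L * norm ((x - z) - (x - r n z)) * (1 + norm (x - z)) ^ N * (1 + norm ((x - z) - (x - r n z))) ^ N"
          by (rule key[OF vs])
        also have "(x - z) - (x - r n z) = r n z - z" by simp
        finally have k: "norm (K z) * ((1 + norm y) ^ N * norm (?d ((x - z) - y) - ?d ((x - r n z) - y))) \<le> D n z"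
          unfolding D_def by (intro mult_left_mono) auto
        have "norm (K z * ?d (x - y - z) - K z * ?d (x - y - r n z)) = norm (K z) * norm (?d ((x - z) - y) - ?d ((x - r n z) - y))"
        proof -
          have "x - y - z = (x - z) - y" "x - y - r n z = (x - r n z) - y" by (auto simp: algebra_simps)
          then show ?thesis by (simp only: right_diff_distrib[symmetric] norm_mult)
        qed
        then show "norm (K z * ?d (x - y - z) - K z * ?d (x - y - r n z)) \<le> D n z / (1 + norm y) ^ N"
          using k by (simp add: le_divide_eq add_pos_nonneg mult.left_commute mult.commute)
      qed
      also have "\<dots> = E n / (1 + norm y) ^ N" unfolding E_def by simp
      finally show "(1 + norm y) ^ N * norm (dderiv vs (\<lambda>y. f (x - y) + (- 1) * ?G y) y) \<le> E n"
        by (simp add: le_divide_eq add_pos_nonneg mult.commute)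
    qed
    then have 1: "norm (g x - T ?G) \<le> C * E n"
      using tempered_diff[OF T sch(2) Gs] by (simp add: g_def)
    have "norm (T ?G) \<le> (\<Sum>w\<in>W. norm (c w) * norm (g (x - w)))"
      unfolding g_def by (rule tempered_sum_norm_le[OF J T W sch(1)])
    also have "\<dots> \<le> (\<Sum>w\<in>W. (\<integral>z. indicator (r n -` {w}) z * norm (K z) \<partial>lborel) * norm (g (x - w)))"
    proof (intro sum_mono mult_right_mono)
      fix w
      have "norm (c w) \<le> (\<integral>z. norm (indicator (r n -` {w}) z *\<^sub>R K z) \<partial>lborel)" unfolding c_def by (rule integral_norm_bound)
      then show "norm (c w) \<le> (\<integral>z. indicator (r n -` {w}) z * norm (K z) \<partial>lborel)" by simp
    qed simp
    also have "\<dots> = (\<integral>z. (\<Sum>w\<in>W. indicator (r n -` {w}) z * norm (K z) * norm (g (x - w))) \<partial>lborel)"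
    proof -
      have "integrable lborel (\<lambda>z. indicator (r n -` {w}) z * norm (K z))" for w
        using integrable_norm[OF ci[of w]] by simp
      then show ?thesis by (subst Bochner_Integration.integral_sum) auto
    qed
    also have "ennreal \<dots> \<le> (\<integral>\<^sup>+z. ennreal (\<Sum>w\<in>W. indicator (r n -` {w}) z * norm (K z) * norm (g (x - w))) \<partial>lborel)"
      by (subst nn_integral_eq_integral[symmetric])
        (auto intro!: sum_nonneg AE_I2 Bochner_Integration.integrable_sum integrable_mult_left integrable_norm[OF ci, simplified] nn_integral_mono)
    finally have 2: "ennreal (norm (T ?G)) \<le> (\<integral>\<^sup>+z. ennreal (\<Sum>w\<in>W. indicator (r n -` {w}) z * norm (K z) * norm (g (x - w))) \<partial>lborel)"
      by (auto intro: ennreal_leI)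
    also have "\<dots> = (\<integral>\<^sup>+z. ennreal (norm (K z) * norm (g (x - r n z))) \<partial>lborel)"
      using collect[of _ "\<lambda>w. norm (K _) * norm (g (x - w))"]
      by (intro nn_integral_cong) (simp add: mult.assoc collect)
    also have "\<dots> \<le> (\<integral>\<^sup>+z. ennreal (norm (K z) * norm (g (x - z)) + C * D n z) \<partial>lborel)"
    proof (intro nn_integral_mono ennreal_leI)
      fix z
      have "norm (g (x - z) - g (x - r n z)) \<le> C * (L * norm ((x - z) - (x - r n z)) * (1 + norm (x - z)) ^ N * (1 + norm ((x - z) - (x - r n z))) ^ N)"
        unfolding g_def by (rule pert)
      also have "(x - z) - (x - r n z) = r n z - z" by simp
      finally have p: "norm (g (x - z) - g (x - r n z)) \<le> C * (L * norm (r n z - z) * (1 + norm (x - z)) ^ N * (1 + norm (r n z - z)) ^ N)" .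
      have "norm (g (x - r n z)) \<le> norm (g (x - z)) + norm (g (x - z) - g (x - r n z))"
        using norm_triangle_sub[of "g (x - r n z)" "g (x - z)"] by (simp add: norm_minus_commute)
      then have "norm (g (x - r n z)) \<le> norm (g (x - z)) + C * (L * norm (r n z - z) * (1 + norm (x - z)) ^ N * (1 + norm (r n z - z)) ^ N)"
        using p by linarith
      then have "norm (K z) * norm (g (x - r n z)) \<le> norm (K z) * (norm (g (x - z)) + C * (L * norm (r n z - z) * (1 + norm (x - z)) ^ N * (1 + norm (r n z - z)) ^ N))"
        by (intro mult_left_mono) auto
      then show "norm (K z) * norm (g (x - r n z)) \<le> norm (K z) * norm (g (x - z)) + C * D n z"
        by (simp only: D_def distrib_left ac_simps)
    qed
    also have "\<dots> = (\<integral>\<^sup>+z. ennreal (norm (K z) * norm (g (x - z))) \<partial>lborel) + (\<integral>\<^sup>+z. ennreal (C * D n z) \<partial>lborel)"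
      using C0 D0 by (subst nn_integral_add[symmetric]) auto
    also have "(\<integral>\<^sup>+z. ennreal (C * D n z) \<partial>lborel) = ennreal (C * E n)"
      using C0 D0 Di by (subst nn_integral_eq_integral) (auto simp: E_def)
    finally have 2: "ennreal (norm (T ?G)) \<le> (\<integral>\<^sup>+z. ennreal (norm (K z) * norm (g (x - z))) \<partial>lborel) + ennreal (C * E n)" .
    have "norm (g x) \<le> norm (T ?G) + C * E n" using 1 norm_triangle_sub[of "g x" "T ?G"] by linarith
    then have "ennreal (norm (g x)) \<le> ennreal (norm (T ?G)) + ennreal (C * E n)"
      using C0 E0[of n] by (simp add: ennreal_plus[symmetric] ennreal_leI del: ennreal_plus)
    also have "\<dots> \<le> ((\<integral>\<^sup>+z. ennreal (norm (K z) * norm (g (x - z))) \<partial>lborel) + ennreal (C * E n)) + ennreal (C * E n)"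
      by (intro add_right_mono 2)
    also have "\<dots> = (\<integral>\<^sup>+z. ennreal (norm (K z) * norm (g (x - z))) \<partial>lborel) + ennreal (2 * (C * E n))"
      using C0 E0[of n] by (simp add: add.assoc ennreal_plus[symmetric] del: ennreal_plus)
    finally show ?thesis .
  qed
  have "(\<lambda>n. (\<integral>\<^sup>+z. ennreal (norm (K z) * norm (g (x - z))) \<partial>lborel) + ennreal (2 * (C * E n)))
     \<longlonglongrightarrow> (\<integral>\<^sup>+z. ennreal (norm (K z) * norm (g (x - z))) \<partial>lborel) + ennreal (2 * (C * 0))"
    by (intro tendsto_add tendsto_const tendsto_ennrealI tendsto_mult E)
  from LIMSEQ_le_const[OF this] main
  have "ennreal (norm (g x)) \<le> (\<integral>\<^sup>+z. ennreal (norm (K z) * norm (g (x - z))) \<partial>lborel) + ennreal (2 * (C * 0))" by blast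
  then show ?thesis by (simp add: g_def)
qed

end

section \<open>The embeddings\<close>

lemma epow_ennreal: "0 \<le> x \<Longrightarrow> epow (ennreal x) r = ennreal (x powr r)"
  by (simp add: epow_def)

lemma epow_infinity [simp]: "epow \<infinity> r = \<infinity>"
  by (simp add: epow_def)

lemma epow_mono:
  assumes "0 \<le> r" "a \<le> b" shows "epow a r \<le> epow b r"
proof (cases b)
  case (real b')
  then obtain a' where "a = ennreal a'" "0 \<le> a'" "a' \<le> b'"
    using assms(2) by (cases a) (auto simp: top_unique ennreal_le_iff)
  then show ?thesis using real assms(1) by (auto simp: epow_ennreal intro!: ennreal_leI powr_mono2)
qed (simp add: epow_def)

lemma epow_inverse:
  assumes "0 < r" shows "epow (epow a r) (1 / r) = a" "epow (epow a (1 / r)) r = a"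
  using assms by (cases a; simp add: epow_ennreal powr_powr epow_def)+

lemma suminf_ennreal_le_iff_partial:
  fixes z :: "nat \<Rightarrow> ennreal"
  assumes "\<And>M. (\<Sum>k<M. z k) \<le> B" shows "(\<Sum>k. z k) \<le> B"
  unfolding suminf_eq_SUP using assms by (intro SUP_least)

text \<open>With \<open>s\<close> the total sum, each term satisfies
  \<open>z^Q \<le> z * s^(Q-1)\<close>. This reduces the first embedding to the microscopic exponent
  1.\<close>

lemma lq_le_suminf:
  assumes q: "1 \<le> q" shows "lq q z \<le> (\<Sum>k. z k)"
proof (cases "q = \<infinity>")
  case True
  then show ?thesis unfolding lq_def by (auto intro!: SUP_least ennreal_le_suminf_single[OF order_refl])
next
  case False
  define Q where "Q = enn2real q"
  have Q: "1 \<le> Q" using q False unfolding Q_def by (cases q) auto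
  show ?thesis
  proof (cases "\<Sum>k. z k")
    case (real s)
    have zs: "z k \<le> ennreal s" for k using ennreal_le_suminf_single[of "z k" z k] real by simp
    have "epow (z k) Q \<le> z k * ennreal (s powr (Q - 1))" for k
    proof -
      obtain r where r: "z k = ennreal r" "0 \<le> r" "r \<le> s"
        using zs[of k] real(1) by (cases "z k") (auto simp: top_unique)
      have "r powr Q = r * r powr (Q - 1)" using r by (cases "r = 0") (auto simp: powr_diff)
      also have "\<dots> \<le> r * s powr (Q - 1)" using r Q by (intro mult_left_mono powr_mono2) auto
      finally show ?thesis using r by (simp add: epow_ennreal ennreal_mult[symmetric] ennreal_leI)
    qed
    then have "(\<Sum>k. epow (z k) Q) \<le> (\<Sum>k. z k * ennreal (s powr (Q - 1)))"
      by (intro suminf_le) auto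
    also have "\<dots> = ennreal s * ennreal (s powr (Q - 1))" using real by simp
    also have "\<dots> = epow (ennreal s) Q"
      using real(1) by (cases "s = 0") (auto simp: epow_def ennreal_mult[symmetric] powr_diff)
    finally have "epow (\<Sum>k. epow (z k) Q) (1 / Q) \<le> epow (epow (ennreal s) Q) (1 / Q)"
      using Q by (intro epow_mono) auto
    then show ?thesis using False Q real by (simp add: lq_def Q_def[symmetric] epow_inverse)
  qed simp
qed

text \<open>The counterpart at the other end: the second embedding uses no more of the inner
  sequence than its individual terms.\<close>

lemma lq_ge_single:
  assumes q: "1 \<le> q" shows "z k \<le> lq q z"
proof (cases "q = \<infinity>")
  case True
  then show ?thesis unfolding lq_def by (auto intro: SUP_upper)
next
  case False
  define Q where "Q = enn2real q"
  have Q: "1 \<le> Q" using q False unfolding Q_def by (cases q) auto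
  have "epow (epow (z k) Q) (1 / Q) \<le> epow (\<Sum>k. epow (z k) Q) (1 / Q)"
    using Q by (intro epow_mono ennreal_le_suminf_single[of _ _ k]) auto
  then show ?thesis using False Q by (simp add: lq_def Q_def[symmetric] epow_inverse)
qed

text \<open>Passes to real partial sums, to which the estimates for finite sums apply; the supremum
  is then taken out of the integral by monotone convergence.\<close>

lemma epow_suminf_le_SUP:
  fixes z :: "nat \<Rightarrow> real"
  assumes p: "0 < p" and z: "\<And>k. 0 \<le> z k"
  shows "epow (\<Sum>k. ennreal (z k)) p \<le> (SUP M. ennreal ((\<Sum>k<M. z k) powr p))"
proof (cases "SUP M. ennreal ((\<Sum>k<M. z k) powr p)")
  case (real y)
  have "(\<Sum>k<M. ennreal (z k)) \<le> ennreal (y powr (1 / p))" for M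
  proof -
    have "ennreal ((\<Sum>k<M. z k) powr p) \<le> ennreal y" unfolding real(2)[symmetric] by (rule SUP_upper) simp
    then have "(\<Sum>k<M. z k) powr p \<le> y" using real(1) by (simp add: ennreal_le_iff)
    then have "((\<Sum>k<M. z k) powr p) powr (1 / p) \<le> y powr (1 / p)" using p by (intro powr_mono2) auto
    then show ?thesis using p z by (simp add: powr_powr sum_nonneg ennreal_leI)
  qed
  then have "(\<Sum>k. ennreal (z k)) \<le> ennreal (y powr (1 / p))" by (rule suminf_ennreal_le_iff_partial)
  then have "epow (\<Sum>k. ennreal (z k)) p \<le> epow (ennreal (y powr (1 / p))) p" using p by (intro epow_mono) auto
  also have "\<dots> = ennreal y" using p real(1) by (simp add: epow_ennreal powr_powr)
  finally show ?thesis using real by simp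
next
  case top
  show ?thesis unfolding top by simp
qed

lemma dilate_schwartz:
  assumes "\<phi> \<in> schwartz" "t \<noteq> 0" shows "dilate t \<phi> \<in> schwartz"
  unfolding dilate_def using schwartz_cmult[OF schwartz_affine[OF assms, of 0]] by simp

section \<open>Dyadic blocks are dominated by their own averages\<close>

context
  fixes \<phi> :: "'a::euclidean_space \<Rightarrow> complex"
  assumes \<phi>: "\<phi> \<in> schwartz"
    and one: "\<And>\<xi>. norm \<xi> \<le> 1 \<Longrightarrow> ft \<phi> \<xi> = 1"
    and zero: "\<And>\<xi>. norm \<xi> \<ge> 3/2 \<Longrightarrow> ft \<phi> \<xi> = 0"
begin

lemma LP_kernel_schwartz: "ift (phihat \<phi> k) \<in> schwartz"
proof -
  have eq: "ift (phihat \<phi> k) = (\<lambda>x. dilate (2 ^ k) \<phi> x + (if k = 0 then 0 else - 1) * dilate (2 ^ (k - 1)) \<phi> x)"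
    by (rule ext) (simp add: phihat_kernel(1)[OF \<phi> one zero])
  show ?thesis unfolding eq by (intro schwartz_add schwartz_cmult dilate_schwartz \<phi>) auto
qed

lemma LP_continuous:
  assumes T: "tempered J T"
  shows "continuous_on UNIV (LP \<phi> T k)"
  unfolding LP_def[abs_def]
  by (intro continuous_on_scaleR continuous_on_const tempered_translate_continuous[OF T LP_kernel_schwartz])

text \<open>The reproducing kernel at level \<open>k\<close> is a dilate of the single function
  \<open>\<phi>\<close>, so its decay at scale \<open>2^(-k)\<close> has a constant independent of
  \<open>k\<close>, and of \<open>T\<close> since \<open>T\<close> enters only through the blocks.
  The constant is put into the function being averaged, in accordance with
  \<open>dominated\<close>.\<close>

lemma LP_kernel_bound:
  fixes J :: "'b::real_normed_vector \<Rightarrow> 'b"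
  assumes J: "complex_structure J"
  obtains C where "0 < C" "\<And>T k x. tempered J T \<Longrightarrow> ennreal (norm (LP \<phi> T k x)) \<le>
     kernel_conv N (2 ^ k) (\<lambda>y. C * norm (LP \<phi> T k y)) x"
proof -
  let ?c = "(2 * pi) powr (- real DIM('a) / 2)"
  have c: "0 < ?c" by simp
  define N' where "N' = nat \<lceil>N\<rceil>"
  have N': "N \<le> real N'" unfolding N'_def by linarith
  obtain A where A: "0 \<le> A" "\<And>x. norm (dderiv [] \<phi> x) \<le> A * (1 + norm x) powr - real N'"
    by (rule schwartz_decay[OF \<phi>, of "[]" N']) (auto intro: that)
  \<comment> \<open>The factor \<open>2^d\<close> arises because the dilation is by
    \<open>2^(k+1)\<close> while the kernel is normalised at \<open>2^k\<close>; adding 1 makes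
    \<open>C\<close> positive.\<close>
  define C where "C = ?c * 2 ^ DIM('a) * A + 1"
  show ?thesis
  proof (rule that[of C])
    show "0 < C" using A by (simp add: C_def add_nonneg_pos)
    fix T :: "('a \<Rightarrow> complex) \<Rightarrow> 'b" and k and x :: 'a
    assume T: "tempered J T"
    let ?\<theta> = "ift (phihat \<phi> k)"
    define K where "K z = complex_of_real ?c * dilate (2 ^ (k + 1)) \<phi> z" for z
    define G where "G z = T (\<lambda>y. ?\<theta> (z - y))" for z
    have LP: "LP \<phi> T k z = ?c *\<^sub>R G z" for z by (simp only: LP_def G_def)
    have K: "K \<in> schwartz" unfolding K_def[abs_def] by (intro schwartz_cmult dilate_schwartz \<phi>) auto
    have [measurable]: "K \<in> borel_measurable borel" by (rule schwartz_measurable[OF K])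
    have [measurable]: "G \<in> borel_measurable borel" unfolding G_def[abs_def]
      by (intro borel_measurable_continuous_onI tempered_translate_continuous[OF T LP_kernel_schwartz])
    have Kb: "norm (K z) \<le> (2 ^ k) ^ DIM('a) * (1 + 2 ^ k * norm z) powr - N * C" for z
    proof -
      have "norm (\<phi> (2 ^ (k + 1) *\<^sub>R z)) \<le> A * (1 + 2 ^ (k + 1) * norm z) powr - real N'"
        using A(2)[of "2 ^ (k + 1) *\<^sub>R z"] by simp
      also have "\<dots> \<le> A * (1 + 2 ^ k * norm z) powr - N"
      proof (intro mult_left_mono A)
        have "(1 + 2 ^ (k + 1) * norm z) powr - real N' \<le> (1 + 2 ^ (k + 1) * norm z) powr - N"
          using N' by (intro powr_mono) auto
        moreover have "(1 + 2 ^ (k + 1) * norm z) powr - real N' \<le> (1 + 2 ^ k * norm z) powr - real N'"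
          by (intro powr_mono2') (auto simp: add_pos_nonneg mult_right_mono)
        moreover have "(1 + 2 ^ k * norm z) powr - real N' \<le> (1 + 2 ^ k * norm z) powr - N"
          using N' by (intro powr_mono) auto
        ultimately show "(1 + 2 ^ (k + 1) * norm z) powr - real N' \<le> (1 + 2 ^ k * norm z) powr - N" by linarith
      qed
      finally have "?c * (2 ^ (k + 1)) ^ DIM('a) * norm (\<phi> (2 ^ (k + 1) *\<^sub>R z))
         \<le> ?c * (2 ^ (k + 1)) ^ DIM('a) * (A * (1 + 2 ^ k * norm z) powr - N)"
        by (intro mult_left_mono) auto
      then have "norm (K z) \<le> ?c * (2 ^ (k + 1)) ^ DIM('a) * (A * (1 + 2 ^ k * norm z) powr - N)"
        by (simp add: K_def dilate_def norm_mult norm_power)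
      also have "\<dots> = (2 ^ k) ^ DIM('a) * (1 + 2 ^ k * norm z) powr - N * (?c * 2 ^ DIM('a) * A)"
        by (simp only: power_add power_one_right power_mult_distrib ac_simps)
      also have "\<dots> \<le> (2 ^ k) ^ DIM('a) * (1 + 2 ^ k * norm z) powr - N * C"
        by (intro mult_left_mono) (auto simp: C_def)
      finally show ?thesis .
    qed
    have "ennreal (norm (G x)) \<le> (\<integral>\<^sup>+z. ennreal (norm (K z) * norm (G (x - z))) \<partial>lborel)"
      unfolding G_def
    proof (rule tempered_convolution_norm_le[OF T LP_kernel_schwartz J])
      show "K \<in> borel_measurable borel" by (rule schwartz_measurable[OF K])
      show "integrable lborel (\<lambda>z. (1 + norm z) ^ m * norm (K z))" for m
        by (rule schwartz_weighted_integrable[OF K])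
      show "?\<theta> u = (\<integral>z. K z * ?\<theta> (u - z) \<partial>lborel)" for u
        unfolding K_def by (rule phihat_kernel(2)[OF \<phi> one zero, symmetric])
    qed
    then have "ennreal ?c * ennreal (norm (G x)) \<le> ennreal ?c * (\<integral>\<^sup>+z. ennreal (norm (K z) * norm (G (x - z))) \<partial>lborel)"
      by (intro mult_left_mono) auto
    also have "ennreal ?c * ennreal (norm (G x)) = ennreal (norm (LP \<phi> T k x))"
      by (simp add: LP ennreal_mult[symmetric])
    also have "ennreal ?c * (\<integral>\<^sup>+z. ennreal (norm (K z) * norm (G (x - z))) \<partial>lborel)
       = (\<integral>\<^sup>+z. ennreal ?c * ennreal (norm (K z) * norm (G (x - z))) \<partial>lborel)"
      by (rule nn_integral_cmult[symmetric]) measurable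
    also have "\<dots> = (\<integral>\<^sup>+z. ennreal (norm (K z) * norm (LP \<phi> T k (x - z))) \<partial>lborel)"
      by (intro nn_integral_cong) (simp add: LP ennreal_mult[symmetric] mult.left_commute)
    also have "\<dots> = (\<integral>\<^sup>+y. ennreal (norm (K (x - y)) * norm (LP \<phi> T k (x - (x - y)))) \<partial>lborel)"
      unfolding LP by (rule nn_integral_lborel_reflect[symmetric]) measurable
    also have "\<dots> \<le> kernel_conv N (2 ^ k) (\<lambda>y. C * norm (LP \<phi> T k y)) x"
    proof (intro nn_integral_mono ennreal_leI)
      fix y
      have "norm (K (x - y)) * norm (LP \<phi> T k y) \<le> (2 ^ k) ^ DIM('a) * (1 + 2 ^ k * norm (x - y)) powr - N * C * norm (LP \<phi> T k y)"
        by (intro mult_right_mono Kb) auto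
      then show "norm (K (x - y)) * norm (LP \<phi> T k (x - (x - y))) \<le> (2 ^ k) ^ DIM('a) * (1 + 2 ^ k * norm (x - y)) powr - N * (C * norm (LP \<phi> T k y))"
        by (simp add: mult.assoc)
    qed
    finally show "ennreal (norm (LP \<phi> T k x)) \<le>
     kernel_conv N (2 ^ k) (\<lambda>y. C * norm (LP \<phi> T k y)) x" .
  qed
qed

end

section \<open>Besov into Triebel-Lizorkin\<close>

lemma epow_ennreal_mult_le:
  assumes r: "0 \<le> r" and c: "0 < c"
  shows "epow (ennreal c * X) r = ennreal (c powr r) * epow X r"
proof (cases X)
  case (real x)
  then show ?thesis using c by (simp add: ennreal_mult[symmetric] epow_ennreal powr_mult)
next
  case top
  then show ?thesis using c by (simp add: epow_def ennreal_mult_top)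
qed

text \<open>The number \<open>\<delta>\<close> is the Sobolev gap, so the hypothesis on the
  smoothness says \<open>s1 \<le> s0 - \<delta>\<close>. Because \<open>k \<ge> 0\<close>, this
  gives \<open>2^(k s1) \<le> 2^(-k \<delta>) 2^(k s0)\<close>, and
  \<open>weighted_besov_sum\<close> applies to the blocks multiplied by \<open>2^(k s0)\<close>,
  each dominated by \<open>CL\<close> times itself.\<close>

lemma besov_triebel_embedding:
  fixes \<phi> :: "'a::euclidean_space \<Rightarrow> complex" and J :: "'b::real_normed_vector \<Rightarrow> 'b"
  assumes J: "complex_structure J" and \<phi>: "\<phi> \<in> schwartz"
    and one: "\<And>\<xi>. norm \<xi> \<le> 1 \<Longrightarrow> ft \<phi> \<xi> = 1"
    and zero: "\<And>\<xi>. norm \<xi> \<ge> 3/2 \<Longrightarrow> ft \<phi> \<xi> = 0"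
    and p: "1 < p0" "p0 < p1" and q: "1 \<le> q"
    and g0: "\<gamma>0 < real DIM('a) * (p0 - 1)" and g1: "- real DIM('a) < \<gamma>1"
    and gam: "\<gamma>1 / p1 \<le> \<gamma>0 / p0"
    and sob: "s0 - (real DIM('a) + \<gamma>0) / p0 \<ge> s1 - (real DIM('a) + \<gamma>1) / p1"
  shows "\<exists>C::real. \<forall>T :: ('a \<Rightarrow> complex) \<Rightarrow> 'b. tempered J T \<longrightarrow>
            triebel_norm \<phi> s1 p1 q \<gamma>1 T \<le> ennreal C * besov_norm \<phi> s0 p0 (ennreal p1) \<gamma>0 T"
proof -
  define N where "N = real DIM('a) + \<bar>\<gamma>0\<bar> / (p0 - 1) + 1"
  have N: "real DIM('a) + \<bar>\<gamma>0\<bar> / (p0 - 1) < N" by (simp add: N_def)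
  define \<delta> where "\<delta> = (real DIM('a) + \<gamma>0) / p0 - (real DIM('a) + \<gamma>1) / p1"
  have s\<delta>: "s1 \<le> s0 - \<delta>" using sob by (simp add: \<delta>_def)
  have p1: "0 < p1" "1 < p1" using p by auto
  obtain CL where CL: "0 < CL" "\<And>(T :: ('a \<Rightarrow> complex) \<Rightarrow> 'b) k x. tempered J T \<Longrightarrow> ennreal (norm (LP \<phi> T k x)) \<le>
     kernel_conv N (2 ^ k) (\<lambda>y. CL * norm (LP \<phi> T k y)) x"
    using LP_kernel_bound[OF \<phi> one zero J] by blast
  obtain CF where CF: "0 \<le> CF" "\<And>(g::nat \<Rightarrow> 'a \<Rightarrow> real) h b M.
     (\<forall>k. 0 \<le> b k \<and> dominated N p0 \<gamma>0 (2 ^ k) (g k) (h k) (b k powr p0)) \<Longrightarrow>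
     (\<integral>\<^sup>+x. ennreal ((\<Sum>k<M. 2 powr (- real k * \<delta>) * g k x) powr p1 * norm x powr \<gamma>1) \<partial>lborel)
        \<le> ennreal (CF * (\<Sum>k<M. b k powr p1))"
    by (rule weighted_besov_sum[OF p g0 g1 gam N \<delta>_def]) (rule that)
  \<comment> \<open>The summand 1 keeps \<open>C\<close> positive: for an infinite Besov norm the
    right-hand side must be infinite and not \<open>0 * \<infinity> = 0\<close>.\<close>
  define C where "C = CF * CL powr p1 + 1"
  have C: "0 < C" using CF(1) by (simp add: C_def add_nonneg_pos)
  show ?thesis
  proof (intro exI[of _ "C powr (1 / p1)"] allI impI)
    fix T :: "('a \<Rightarrow> complex) \<Rightarrow> 'b" assume T: "tempered J T"
    define a where "a k x = norm (LP \<phi> T k x)" for k x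
    have a0: "0 \<le> a k x" for k x by (simp add: a_def)
    have am [measurable]: "a k \<in> borel_measurable borel" for k
      unfolding a_def[abs_def] by (intro borel_measurable_continuous_onI continuous_on_norm LP_continuous[OF \<phi> one zero T])
    define X where "X k = ennreal (2 powr (real k * s0)) * Lpw p0 \<gamma>0 (LP \<phi> T k)" for k
    have bes: "besov_norm \<phi> s0 p0 (ennreal p1) \<gamma>0 T = epow (\<Sum>k. epow (X k) p1) (1 / p1)"
      using p1 by (simp add: besov_norm_def lq_def X_def)
    show "triebel_norm \<phi> s1 p1 q \<gamma>1 T \<le> ennreal (C powr (1 / p1)) * besov_norm \<phi> s0 p0 (ennreal p1) \<gamma>0 T"
    proof (cases "(\<Sum>k. epow (X k) p1) = \<infinity>")
      case True
      then show ?thesis using C unfolding bes by (simp add: ennreal_mult_top epow_def)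
    next
      case False
      have Xfin: "X k \<noteq> \<infinity>" for k
      proof
        assume "X k = \<infinity>"
        then have "\<infinity> \<le> (\<Sum>k. epow (X k) p1)" by (intro ennreal_le_suminf_single[of _ _ k]) (simp add: epow_def)
        then show False using False by (simp add: top_unique)
      qed
      define b where "b k = enn2real (X k)" for k
      have b: "X k = ennreal (b k)" "0 \<le> b k" for k using Xfin[of k] by (auto simp: b_def ennreal_enn2real_if)
      have I: "weighted_integral p0 \<gamma>0 (a k) = ennreal ((b k / 2 powr (real k * s0)) powr p0)" for k
      proof -
        let ?I = "\<integral>\<^sup>+x. ennreal (a k x powr p0 * norm x powr \<gamma>0) \<partial>lborel"
        have "ennreal (1 / 2 powr (real k * s0)) * X k = Lpw p0 \<gamma>0 (LP \<phi> T k)"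
          by (simp add: X_def mult.assoc[symmetric] ennreal_mult[symmetric])
        then have "Lpw p0 \<gamma>0 (LP \<phi> T k) = ennreal (b k / 2 powr (real k * s0))"
          using b[of k] by (simp add: ennreal_mult[symmetric])
        then have "epow ?I (1 / p0) = ennreal (b k / 2 powr (real k * s0))" by (simp add: Lpw_def a_def)
        then have "epow (epow ?I (1 / p0)) p0 = epow (ennreal (b k / 2 powr (real k * s0))) p0" by simp
        then show ?thesis using p b(2)[of k] by (simp add: epow_inverse epow_ennreal)
      qed
      define h where "h k y = 2 powr (real k * s0) * (CL * a k y)" for k y
      have F: "(\<integral>\<^sup>+x. ennreal ((\<Sum>k<M. 2 powr (- real k * \<delta>) * (2 powr (real k * s0) * a k x)) powr p1 * norm x powr \<gamma>1) \<partial>lborel)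
        \<le> ennreal (CF * (\<Sum>k<M. (CL * b k) powr p1))" for M
      proof (rule CF(2)[of _ _ h]; unfold dominated_def; intro allI conjI)
        show "h k \<in> borel_measurable borel" for k unfolding h_def[abs_def] by measurable
        show "0 \<le> h k y" for k y using CL a0 by (simp add: h_def)
        show "0 \<le> CL * b k" for k using CL b by simp
        show "ennreal (2 powr (real k * s0) * a k x) \<le> kernel_conv N (2 ^ k) (h k) x" for k x
        proof -
          have "ennreal (2 powr (real k * s0) * a k x) = ennreal (2 powr (real k * s0)) * ennreal (a k x)"
            by (simp add: ennreal_mult a0)
          also have "\<dots> \<le> ennreal (2 powr (real k * s0)) * kernel_conv N (2 ^ k) (\<lambda>y. CL * a k y) x"
            unfolding a_def by (intro mult_left_mono CL(2) T) auto
          also have "\<dots> = (\<integral>\<^sup>+y. ennreal (2 powr (real k * s0)) * ennreal ((2 ^ k) ^ DIM('a) * (1 + 2 ^ k * norm (x - y)) powr - N * (CL * a k y)) \<partial>lborel)"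
            by (rule nn_integral_cmult[symmetric]) measurable
          also have "\<dots> = kernel_conv N (2 ^ k) (h k) x"
            using CL a0 by (intro nn_integral_cong) (simp add: ennreal_mult[symmetric] h_def mult.left_commute)
          finally show ?thesis .
        qed
        show "weighted_integral p0 \<gamma>0 (h k) \<le> ennreal ((CL * b k) powr p0)" for k
        proof -
          let ?c = "(2 powr (real k * s0) * CL) powr p0"
          have "weighted_integral p0 \<gamma>0 (h k)
            = (\<integral>\<^sup>+y. ennreal ?c * ennreal (a k y powr p0 * norm y powr \<gamma>0) \<partial>lborel)"
            by (intro nn_integral_cong) (simp add: ennreal_mult[symmetric] h_def powr_mult mult.assoc)
          also have "\<dots> = ennreal ?c * ennreal ((b k / 2 powr (real k * s0)) powr p0)"
            unfolding I[symmetric] by (rule nn_integral_cmult) measurable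
          also have "\<dots> = ennreal ((CL * b k) powr p0)"
          proof -
            have "2 powr (real k * s0) * CL * (b k / 2 powr (real k * s0)) = CL * b k" by simp
            then show ?thesis by (simp only: ennreal_mult[symmetric] powr_ge_zero powr_mult[symmetric])
          qed
          finally show ?thesis by simp
        qed
      qed (use a0 in auto)
      define S where "S M x = (\<Sum>k<M. 2 powr (real k * s1) * a k x)" for M x
      have S0: "0 \<le> S M x" for M x by (simp add: S_def sum_nonneg a0)
      have [measurable]: "S M \<in> borel_measurable borel" for M unfolding S_def[abs_def] by measurable
      have G: "weighted_integral p1 \<gamma>1 (S M) \<le> ennreal C * (\<Sum>k. epow (X k) p1)" for M
      proof -
        have "weighted_integral p1 \<gamma>1 (S M)
          \<le> (\<integral>\<^sup>+x. ennreal ((\<Sum>k<M. 2 powr (- real k * \<delta>) * (2 powr (real k * s0) * a k x)) powr p1 * norm x powr \<gamma>1) \<partial>lborel)"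
        proof (intro nn_integral_mono ennreal_leI mult_right_mono powr_mono2 S0)
          fix x
          show "S M x \<le> (\<Sum>k<M. 2 powr (- real k * \<delta>) * (2 powr (real k * s0) * a k x))"
            unfolding S_def
          proof (intro sum_mono)
            fix k
            have "real k * s1 \<le> real k * (s0 - \<delta>)" by (intro mult_left_mono s\<delta>) auto
            then have "2 powr (real k * s1) \<le> 2 powr (- real k * \<delta> + real k * s0)"
              by (intro powr_mono) (auto simp: algebra_simps)
            then show "2 powr (real k * s1) * a k x \<le> 2 powr (- real k * \<delta>) * (2 powr (real k * s0) * a k x)"
              unfolding mult.assoc[symmetric] powr_add[symmetric] by (intro mult_right_mono a0)
          qed
        qed (use p1 in auto)
        also have "\<dots> \<le> ennreal (CF * (\<Sum>k<M. (CL * b k) powr p1))" by (rule F)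
        also have "\<dots> = ennreal (CF * CL powr p1) * (\<Sum>k<M. epow (X k) p1)"
        proof -
          have "(\<Sum>k<M. epow (X k) p1) = ennreal (\<Sum>k<M. b k powr p1)" by (simp add: b epow_ennreal)
          moreover have "CF * (\<Sum>k<M. (CL * b k) powr p1) = CF * CL powr p1 * (\<Sum>k<M. b k powr p1)"
            by (simp add: powr_mult sum_distrib_left mult.assoc)
          ultimately show ?thesis using CF(1) by (simp add: ennreal_mult[symmetric] sum_nonneg del: sum_ennreal)
        qed
        also have "\<dots> \<le> ennreal C * (\<Sum>k. epow (X k) p1)"
          by (intro mult_mono ennreal_leI sum_le_suminf) (auto simp: C_def)
        finally show ?thesis .
      qed
      have "(\<integral>\<^sup>+x. epow (lq q (\<lambda>k. ennreal (2 powr (real k * s1) * norm (LP \<phi> T k x)))) p1 * ennreal (norm x powr \<gamma>1) \<partial>lborel)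
        \<le> (\<integral>\<^sup>+x. (SUP M. ennreal (S M x powr p1 * norm x powr \<gamma>1)) \<partial>lborel)"
      proof (intro nn_integral_mono)
        fix x
        have "epow (lq q (\<lambda>k. ennreal (2 powr (real k * s1) * norm (LP \<phi> T k x)))) p1
           \<le> epow (\<Sum>k. ennreal (2 powr (real k * s1) * a k x)) p1"
          unfolding a_def using p1 by (intro epow_mono lq_le_suminf q) auto
        also have "\<dots> \<le> (SUP M. ennreal (S M x powr p1))"
          unfolding S_def using p1 a0 by (intro epow_suminf_le_SUP) auto
        finally have "epow (lq q (\<lambda>k. ennreal (2 powr (real k * s1) * norm (LP \<phi> T k x)))) p1 * ennreal (norm x powr \<gamma>1)
           \<le> (SUP M. ennreal (S M x powr p1)) * ennreal (norm x powr \<gamma>1)" by (intro mult_right_mono) auto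
        also have "\<dots> = (SUP M. ennreal (S M x powr p1 * norm x powr \<gamma>1))"
          by (simp add: SUP_mult_right_ennreal[symmetric] ennreal_mult)
        finally show "epow (lq q (\<lambda>k. ennreal (2 powr (real k * s1) * norm (LP \<phi> T k x)))) p1 * ennreal (norm x powr \<gamma>1)
           \<le> (SUP M. ennreal (S M x powr p1 * norm x powr \<gamma>1))" .
      qed
      also have "\<dots> = (SUP M. \<integral>\<^sup>+x. ennreal (S M x powr p1 * norm x powr \<gamma>1) \<partial>lborel)"
      proof (rule nn_integral_monotone_convergence_SUP)
        show "incseq (\<lambda>M x. ennreal (S M x powr p1 * norm x powr \<gamma>1))"
        proof (rule incseq_SucI, rule le_funI)
          fix M x
          have "S M x \<le> S (Suc M) x" by (simp add: S_def a0)
          then show "ennreal (S M x powr p1 * norm x powr \<gamma>1) \<le> ennreal (S (Suc M) x powr p1 * norm x powr \<gamma>1)"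
            using S0 p1 by (intro ennreal_leI mult_right_mono powr_mono2) auto
        qed
      qed measurable
      also have "\<dots> \<le> ennreal C * (\<Sum>k. epow (X k) p1)" by (intro SUP_least G)
      finally have "triebel_norm \<phi> s1 p1 q \<gamma>1 T \<le> epow (ennreal C * (\<Sum>k. epow (X k) p1)) (1 / p1)"
        unfolding triebel_norm_def using p1 by (intro epow_mono) auto
      also have "\<dots> = ennreal (C powr (1 / p1)) * besov_norm \<phi> s0 p0 (ennreal p1) \<gamma>0 T"
        unfolding bes using p1 C by (intro epow_ennreal_mult_le) auto
      finally show ?thesis .
    qed
  qed
qed

section \<open>Triebel-Lizorkin into Besov, by duality\<close>

lemma kernel_convolution_finite:
  fixes N p \<gamma> t :: real and h :: "'a::euclidean_space \<Rightarrow> real"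
  assumes p: "1 < p" and \<gamma>: "\<gamma> < real DIM('a) * (p - 1)"
    and N: "real DIM('a) + \<bar>\<gamma>\<bar> / (p - 1) < N" and t: "1 \<le> t"
    and h: "\<And>y. 0 \<le> h y" "h \<in> borel_measurable borel"
    and fin: "weighted_integral p \<gamma> h < \<infinity>"
  shows "kernel_conv N t h x < \<infinity>"
proof -
  note [measurable] = h(2)
  have "0 \<le> \<bar>\<gamma>\<bar> / (p - 1)" using p by simp
  then have N0: "0 < N" using N DIM_positive[where 'a='a] by linarith
  let ?I = "\<integral>\<^sup>+y. ennreal ((1 + norm (x - y)) powr - N * h y) \<partial>lborel"
  obtain H where H: "0 \<le> H" "weighted_integral p \<gamma> h \<le> ennreal H"
    using fin by (cases "\<integral>\<^sup>+y. ennreal (h y powr p * norm y powr \<gamma>) \<partial>lborel") auto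
  obtain C where C: "0 \<le> C" and
    Cb: "\<And>g h H. (\<forall>x::'a. 0 \<le> g x) \<Longrightarrow> (\<forall>y. 0 \<le> h y) \<Longrightarrow> h \<in> borel_measurable borel \<Longrightarrow> 0 \<le> H \<Longrightarrow>
     (\<forall>x. ennreal (g x) \<le> unit_kernel_conv N h x) \<Longrightarrow>
     weighted_integral p \<gamma> h \<le> ennreal H \<Longrightarrow>
     (\<exists>W. W \<in> borel_measurable borel \<and> (\<forall>x. 0 \<le> W x \<and> W x \<le> H \<and> g x powr p * (1 + norm x) powr \<gamma> \<le> C * W x)
        \<and> (\<integral>\<^sup>+x. ennreal (W x) \<partial>lborel) \<le> ennreal (C * H))"
    by (rule kernel_convolution_weighted_bound[OF p \<gamma> N]) (rule that)
  have I: "?I < \<infinity>"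
  proof (rule ccontr)
    assume "\<not> ?I < \<infinity>"
    then have top: "?I = \<infinity>" by (simp add: not_less top_unique)
    have w: "0 < (1 + norm x) powr \<gamma>" by (simp add: add_nonneg_eq_0_iff)
    \<comment> \<open>If the convolution were infinite at \<open>x\<close>, it would dominate every
      multiple of the indicator of \<open>{x}\<close>, and the pointwise part of
      \<open>kernel_convolution_weighted_bound\<close> would bound all these multiples. This
      \<open>n\<close> is chosen so that \<open>n^p (1 + |x|)^\<gamma>\<close> exceeds
      \<open>C * H\<close>.\<close>
    define n where "n = (C * H / (1 + norm x) powr \<gamma> + 1) powr (1 / p)"
    have n0: "0 \<le> n" by (simp add: n_def)
    have "\<exists>W. W \<in> borel_measurable borel \<and> (\<forall>y. 0 \<le> W y \<and> W y \<le> H \<and> (n * indicator {x} y) powr p * (1 + norm y) powr \<gamma> \<le> C * W y)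
        \<and> (\<integral>\<^sup>+x. ennreal (W x) \<partial>lborel) \<le> ennreal (C * H)"
    proof (rule Cb[OF _ _ h(2) H(1) _ H(2)])
      show "\<forall>y. ennreal (n * indicator {x} y) \<le> unit_kernel_conv N h y"
      proof
        fix y show "ennreal (n * indicator {x} y) \<le> unit_kernel_conv N h y"
          using top by (cases "y = x") auto
      qed
    qed (use h n0 in auto)
    then obtain W where "W x \<le> H" "(n * indicator {x} x) powr p * (1 + norm x) powr \<gamma> \<le> C * W x" by blast
    then have "n powr p * (1 + norm x) powr \<gamma> \<le> C * H"
      using C by (auto intro: order_trans mult_left_mono)
    moreover have "n powr p = C * H / (1 + norm x) powr \<gamma> + 1"
      using p C H w by (simp add: n_def powr_powr)
    ultimately show False using w by (simp add: field_simps)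
  qed
  have "kernel_conv N t h x
     \<le> (\<integral>\<^sup>+y. ennreal (t ^ DIM('a)) * ennreal ((1 + norm (x - y)) powr - N * h y) \<partial>lborel)"
  proof (intro nn_integral_mono)
    fix y
    have "norm (x - y) \<le> t * norm (x - y)" using t by (simp add: mult_le_cancel_right1)
    then have "(1 + t * norm (x - y)) powr - N \<le> (1 + norm (x - y)) powr - N"
      using N0 by (intro powr_mono2') (auto simp: add_pos_nonneg)
    then have "t ^ DIM('a) * (1 + t * norm (x - y)) powr - N * h y \<le> t ^ DIM('a) * ((1 + norm (x - y)) powr - N * h y)"
      unfolding mult.assoc using t h(1) by (intro mult_left_mono mult_right_mono) auto
    then show "ennreal (t ^ DIM('a) * (1 + t * norm (x - y)) powr - N * h y) \<le> ennreal (t ^ DIM('a)) * ennreal ((1 + norm (x - y)) powr - N * h y)"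
      using t h(1) by (simp add: ennreal_mult[symmetric] ennreal_leI)
  qed
  also have "\<dots> = ennreal (t ^ DIM('a)) * ?I" by (rule nn_integral_cmult) measurable
  also have "\<dots> < \<infinity>" using I by (simp add: ennreal_mult_less_top)
  finally show ?thesis .
qed

text \<open>Write \<open>v k\<close> for the \<open>k\<close>-th weighted norm in the Besov quantity
  and pair \<open>a k\<close> with a function \<open>h k\<close> such that the pairing is
  \<open>v k powr p0\<close>. Bounding \<open>a k\<close> by its average and moving the symmetric
  kernel onto \<open>h k\<close> yields \<open>u k\<close>. Summing gives at most \<open>CL\<close>
  times the integral of \<open>A * U\<close>, where \<open>A\<close> is a maximum of weighted blocks
  and \<open>U\<close> is the sum estimated by the first embedding at dual exponents. Hoelder's
  inequality then bounds the partial sum \<open>V\<close> by a multiple of \<open>V^(1/P')\<close>,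
  which is absorbed.\<close>

lemma triebel_besov_embedding:
  fixes \<phi> :: "'a::euclidean_space \<Rightarrow> complex" and J :: "'b::real_normed_vector \<Rightarrow> 'b"
  assumes J: "complex_structure J" and \<phi>: "\<phi> \<in> schwartz"
    and one: "\<And>\<xi>. norm \<xi> \<le> 1 \<Longrightarrow> ft \<phi> \<xi> = 1"
    and zero: "\<And>\<xi>. norm \<xi> \<ge> 3/2 \<Longrightarrow> ft \<phi> \<xi> = 0"
    and p: "1 < p0" "p0 < p1" and q: "1 \<le> q"
    and g0: "\<gamma>0 < real DIM('a) * (p0 - 1)" and g1: "- real DIM('a) < \<gamma>1"
    and gam: "\<gamma>1 / p1 \<le> \<gamma>0 / p0"
    and sob: "s0 - (real DIM('a) + \<gamma>0) / p0 \<ge> s1 - (real DIM('a) + \<gamma>1) / p1"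
  shows "\<exists>C::real. \<forall>T :: ('a \<Rightarrow> complex) \<Rightarrow> 'b. tempered J T \<longrightarrow>
            besov_norm \<phi> s1 p1 (ennreal p0) \<gamma>1 T \<le> ennreal C * triebel_norm \<phi> s0 p0 q \<gamma>0 T"
proof -
  let ?d = "real DIM('a)"
  define P where "P = p1 / (p1 - 1)"
  define P' where "P' = p0 / (p0 - 1)"
  \<comment> \<open>Dual weights, exponent \<open>-\<gamma>/(p-1)\<close>. Conjugation reverses the
    order: the conjugate \<open>P\<close> of \<open>p1\<close> is the smaller exponent, so the
    source of the dual estimate carries the data of \<open>p1\<close> and its target those of
    \<open>p0\<close>.\<close>
  define \<gamma> where "\<gamma> = - \<gamma>1 / (p1 - 1)"
  define G where "G = - \<gamma>0 / (p0 - 1)"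
  have p1: "0 < p1" "1 < p1" using p by auto
  have PP: "1 < P" "P < P'" using p by (auto simp: P_def P'_def field_simps)
  have \<gamma>P: "\<gamma> < ?d * (P - 1)"
  proof -
    have "- \<gamma>1 / (p1 - 1) < ?d / (p1 - 1)" using g1 p1 by (intro divide_strict_right_mono) auto
    then show ?thesis using p1 by (simp add: \<gamma>_def P_def field_simps)
  qed
  have GP: "- ?d < G"
    using g0 p by (simp add: G_def field_simps)
  have GP': "G / P' = - \<gamma>0 / p0" "\<gamma> / P = - \<gamma>1 / p1"
    using p p1 by (auto simp: G_def P'_def \<gamma>_def P_def field_simps)
  have gG: "G / P' \<le> \<gamma> / P" unfolding GP' using gam by simp
  \<comment> \<open>One kernel must decay fast enough both for the dual estimate and for the
    Bernstein inequality that makes each block norm finite.\<close>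
  define N where "N = ?d + max (\<bar>\<gamma>\<bar> / (P - 1)) (\<bar>\<gamma>0\<bar> / (p0 - 1)) + 1"
  have N: "?d + \<bar>\<gamma>\<bar> / (P - 1) < N" "?d + \<bar>\<gamma>0\<bar> / (p0 - 1) < N" by (auto simp: N_def)
  define \<delta> where "\<delta> = (?d + \<gamma>) / P - (?d + G) / P'"
  \<comment> \<open>The dual gap equals the original one: both
    \<open>1/P - 1/P' = 1/p0 - 1/p1\<close> and
    \<open>\<gamma>/P - G/P' = \<gamma>0/p0 - \<gamma>1/p1\<close> are invariant under passing to
    conjugates.\<close>
  have "\<delta> = ?d * (1 / P - 1 / P') + (\<gamma> / P - G / P')"
    by (simp add: \<delta>_def add_divide_distrib right_diff_distrib)
  moreover have "1 / P = 1 - 1 / p1" "1 / P' = 1 - 1 / p0"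
    using p p1 by (auto simp: P_def P'_def field_simps)
  ultimately have "\<delta> = (?d + \<gamma>0) / p0 - (?d + \<gamma>1) / p1"
    by (simp add: GP' add_divide_distrib right_diff_distrib)
  then have s\<delta>: "s1 \<le> s0 - \<delta>" using sob by simp
  obtain CL where CL: "0 < CL" "\<And>(T :: ('a \<Rightarrow> complex) \<Rightarrow> 'b) k x. tempered J T \<Longrightarrow> ennreal (norm (LP \<phi> T k x)) \<le>
     kernel_conv N (2 ^ k) (\<lambda>y. CL * norm (LP \<phi> T k y)) x"
    using LP_kernel_bound[OF \<phi> one zero J] by blast
  obtain CF where CF: "0 \<le> CF" "\<And>(g::nat \<Rightarrow> 'a \<Rightarrow> real) h b M.
     (\<forall>k. 0 \<le> b k \<and> dominated N P \<gamma> (2 ^ k) (g k) (h k) (b k powr P)) \<Longrightarrow>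
     (\<integral>\<^sup>+x. ennreal ((\<Sum>k<M. 2 powr (- real k * \<delta>) * g k x) powr P' * norm x powr G) \<partial>lborel)
        \<le> ennreal (CF * (\<Sum>k<M. b k powr P'))"
    by (rule weighted_besov_sum[OF PP \<gamma>P GP gG N(1) \<delta>_def]) (rule that)
  obtain CE where CE: "0 \<le> CE" and
      CEb: "\<And>t (g::'a \<Rightarrow> real) h H. 0 < t \<Longrightarrow> dominated N p0 \<gamma>0 t g h H \<Longrightarrow>
       weighted_integral p1 \<gamma>1 g
          \<le> ennreal (CE * t powr (p1 * ((?d + \<gamma>0) / p0) - (?d + \<gamma>1)) * H powr (p1 / p0))"
    by (rule kernel_convolution_weighted_embedding[OF p(1) less_imp_le[OF p(2)] g0 N(2) g1 gam]) (rule that)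
  define C where "C = CL * CF powr (1 / P') + 1"
  have C: "0 < C" using CL(1) by (simp add: C_def add_nonneg_pos)
  show ?thesis
  proof (intro exI[of _ C] allI impI)
    fix T :: "('a \<Rightarrow> complex) \<Rightarrow> 'b" assume T: "tempered J T"
    define a where "a k x = norm (LP \<phi> T k x)" for k x
    have a0: "0 \<le> a k x" for k x by (simp add: a_def)
    have am [measurable]: "a k \<in> borel_measurable borel" for k
      unfolding a_def[abs_def] by (intro borel_measurable_continuous_onI continuous_on_norm LP_continuous[OF \<phi> one zero T])
    have aCL: "ennreal (a k x) \<le> kernel_conv N (2 ^ k) (\<lambda>y. CL * a k y) x" for k x
      unfolding a_def by (rule CL(2)[OF T])
    define Y where "Y x = lq q (\<lambda>k. ennreal (2 powr (real k * s0) * a k x))" for x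
    define R where "R = (\<integral>\<^sup>+x. epow (Y x) p0 * ennreal (norm x powr \<gamma>0) \<partial>lborel)"
    have tri: "triebel_norm \<phi> s0 p0 q \<gamma>0 T = epow R (1 / p0)"
      by (simp add: triebel_norm_def R_def Y_def a_def)
    show "besov_norm \<phi> s1 p1 (ennreal p0) \<gamma>1 T \<le> ennreal C * triebel_norm \<phi> s0 p0 q \<gamma>0 T"
    proof (cases R)
      case top
      then show ?thesis using C unfolding tri by (simp add: ennreal_mult_top epow_def)
    next
      case (real Rr)
      have aY: "weighted_integral p0 \<gamma>0 f \<le> ennreal Rr"
        if f: "\<And>x. 0 \<le> f x" "\<And>x. \<exists>k. f x \<le> 2 powr (real k * s0) * a k x" for f
        unfolding real(2)[symmetric] R_def
      proof (intro nn_integral_mono)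
        fix x
        obtain k where "f x \<le> 2 powr (real k * s0) * a k x" using f by blast
        then have "ennreal (f x) \<le> ennreal (2 powr (real k * s0) * a k x)" by (rule ennreal_leI)
        also have "\<dots> \<le> Y x" unfolding Y_def by (rule lq_ge_single[OF q])
        finally have "epow (ennreal (f x)) p0 \<le> epow (Y x) p0" using p by (intro epow_mono) auto
        then show "ennreal (f x powr p0 * norm x powr \<gamma>0) \<le> epow (Y x) p0 * ennreal (norm x powr \<gamma>0)"
          using f(1)[of x] by (simp add: epow_ennreal ennreal_mult mult_right_mono)
      qed
      \<comment> \<open>Qualitative finiteness, with a bound that may depend on \<open>k\<close>.
        The powers of \<open>v k\<close> below and the final absorption make sense only for finite
        norms.\<close>
      have "\<exists>m\<ge>0. weighted_integral p1 \<gamma>1 (a k) = ennreal m" for k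
      proof -
        let ?f = "\<lambda>x. 2 powr (real k * s0) * a k x"
        let ?c = "(CL / 2 powr (real k * s0)) powr p0"
        have "(\<integral>\<^sup>+x. ennreal ((CL * a k x) powr p0 * norm x powr \<gamma>0) \<partial>lborel)
          = (\<integral>\<^sup>+x. ennreal ?c * ennreal (?f x powr p0 * norm x powr \<gamma>0) \<partial>lborel)"
          using CL by (intro nn_integral_cong) (simp add: ennreal_mult[symmetric] powr_mult powr_divide)
        also have "\<dots> = ennreal ?c * (\<integral>\<^sup>+x. ennreal (?f x powr p0 * norm x powr \<gamma>0) \<partial>lborel)"
          by (rule nn_integral_cmult) measurable
        also have "\<dots> \<le> ennreal ?c * ennreal Rr"
          using a0 by (intro mult_left_mono aY) auto
        also have "\<dots> = ennreal (?c * Rr)" using real by (simp add: ennreal_mult)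
        finally have "weighted_integral p1 \<gamma>1 (a k)
          \<le> ennreal (CE * (2 ^ k) powr (p1 * ((?d + \<gamma>0) / p0) - (?d + \<gamma>1)) * (?c * Rr) powr (p1 / p0))"
          using real CL a0 aCL by (intro CEb[of "2 ^ k" "a k" "\<lambda>y. CL * a k y"]) (auto simp: dominated_def)
        then show ?thesis
          by (cases "\<integral>\<^sup>+x. ennreal (a k x powr p1 * norm x powr \<gamma>1) \<partial>lborel") (auto simp: top_unique)
      qed
      then obtain m where m: "\<And>k. 0 \<le> m k" "\<And>k. weighted_integral p1 \<gamma>1 (a k) = ennreal (m k)"
        by metis
      define v where "v k = 2 powr (real k * s1) * m k powr (1 / p1)" for k
      have v0: "0 \<le> v k" for k by (simp add: v_def)
      have vm: "2 powr (real k * s1 * p1) * m k = v k powr p1" for k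
        using p1 m(1)[of k] by (simp add: v_def powr_mult powr_powr)
      have vX: "epow (ennreal (2 powr (real k * s1)) * Lpw p1 \<gamma>1 (LP \<phi> T k)) p0 = ennreal (v k powr p0)" for k
      proof -
        have "Lpw p1 \<gamma>1 (LP \<phi> T k) = ennreal (m k powr (1 / p1))"
          using m by (simp add: Lpw_def a_def[symmetric] epow_ennreal)
        then show ?thesis by (simp add: ennreal_mult[symmetric] epow_ennreal v_def)
      qed
      have bes: "besov_norm \<phi> s1 p1 (ennreal p0) \<gamma>1 T = epow (\<Sum>k. ennreal (v k powr p0)) (1 / p0)"
        using p by (simp add: besov_norm_def lq_def vX)
      \<comment> \<open>Up to scaling, \<open>a^(p1-1) |y|^\<gamma>1\<close> is the function at
        which Hoelder's inequality is an equality. The factor \<open>v^(p0-p1)\<close> makes the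
        pairing equal to \<open>v^p0\<close> and the dual norm equal to \<open>v^(p0-1)\<close>. For
        \<open>v k = 0\<close> the convention \<open>0 powr x = 0\<close> gives
        \<open>h k = 0\<close>, as it should.\<close>
      define h where "h k y = 2 powr (real k * s1 * (p1 - 1)) * a k y powr (p1 - 1) * norm y powr \<gamma>1 * v k powr (p0 - p1)" for k y
      have h0: "0 \<le> h k y" for k y by (simp add: h_def)
      have hm [measurable]: "h k \<in> borel_measurable borel" for k unfolding h_def[abs_def] by measurable
      have hI: "weighted_integral P \<gamma> (h k) = ennreal ((v k powr (p0 - 1)) powr P)" for k
      proof -
        have e: "(p1 - 1) * P = p1" "\<gamma>1 * P + \<gamma> = \<gamma>1"
        proof -
          have "\<gamma>1 * P + \<gamma> = \<gamma>1 * (p1 - 1) / (p1 - 1)"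
            by (simp add: P_def \<gamma>_def diff_divide_distrib right_diff_distrib)
          then show "\<gamma>1 * P + \<gamma> = \<gamma>1" using p1 by simp
        qed (use p1 in \<open>simp add: P_def\<close>)
        have "h k y powr P * norm y powr \<gamma> = (v k powr ((p0 - p1) * P) * 2 powr (real k * s1 * p1)) * (a k y powr p1 * norm y powr \<gamma>1)" for y
        proof -
          have hP: "h k y powr P = 2 powr (real k * s1 * ((p1 - 1) * P)) * a k y powr ((p1 - 1) * P) * norm y powr (\<gamma>1 * P) * v k powr ((p0 - p1) * P)"
            by (simp only: h_def powr_mult powr_powr mult.assoc)
          have w: "norm y powr \<gamma>1 = norm y powr (\<gamma>1 * P) * norm y powr \<gamma>"
            unfolding powr_add[symmetric] e ..
          show ?thesis unfolding hP w e(1) by (simp only: ac_simps)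
        qed
        then have "weighted_integral P \<gamma> (h k)
          = (\<integral>\<^sup>+y. ennreal (v k powr ((p0 - p1) * P) * 2 powr (real k * s1 * p1)) * ennreal (a k y powr p1 * norm y powr \<gamma>1) \<partial>lborel)"
          by (intro nn_integral_cong) (simp add: ennreal_mult[symmetric])
        also have "\<dots> = ennreal (v k powr ((p0 - p1) * P) * 2 powr (real k * s1 * p1)) * ennreal (m k)"
          unfolding m(2)[symmetric] by (rule nn_integral_cmult) measurable
        also have "\<dots> = ennreal (v k powr ((p0 - p1) * P) * v k powr p1)"
          using m(1)[of k] by (simp add: ennreal_mult[symmetric] vm[symmetric] mult.assoc)
        also have "v k powr ((p0 - p1) * P) * v k powr p1 = (v k powr (p0 - 1)) powr P"
        proof -
          have "(p0 - p1) * P + p1 = (p0 - 1) * P" using e(1) by (simp add: algebra_simps)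
          then show ?thesis by (simp only: powr_add[symmetric] powr_powr)
        qed
        finally show ?thesis .
      qed
      define u where "u k x = enn2real (kernel_conv N (2 ^ k) (h k) x)" for k x
      have u0: "0 \<le> u k x" for k x by (simp add: u_def)
      have um [measurable]: "u k \<in> borel_measurable borel" for k unfolding u_def[abs_def] by measurable
      \<comment> \<open>Passing to reals loses nothing, because
        \<open>kernel_convolution_finite\<close> applies to \<open>h k\<close>.\<close>
      have u: "ennreal (u k x) = kernel_conv N (2 ^ k) (h k) x" for k x
        unfolding u_def using kernel_convolution_finite[OF PP(1) \<gamma>P N(1), of "2 ^ k" "h k" x] h0 hI[of k]
        by (intro ennreal_enn2real) auto
      have V: "(\<Sum>k<M. v k powr p0) \<le> C powr p0 * Rr" for M
      proof -
        define V where "V = (\<Sum>k<M. v k powr p0)"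
        have V0: "0 \<le> V" by (simp add: V_def sum_nonneg)
        define U where "U x = (\<Sum>k<M. 2 powr (- real k * \<delta>) * u k x)" for x
        have U0: "0 \<le> U x" for x by (simp add: U_def sum_nonneg u0)
        have [measurable]: "U \<in> borel_measurable borel" unfolding U_def[abs_def] by measurable
        have UI: "weighted_integral P' G U \<le> ennreal (CF * V)"
        proof -
          have "(p0 - 1) * P' = p0" using p by (simp add: P'_def)
          then have "V = (\<Sum>k<M. (v k powr (p0 - 1)) powr P')" by (simp add: V_def powr_powr)
          moreover have "weighted_integral P' G U \<le> ennreal (CF * (\<Sum>k<M. (v k powr (p0 - 1)) powr P'))"
            unfolding U_def by (rule CF(2)[of _ u h]) (auto simp: dominated_def u0 h0 u hI)
          ultimately show ?thesis by simp
        qed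
        \<comment> \<open>The slot \<open>k = M\<close> holds the value 0. It makes the index set
          nonempty for \<open>M = 0\<close> and the maximum nonnegative; the blocks proper are those
          with \<open>k < M\<close>.\<close>
        define A where "A x = Max ((\<lambda>k. if k = M then 0 else 2 powr (real k * s0) * a k x) ` {..M})" for x
        have A0: "0 \<le> A x" for x unfolding A_def by (intro Max_ge) force+
        have Age: "2 powr (real k * s0) * a k x \<le> A x" if "k < M" for k x
          unfolding A_def using that by (intro Max_ge) force+
        have [measurable]: "A \<in> borel_measurable borel" unfolding A_def[abs_def] by measurable
        have AI: "weighted_integral p0 \<gamma>0 A \<le> ennreal Rr"
        proof (rule aY[OF A0])
          fix x
          have "A x \<in> (\<lambda>k. if k = M then 0 else 2 powr (real k * s0) * a k x) ` {..M}"
            unfolding A_def by (intro Max_in) auto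
          then consider "A x = 0" | k where "A x = 2 powr (real k * s0) * a k x" by (auto split: if_splits)
          then show "\<exists>k. A x \<le> 2 powr (real k * s0) * a k x"
            by cases (use a0 in auto)
        qed
        \<comment> \<open>The transposition step: \<open>a k\<close> is replaced by its average,
          Fubini's theorem exchanges the variables, and the symmetry of the kernel lets the average
          fall on \<open>h k\<close>. The smoothness hypothesis then splits \<open>2^(k s1)\<close>
          between \<open>A\<close> and \<open>U\<close>.\<close>
        have pair: "ennreal (v k powr p0) \<le> (\<integral>\<^sup>+y. ennreal (CL * A y * (2 powr (- real k * \<delta>) * u k y)) \<partial>lborel)" if k: "k < M" for k
        proof -
          let ?k = "\<lambda>x y. (2 ^ k) ^ DIM('a) * (1 + 2 ^ k * norm (x - y)) powr - N"
          have "ennreal (v k powr p0) = ennreal (2 powr (real k * s1 * p1) * v k powr (p0 - p1)) * ennreal (m k)"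
          proof -
            have "v k powr p0 = v k powr p1 * v k powr (p0 - p1)" unfolding powr_add[symmetric] by simp
            also have "\<dots> = 2 powr (real k * s1 * p1) * v k powr (p0 - p1) * m k" unfolding vm[symmetric] by (simp only: ac_simps)
            finally show ?thesis by (simp add: ennreal_mult[symmetric] m(1))
          qed
          also have "\<dots> = (\<integral>\<^sup>+x. ennreal (2 powr (real k * s1 * p1) * v k powr (p0 - p1)) * ennreal (a k x powr p1 * norm x powr \<gamma>1) \<partial>lborel)"
            unfolding m(2)[symmetric] by (rule nn_integral_cmult[symmetric]) measurable
          also have "\<dots> = (\<integral>\<^sup>+x. ennreal (2 powr (real k * s1)) * (ennreal (h k x) * ennreal (a k x)) \<partial>lborel)"
          proof (intro nn_integral_cong)
            fix x
            have "a k x powr p1 = a k x powr (p1 - 1) * a k x"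
              using a0[of k x] by (cases "a k x = 0") (auto simp: powr_diff)
            moreover have "2 powr (real k * s1 * p1) = 2 powr (real k * s1) * 2 powr (real k * s1 * (p1 - 1))"
              unfolding powr_add[symmetric] by (simp add: algebra_simps)
            ultimately have "2 powr (real k * s1 * p1) * v k powr (p0 - p1) * (a k x powr p1 * norm x powr \<gamma>1)
              = 2 powr (real k * s1) * (h k x * a k x)" unfolding h_def by (simp only: ac_simps)
            then show "ennreal (2 powr (real k * s1 * p1) * v k powr (p0 - p1)) * ennreal (a k x powr p1 * norm x powr \<gamma>1)
              = ennreal (2 powr (real k * s1)) * (ennreal (h k x) * ennreal (a k x))"
              using a0 h0 by (simp add: ennreal_mult[symmetric])
          qed
          also have "\<dots> \<le> (\<integral>\<^sup>+x. ennreal (2 powr (real k * s1)) * (ennreal (h k x) * (\<integral>\<^sup>+y. ennreal (?k x y * (CL * a k y)) \<partial>lborel)) \<partial>lborel)"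
            by (intro nn_integral_mono mult_left_mono aCL) auto
          also have "\<dots> = (\<integral>\<^sup>+x. (\<integral>\<^sup>+y. ennreal (2 powr (real k * s1) * CL * a k y * (?k x y * h k x)) \<partial>lborel) \<partial>lborel)"
          proof (rule nn_integral_cong)
            fix x
            have "(\<integral>\<^sup>+y. ennreal (2 powr (real k * s1) * CL * a k y * (?k x y * h k x)) \<partial>lborel)
              = (\<integral>\<^sup>+y. ennreal (2 powr (real k * s1) * h k x) * ennreal (?k x y * (CL * a k y)) \<partial>lborel)"
              using CL a0 h0 by (intro nn_integral_cong) (simp add: ennreal_mult[symmetric] ac_simps)
            also have "\<dots> = ennreal (2 powr (real k * s1) * h k x) * (\<integral>\<^sup>+y. ennreal (?k x y * (CL * a k y)) \<partial>lborel)"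
              by (rule nn_integral_cmult) measurable
            finally show "ennreal (2 powr (real k * s1)) * (ennreal (h k x) * (\<integral>\<^sup>+y. ennreal (?k x y * (CL * a k y)) \<partial>lborel))
              = (\<integral>\<^sup>+y. ennreal (2 powr (real k * s1) * CL * a k y * (?k x y * h k x)) \<partial>lborel)"
              using h0 by (simp add: ennreal_mult mult.assoc)
          qed
          also have "\<dots> = (\<integral>\<^sup>+y. (\<integral>\<^sup>+x. ennreal (2 powr (real k * s1) * CL * a k y * (?k x y * h k x)) \<partial>lborel) \<partial>lborel)"
            by (rule lborel_pair.Fubini') measurable
          also have "\<dots> = (\<integral>\<^sup>+y. ennreal (2 powr (real k * s1) * CL * a k y * u k y) \<partial>lborel)"
          proof (rule nn_integral_cong)
            fix y
            have "(\<integral>\<^sup>+x. ennreal (2 powr (real k * s1) * CL * a k y * (?k x y * h k x)) \<partial>lborel)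
              = (\<integral>\<^sup>+x. ennreal (2 powr (real k * s1) * CL * a k y) * ennreal (?k y x * h k x) \<partial>lborel)"
              using CL a0 h0 by (intro nn_integral_cong) (simp add: ennreal_mult[symmetric] norm_minus_commute)
            also have "\<dots> = ennreal (2 powr (real k * s1) * CL * a k y) * ennreal (u k y)"
              unfolding u by (rule nn_integral_cmult) measurable
            finally show "(\<integral>\<^sup>+x. ennreal (2 powr (real k * s1) * CL * a k y * (?k x y * h k x)) \<partial>lborel) = ennreal (2 powr (real k * s1) * CL * a k y * u k y)"
              using CL a0 u0 by (simp add: ennreal_mult)
          qed
          also have "\<dots> \<le> (\<integral>\<^sup>+y. ennreal (CL * A y * (2 powr (- real k * \<delta>) * u k y)) \<partial>lborel)"
          proof (intro nn_integral_mono ennreal_leI)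
            fix y
            have "real k * s1 \<le> real k * (s0 - \<delta>)" by (intro mult_left_mono s\<delta>) auto
            then have "2 powr (real k * s1) \<le> 2 powr (- real k * \<delta> + real k * s0)"
              by (intro powr_mono) (auto simp: algebra_simps)
            then have "2 powr (real k * s1) * a k y \<le> 2 powr (- real k * \<delta>) * (2 powr (real k * s0) * a k y)"
              unfolding mult.assoc[symmetric] powr_add[symmetric] by (intro mult_right_mono a0)
            also have "\<dots> \<le> 2 powr (- real k * \<delta>) * A y" by (intro mult_left_mono Age k) auto
            finally have "CL * u k y * (2 powr (real k * s1) * a k y) \<le> CL * u k y * (2 powr (- real k * \<delta>) * A y)"
              using CL u0 by (intro mult_left_mono) auto
            then show "2 powr (real k * s1) * CL * a k y * u k y \<le> CL * A y * (2 powr (- real k * \<delta>) * u k y)"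
              by (simp only: ac_simps)
          qed
          finally show ?thesis .
        qed
        have "ennreal V = (\<Sum>k<M. ennreal (v k powr p0))" by (simp add: V_def)
        also have "\<dots> \<le> (\<Sum>k<M. \<integral>\<^sup>+y. ennreal (CL * A y * (2 powr (- real k * \<delta>) * u k y)) \<partial>lborel)"
          by (intro sum_mono pair) auto
        also have "\<dots> = (\<integral>\<^sup>+y. (\<Sum>k<M. ennreal (CL * A y * (2 powr (- real k * \<delta>) * u k y))) \<partial>lborel)"
          by (rule nn_integral_sum[symmetric]) measurable
        also have "\<dots> = (\<integral>\<^sup>+y. ennreal CL * ennreal (A y * U y) \<partial>lborel)"
        proof (rule nn_integral_cong)
          fix y
          have "(\<Sum>k<M. ennreal (CL * A y * (2 powr (- real k * \<delta>) * u k y))) = ennreal (\<Sum>k<M. CL * A y * (2 powr (- real k * \<delta>) * u k y))"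
            using CL(1) A0 u0 by (intro sum_ennreal) auto
          also have "(\<Sum>k<M. CL * A y * (2 powr (- real k * \<delta>) * u k y)) = CL * (A y * U y)"
            by (simp add: U_def sum_distrib_left mult.assoc)
          finally show "(\<Sum>k<M. ennreal (CL * A y * (2 powr (- real k * \<delta>) * u k y))) = ennreal CL * ennreal (A y * U y)"
            using CL(1) A0 U0 by (simp add: ennreal_mult)
        qed
        also have "\<dots> = ennreal CL * (\<integral>\<^sup>+y. ennreal (A y * U y) \<partial>lborel)"
          by (rule nn_integral_cmult) measurable
        finally have V1: "ennreal V \<le> ennreal CL * (\<integral>\<^sup>+y. ennreal (A y * U y) \<partial>lborel)" .
        have "(\<integral>\<^sup>+y. ennreal (A y * U y) \<partial>lborel) = (\<integral>\<^sup>+y. ennreal ((A y * norm y powr (\<gamma>0 / p0)) * (U y * norm y powr (- \<gamma>0 / p0))) \<partial>lborel)"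
        proof (rule nn_integral_cong_AE)
          have eq: "A y * U y = (A y * norm y powr (\<gamma>0 / p0)) * (U y * norm y powr (- \<gamma>0 / p0))" if "y \<noteq> 0" for y
            using that by (simp add: powr_minus field_simps)
          show "AE y in lborel. ennreal (A y * U y) = ennreal ((A y * norm y powr (\<gamma>0 / p0)) * (U y * norm y powr (- \<gamma>0 / p0)))"
            using AE_lborel_singleton[of "0::'a"] by eventually_elim (rule arg_cong[OF eq])
        qed
        also have "\<dots> \<le> ennreal (Rr powr (1 / p0) * (CF * V) powr (1 / P'))"
        proof (rule nn_integral_Holder)
          show "1 < P'" "1 / p0 + 1 / P' = 1" using p by (auto simp: P'_def field_simps)
          have "(A x * norm x powr (\<gamma>0 / p0)) powr p0 = A x powr p0 * norm x powr \<gamma>0" for x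
            using p by (simp add: powr_mult powr_powr)
          then show "(\<integral>\<^sup>+x. ennreal ((A x * norm x powr (\<gamma>0 / p0)) powr p0) \<partial>lborel) \<le> ennreal Rr" using AI by simp
          have "- \<gamma>0 / p0 * P' = G" using p by (simp add: P'_def G_def)
          then have "(U x * norm x powr (- \<gamma>0 / p0)) powr P' = U x powr P' * norm x powr G" for x
            by (simp only: powr_mult powr_powr)
          then show "(\<integral>\<^sup>+x. ennreal ((U x * norm x powr (- \<gamma>0 / p0)) powr P') \<partial>lborel) \<le> ennreal (CF * V)" using UI by simp
        qed (use p A0 U0 real CF V0 in auto)
        finally have "(\<integral>\<^sup>+y. ennreal (A y * U y) \<partial>lborel) \<le> ennreal (Rr powr (1 / p0) * (CF * V) powr (1 / P'))" .
        with V1 have "ennreal V \<le> ennreal CL * ennreal (Rr powr (1 / p0) * (CF * V) powr (1 / P'))"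
          by (rule order_trans[OF _ mult_left_mono]) simp
        then have VV: "V \<le> CL * (Rr powr (1 / p0) * (CF * V) powr (1 / P'))"
          using CL by (simp add: ennreal_mult[symmetric] ennreal_le_iff)
        \<comment> \<open>Absorption: as \<open>V\<close> is a finite partial sum of finite terms, a
          positive \<open>V\<close> may be divided by \<open>V^(1/P') = V^(1 - 1/p0)\<close>. The
          result does not depend on \<open>M\<close>.\<close>
        have "V \<le> C powr p0 * Rr"
        proof (cases "V = 0")
          case False
          then have Vp: "0 < V" using V0 by simp
          have "1 / P' = 1 - 1 / p0" using p by (auto simp: P'_def field_simps)
          then have "V powr (1 / p0) * V powr (1 / P') = V" using Vp by (simp add: powr_add[symmetric])
          then have "V powr (1 / p0) * V powr (1 / P') \<le> (CL * CF powr (1 / P') * Rr powr (1 / p0)) * V powr (1 / P')"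
            using VV by (simp add: powr_mult ac_simps)
          then have "V powr (1 / p0) \<le> CL * CF powr (1 / P') * Rr powr (1 / p0)"
            using Vp by (simp add: mult_le_cancel_right)
          also have "\<dots> \<le> C * Rr powr (1 / p0)" by (intro mult_right_mono) (auto simp: C_def)
          finally have "(V powr (1 / p0)) powr p0 \<le> (C * Rr powr (1 / p0)) powr p0"
            using p by (intro powr_mono2) auto
          then show ?thesis using p Vp real(1) by (simp add: powr_powr powr_mult)
        qed (use real in simp)
        then show ?thesis by (simp add: V_def)
      qed
      have "besov_norm \<phi> s1 p1 (ennreal p0) \<gamma>1 T \<le> epow (ennreal (C powr p0 * Rr)) (1 / p0)"
        unfolding bes using p V by (intro epow_mono suminf_ennreal_le_iff_partial) (auto intro!: ennreal_leI)
      also have "\<dots> = ennreal C * triebel_norm \<phi> s0 p0 q \<gamma>0 T"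
        unfolding tri real(2) using p C real(1) by (simp add: epow_ennreal powr_mult powr_powr ennreal_mult[symmetric])
      finally show ?thesis .
    qed
  qed
qed

theorem theorem6p4:
  fixes J :: "'b::banach \<Rightarrow> 'b"
    and \<phi> :: "'a::euclidean_space \<Rightarrow> complex"
    and p0 p1 s0 s1 \<gamma>0 \<gamma>1 :: real and q :: ennreal
  assumes X: "complex_structure J"
    and phi_S: "\<phi> \<in> schwartz"
    and phi_hat: "\<And>\<xi>. Im (ft \<phi> \<xi>) = 0 \<and> 0 \<le> Re (ft \<phi> \<xi>) \<and> Re (ft \<phi> \<xi>) \<le> 1"
    and phi_one: "\<And>\<xi>. norm \<xi> \<le> 1 \<Longrightarrow> ft \<phi> \<xi> = 1"
    and phi_zero: "\<And>\<xi>. norm \<xi> \<ge> 3/2 \<Longrightarrow> ft \<phi> \<xi> = 0"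
    and p: "1 < p0" "p0 < p1"
    and q: "1 \<le> q"
    and g0: "- real DIM('a) < \<gamma>0" "\<gamma>0 < real DIM('a) * (p0 - 1)"
    and g1: "- real DIM('a) < \<gamma>1" "\<gamma>1 < real DIM('a) * (p1 - 1)"
    and gam: "\<gamma>1 / p1 \<le> \<gamma>0 / p0"
    and sob: "s0 - (real DIM('a) + \<gamma>0) / p0 \<ge> s1 - (real DIM('a) + \<gamma>1) / p1"
  shows "(\<exists>C::real. \<forall>T :: ('a \<Rightarrow> complex) \<Rightarrow> 'b. tempered J T \<longrightarrow>
            triebel_norm \<phi> s1 p1 q \<gamma>1 T \<le> ennreal C * besov_norm \<phi> s0 p0 (ennreal p1) \<gamma>0 T)
       \<and> (\<exists>C::real. \<forall>T :: ('a \<Rightarrow> complex) \<Rightarrow> 'b. tempered J T \<longrightarrow>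
            besov_norm \<phi> s1 p1 (ennreal p0) \<gamma>1 T \<le> ennreal C * triebel_norm \<phi> s0 p0 q \<gamma>0 T)"
  using besov_triebel_embedding[OF X phi_S phi_one phi_zero p q g0(2) g1(1) gam sob]
    triebel_besov_embedding[OF X phi_S phi_one phi_zero p q g0(2) g1(1) gam sob]
  by (rule conjI)

end
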